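(* Let $u$ and $v$ be inner functions on $\mathbb{D}$, with $u$ nonconstant, and let $\varphi \in H^2$. The following are equivalent: (i) $\varphi \in \mathscr{M}(u,v)$; (ii) $\varphi\, S^*u \in \mathcal{K}_v$ and $|\varphi|^2\,dm$ is a Carleson measure for $\mathcal{K}_u$; (iii) $\varphi \in \ker T_{\overline{zv}u}$ and $|\varphi|^2\,dm$ is a Carleson measure for $\mathcal{K}_u$. Furthermore, the following are equivalent: (iv) $\varphi \in \mathscr{M}(u,v) \cap H^{\infty}$; (v) $\varphi\, S^*u \in \mathcal{K}_v \cap H^{\infty}$; (vi) $\varphi \in \ker T_{\overline{zv}u} \cap H^{\infty}$.
   Context: $\mathbb{D}$ is the open unit disk, $\mathbb{T}$ the unit circle, $m$ normalized Lebesgue measure on $\mathbb{T}$, $L^2=L^2(\mathbb{T},m)$, $H^2$ the Hardy space of $\mathbb{D}$ (identified with a closed subspace of $L^2$ via boundary values), and $H^\infty$ the bounded analytic functions on $\mathbb{D}$. For an inner function $\Theta$, $\mathcal{K}_{\Theta} := H^2 \cap (\Theta H^2)^{\perp}$. $\mathscr{M}(u,v) := \{\varphi \in \operatorname{Hol}(\mathbb{D}) : \varphi \mathcal{K}_u \subseteq \mathcal{K}_v\}$. $S^*$ is the backward shift, $S^*f(z) = (f(z)-f(0))/z$. For $\psi\in L^\infty(\mathbb{T})$, $T_\psi$ is the Toeplitz operator on $H^2$, $T_\psi f = P_+(\psi f)$, with $P_+$ the orthogonal projection of $L^2$ onto $H^2$; thus $T_{\overline{zv}u}f = P_+(\overline{zv}\,u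 f)$. The measure $|\varphi|^2\,dm$ is a Carleson measure for $\mathcal{K}_u$ if there is a constant $C$ with $\int_{\mathbb{T}} |f|^2|\varphi|^2\,dm \le C\|f\|^2$ for all $f \in \mathcal{K}_u$, where $\|\cdot\|$ is the norm of $L^2$. *)

theory Defs
  imports "HOL-Complex_Analysis.Complex_Analysis"
begin

text \<open>
  Functions on the open unit disk are total functions \<^typ>\<open>complex \<Rightarrow> complex\<close>; their values
  outside \<^term>\<open>ball (0::complex) 1\<close> are irrelevant: none of the notions below depends on them.
  Functions on the unit circle are likewise total functions, regarded up to equality almost
  everywhere with respect to the normalized Lebesgue measure.
\<close>

definition circle_measure :: "complex measure" where
  "circle_measure =
     distr (uniform_measure lborel {0..2*pi}) (restrict_space borel (sphere 0 1)) cis"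

text \<open>Radial boundary values. Where the radial limit does not exist the value is a fixed
  unspecified number; for Hardy space functions this is a null set, by Fatou's theorem.\<close>

definition boundary :: "(complex \<Rightarrow> complex) \<Rightarrow> complex \<Rightarrow> complex" where
  "boundary f \<zeta> = Lim (at_left 1) (\<lambda>r::real. f (of_real r * \<zeta>))"

definition l2_inner :: "(complex \<Rightarrow> complex) \<Rightarrow> (complex \<Rightarrow> complex) \<Rightarrow> complex" where
  "l2_inner F G = (\<integral>\<zeta>. F \<zeta> * cnj (G \<zeta>) \<partial>circle_measure)"

definition l2_norm :: "(complex \<Rightarrow> complex) \<Rightarrow> real" where
  "l2_norm F = sqrt (\<integral>\<zeta>. (norm (F \<zeta>))\<^sup>2 \<partial>circle_measure)"

definition hardy2 :: "(complex \<Rightarrow> complex) set" where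
  "hardy2 = {f. f holomorphic_on ball 0 1 \<and>
     bdd_above ((\<lambda>r::real. \<integral>\<zeta>. (norm (f (of_real r * \<zeta>)))\<^sup>2 \<partial>circle_measure) ` {0..<1})}"

definition hardy_inf :: "(complex \<Rightarrow> complex) set" where
  "hardy_inf = {f. f holomorphic_on ball 0 1 \<and> bounded (f ` ball 0 1)}"

definition inner_function :: "(complex \<Rightarrow> complex) \<Rightarrow> bool" where
  "inner_function \<Theta> \<longleftrightarrow> \<Theta> \<in> hardy_inf \<and>
     (AE \<zeta> in circle_measure.
        \<exists>w. ((\<lambda>r::real. \<Theta> (of_real r * \<zeta>)) \<longlongrightarrow> w) (at_left 1) \<and> norm w = 1)"

definition model_space :: "(complex \<Rightarrow> complex) \<Rightarrow> (complex \<Rightarrow> complex) set" where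
  "model_space \<Theta> =
     {f \<in> hardy2. \<forall>h\<in>hardy2. l2_inner (boundary f) (boundary (\<lambda>z. \<Theta> z * h z)) = 0}"

definition multipliers ::
    "(complex \<Rightarrow> complex) \<Rightarrow> (complex \<Rightarrow> complex) \<Rightarrow> (complex \<Rightarrow> complex) set" where
  "multipliers u v =
     {\<phi>. \<phi> holomorphic_on ball 0 1 \<and> (\<forall>f\<in>model_space u. (\<lambda>z. \<phi> z * f z) \<in> model_space v)}"

text \<open>The value at 0 is the one filling in the removable singularity.\<close>

definition backward_shift :: "(complex \<Rightarrow> complex) \<Rightarrow> complex \<Rightarrow> complex" where
  "backward_shift f z = (if z = 0 then deriv f 0 else (f z - f 0) / z)"

text \<open>The orthogonal projection of \<open>F \<in> L\<^sup>2\<close> onto \<open>H\<^sup>2\<close>, given as a function on the disk. Its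
  defining property determines it uniquely on the disk, but not outside, whence the choice
  operator rather than a definite description.\<close>

definition riesz_projection :: "(complex \<Rightarrow> complex) \<Rightarrow> complex \<Rightarrow> complex" where
  "riesz_projection F =
     (SOME g. g \<in> hardy2 \<and> (\<forall>h\<in>hardy2. l2_inner (\<lambda>\<zeta>. F \<zeta> - boundary g \<zeta>) (boundary h) = 0))"

text \<open>The symbol \<open>\<psi>\<close> is meant to be in \<open>L\<^sup>\<infinity>\<close> of the circle and \<open>f\<close> in \<open>H\<^sup>2\<close>.\<close>

definition toeplitz :: "(complex \<Rightarrow> complex) \<Rightarrow> (complex \<Rightarrow> complex) \<Rightarrow> complex \<Rightarrow> complex" where
  "toeplitz \<psi> f = riesz_projection (\<lambda>\<zeta>. \<psi> \<zeta> * boundary f \<zeta>)"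

definition toeplitz_kernel :: "(complex \<Rightarrow> complex) \<Rightarrow> (complex \<Rightarrow> complex) set" where
  "toeplitz_kernel \<psi> = {f \<in> hardy2. \<forall>z\<in>ball 0 1. toeplitz \<psi> f z = 0}"

definition carleson_measure_for :: "complex measure \<Rightarrow> (complex \<Rightarrow> complex) set \<Rightarrow> bool" where
  "carleson_measure_for \<mu> X \<longleftrightarrow>
     (\<exists>C::real. \<forall>f\<in>X. (\<integral>\<^sup>+\<zeta>. ennreal ((norm (boundary f \<zeta>))\<^sup>2) \<partial>\<mu>)
                        \<le> ennreal (C * (l2_norm (boundary f))\<^sup>2))"

end

theory Submission
  imports Defs
begin

text \<open>
  The theorem is about orthogonality on the circle. Let \<open>F = cnj(z v) u \<phi>\<close> there; \<open>\<phi>\<close> is in the kernel of the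
  Toeplitz operator iff \<open>F\<close> is orthogonal to the Hardy space \<open>H\<^sup>2\<close>. Since \<open>|u| = 1\<close> on the circle,
  \<open>\<phi> S* u cnj v = F (1 - u(0) cnj u)\<close>. As \<open>u\<close> is not constant, \<open>|u(0)| < 1\<close>, and both \<open>1 - u(0) cnj u\<close> and
  its inverse are conjugates of bounded analytic functions. Multiplication by such functions preserves the orthogonal
  complement of \<open>H\<^sup>2\<close>, so \<open>\<phi> S* u\<close> is in the model space of \<open>v\<close> iff \<open>F\<close> is orthogonal to \<open>H\<^sup>2\<close>
  (\<open>orthogonal_imp_shift_in_model_space\<close>, \<open>shift_in_model_space_imp_orthogonal\<close>).

  A multiplier maps \<open>S* u\<close>, an element of the model space of \<open>u\<close>, into the model space of \<open>v\<close>, and the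
  uniform boundedness principle makes multiplication by it bounded, which is the Carleson condition
  (\<open>multiplier_imp_carleson\<close>). Conversely, every \<open>f\<close> in the model space of \<open>u\<close> has the form
  \<open>u cnj(z g)\<close> on the circle with \<open>g\<close> in \<open>H\<^sup>2\<close> (\<open>model_space_conjugation\<close>). Then
  \<open>\<phi> f cnj v = F cnj g\<close> annihilates the monomials if \<open>F\<close> is orthogonal to \<open>H\<^sup>2\<close>. The Carleson condition makes the
  boundary function of \<open>\<phi> f\<close> square integrable; by \<open>product_in_hardy2\<close>, \<open>\<phi> f\<close> is then in \<open>H\<^sup>2\<close>. For bounded
  \<open>\<phi>\<close> the Carleson condition is automatic, and if \<open>\<phi> S* u\<close> is bounded then so is \<open>\<phi>\<close>, because
  \<open>|S* u| \<ge> 1 - |u(0)|\<close> on the circle.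

  All of this rests on boundary values: a function in \<open>H\<^sup>2\<close> has radial limits almost everywhere
  (\<open>fatou_radial_limits\<close>), its dilations have an integrable square majorant (\<open>radial_bound\<close>), and it is the
  Poisson integral of its boundary function. The radial limits and the majorant both come from a maximal inequality in the mean
  square (\<open>linearized_maximal_inequality\<close>), which has a short \<open>TT*\<close> proof: the composition of two Poisson kernels is
  again a Poisson kernel, and up to a constant it is dominated by the sum of the two.
\<close>

abbreviation circle_integral :: "(complex \<Rightarrow> 'a::{banach, second_countable_topology}) \<Rightarrow> 'a"
    (binder "\<integral>\<^sub>T" 10) where
  "circle_integral F \<equiv> integral\<^sup>L circle_measure F"

section \<open>Arc length measure and the Cauchy formula\<close>

lemma space_circle [simp]: "space circle_measure = sphere 0 1"
  by (simp add: circle_measure_def space_restrict_space)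

lemma sets_circle [measurable_cong]: "sets circle_measure = sets (restrict_space borel (sphere 0 1))"
  by (simp add: circle_measure_def)

lemma cis_measurable_circle:
  "cis \<in> measurable (uniform_measure lborel {0..2*pi}) (restrict_space borel (sphere 0 1))"
proof (rule measurable_restrict_space2)
  have "continuous_on UNIV cis"
    by (intro continuous_intros)
  then show "cis \<in> borel_measurable (uniform_measure lborel {0..2 * pi})"
    using borel_measurable_continuous_onI by (simp add: measurable_def)
qed auto

lemma emeasure_circle: "emeasure circle_measure (sphere 0 1) = 1"
proof -
  have "emeasure circle_measure (space circle_measure) = emeasure (uniform_measure lborel {0..2*pi}) UNIV"
    unfolding circle_measure_def using cis_measurable_circle
    by (subst emeasure_distr) (auto simp: space_restrict_space sets_restrict_space_iff vimage_def)
  also have "\<dots> = 1"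
    by (subst emeasure_uniform_measure) (auto simp: ennreal_divide_self)
  finally show ?thesis by simp
qed

interpretation circle: finite_measure circle_measure
  by standard (simp add: emeasure_circle)

interpretation circle2: pair_sigma_finite circle_measure circle_measure ..

lemma measure_circle [simp]: "measure circle_measure (sphere 0 1) = 1"
  by (simp add: measure_def emeasure_circle)

lemma circle_measurable_continuous:
  assumes "continuous_on (sphere 0 1) f"
  shows "f \<in> borel_measurable circle_measure"
  using borel_measurable_continuous_on_restrict[OF assms]
  by (simp add: measurable_cong_sets[OF sets_circle refl])

lemma circle_integrable_bounded:
  fixes f :: "complex \<Rightarrow> 'b::{banach, second_countable_topology}"
  assumes "f \<in> borel_measurable circle_measure" "AE w in circle_measure. norm (f w) \<le> B"
  shows "integrable circle_measure f"
  using circle.integrable_const_bound[OF assms(2,1)] .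

lemma circle_integrable_continuous:
  fixes f :: "complex \<Rightarrow> 'b::{banach, second_countable_topology}"
  assumes "continuous_on (sphere 0 1) f"
  shows "integrable circle_measure f"
proof -
  have "bounded (f ` sphere 0 1)"
    by (intro compact_imp_bounded compact_continuous_image assms) simp
  then obtain B where "\<forall>w\<in>sphere 0 1. norm (f w) \<le> B"
    by (auto simp: bounded_iff)
  then show ?thesis
    by (intro circle_integrable_bounded[where B = B] circle_measurable_continuous assms AE_I2) simp
qed

lemma circle_integral_of_contour:
  assumes cont: "continuous_on (sphere 0 1) g"
    and I: "((\<lambda>w. g w / w) has_contour_integral I) (circlepath 0 1)"
  shows "(\<integral>\<^sub>T w. g w) = I / (2 * pi * \<i>)"
proof -
  have gc: "continuous_on {0..2*pi} (\<lambda>t. g (cis t))"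
    by (rule continuous_on_compose2[OF cont]) (auto intro!: continuous_intros)
  have "((\<lambda>t. g (cis t) / cis t * \<i> * cis t) has_integral I) {0..2*pi}"
    using I has_contour_integral_part_circlepath_iff[of 0 "2*pi" "\<lambda>w. g w / w" I 0 1]
    by (simp add: circlepath_def mult_ac)
  then have "((\<lambda>t. \<i> * g (cis t)) has_integral I) {0..2*pi}"
    by (rule has_integral_eq[rotated]) simp
  then have "((\<lambda>t. (1 / \<i>) * (\<i> * g (cis t))) has_integral (1 / \<i>) * I) {0..2*pi}"
    by (rule has_integral_mult_right)
  then have h: "integral {0..2*pi} (\<lambda>t. g (cis t)) = I / \<i>"
    by (simp add: integral_unique)
  have "(\<integral>\<^sub>T w. g w) = (\<integral>t. g (cis t) \<partial>uniform_measure lborel {0..2*pi})"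
    unfolding circle_measure_def
    by (rule integral_distr[OF cis_measurable_circle]) (rule borel_measurable_continuous_on_restrict[OF cont])
  also have "uniform_measure lborel {0..2*pi} = density lborel (\<lambda>t. ennreal (indicator {0..2*pi} t / (2*pi)))"
    unfolding uniform_measure_def
    by (intro density_cong) (auto simp: indicator_def divide_ennreal ennreal_1[symmetric] simp del: ennreal_1)
  also have "(\<integral>t. g (cis t) \<partial>\<dots>) = (\<integral>t. (indicator {0..2*pi} t / (2*pi)) *\<^sub>R g (cis t) \<partial>lborel)"
  proof (rule integral_density)
    have "continuous_on UNIV (\<lambda>t. g (cis t))"
      by (rule continuous_on_compose2[OF cont]) (auto intro!: continuous_intros)
    then show "(\<lambda>t. g (cis t)) \<in> borel_measurable lborel"
      using borel_measurable_continuous_onI by (simp add: measurable_def)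
  qed auto
  also have "\<dots> = (1/(2*pi)) *\<^sub>R (LINT t : {0..2*pi} | lborel. g (cis t))"
    unfolding set_lebesgue_integral_def by (subst integral_scaleR_right[symmetric]) (simp add: mult.commute)
  also have "(LINT t : {0..2*pi} | lborel. g (cis t)) = integral {0..2*pi} (\<lambda>t. g (cis t))"
    by (intro set_borel_integral_eq_integral(2) borel_integrable_atLeastAtMost' gc)
  finally show ?thesis
    unfolding h by (simp add: scaleR_conv_of_real field_simps)
qed

text \<open>On the circle \<open>1 / (w - z) = cnj w / (1 - z * cnj w)\<close>, so this is Cauchy's integral formula with
  \<open>dw\<close> replaced by normalized arc length.\<close>

lemma circle_cauchy:
  assumes "continuous_on (cball 0 1) f" "f holomorphic_on ball 0 1" "norm z < 1"
  shows "(\<integral>\<^sub>T w. f w / (1 - z * cnj w)) = f z"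
proof -
  have eq: "1 / (w - z) = 1 / (1 - z * cnj w) / w" if "w \<in> sphere 0 1" for w
  proof -
    have w: "w * cnj w = 1" "w \<noteq> 0"
      using that complex_norm_square[of w] by auto
    have "(1 - z * cnj w) * w = w - z"
      using w by (simp add: algebra_simps)
    then show ?thesis by (simp add: divide_simps)
  qed
  have "((\<lambda>w. f w / (w - z)) has_contour_integral (2 * of_real pi * \<i> * f z)) (circlepath 0 1)"
    using assms by (intro Cauchy_integral_circlepath) auto
  then have "((\<lambda>w. f w / (1 - z * cnj w) / w) has_contour_integral (2 * of_real pi * \<i> * f z)) (circlepath 0 1)"
  proof (rule has_contour_integral_eq)
    fix w assume "w \<in> path_image (circlepath (0::complex) 1)"
    then show "f w / (w - z) = f w / (1 - z * cnj w) / w"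
      using eq[of w] by (metis (no_types, lifting) divide_divide_eq_left' mult.right_neutral path_image_circlepath_nonneg times_divide_eq_right zero_le_one)
  qed
  moreover have "continuous_on (sphere 0 1) (\<lambda>w. f w / (1 - z * cnj w))"
  proof (intro continuous_intros continuous_on_subset[OF assms(1)])
    show "\<forall>w\<in>sphere 0 1. 1 - z * cnj w \<noteq> 0"
    proof
      fix w :: complex assume "w \<in> sphere 0 1"
      then have "norm (z * cnj w) < 1" using assms(3) by (simp add: norm_mult)
      then show "1 - z * cnj w \<noteq> 0" by auto
    qed
  qed auto
  ultimately show ?thesis
    using circle_integral_of_contour by force
qed

lemma circle_mult_cnj [simp]: "w \<in> sphere 0 1 \<Longrightarrow> w * cnj w = 1"
  using complex_norm_square[of w] by auto

lemma circle_power_cnj: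
  assumes "w \<in> sphere 0 1" "m \<le> n" shows "w ^ n * cnj w ^ m = w ^ (n - m)"
proof -
  have "w ^ n * cnj w ^ m = w ^ (n - m) * (w * cnj w) ^ m"
    using assms(2) by (simp add: power_mult_distrib mult.assoc[symmetric] flip: power_add)
  then show ?thesis using assms by simp
qed

lemma circle_integral_power: "(\<integral>\<^sub>T w. w ^ n) = (if n = 0 then 1 else 0)"
proof -
  have "(\<integral>\<^sub>T w. w ^ n / (1 - 0 * cnj w)) = 0 ^ n"
    by (intro circle_cauchy) (auto intro!: continuous_intros holomorphic_intros)
  then show ?thesis by auto
qed

lemma circle_orthonormal:
  "(\<integral>\<^sub>T w. w ^ n * cnj (w ^ m)) = (if n = m then 1 else 0)"
proof -
  have *: "(\<integral>\<^sub>T w. w ^ n * cnj (w ^ m)) = (if n = m then 1 else 0)" if "m \<le> n" for n m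
  proof -
    have "(\<integral>\<^sub>T w. w ^ n * cnj (w ^ m)) = (\<integral>\<^sub>T w. w ^ (n - m))"
      using that by (intro Bochner_Integration.integral_cong) (auto simp: circle_power_cnj)
    then show ?thesis using that by (simp add: circle_integral_power)
  qed
  show ?thesis
  proof (cases "m \<le> n")
    case False
    have "(\<integral>\<^sub>T w. w ^ n * cnj (w ^ m)) = (\<integral>\<^sub>T w. cnj (w ^ m * cnj (w ^ n)))"
      by (simp add: mult.commute)
    also have "\<dots> = cnj (\<integral>\<^sub>T w. w ^ m * cnj (w ^ n))"
      by (rule Bochner_Integration.integral_cnj)
    finally show ?thesis using False *[of n m] by auto
  qed (rule *)
qed

section \<open>Square integrable functions on the circle\<close>

definition L2 :: "(complex \<Rightarrow> complex) \<Rightarrow> bool" where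
  "L2 F \<longleftrightarrow> F \<in> borel_measurable circle_measure \<and>
     integrable circle_measure (\<lambda>w. (norm (F w))\<^sup>2)"

lemma L2_measurable: "L2 F \<Longrightarrow> F \<in> borel_measurable circle_measure"
  and L2_integrable: "L2 F \<Longrightarrow> integrable circle_measure (\<lambda>w. (norm (F w))\<^sup>2)"
  by (simp_all add: L2_def)

lemma l2_norm_nonneg [simp]: "0 \<le> l2_norm F"
  by (simp add: l2_norm_def)

lemma l2_norm_sq: "(l2_norm F)\<^sup>2 = (\<integral>\<^sub>T w. (norm (F w))\<^sup>2)"
  by (simp add: l2_norm_def)

lemma L2_mono:
  assumes "F \<in> borel_measurable circle_measure" "integrable circle_measure g"
    and "AE w in circle_measure. (norm (F w))\<^sup>2 \<le> g w"
  shows "L2 F"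
  unfolding L2_def using assms
  by (auto intro!: Bochner_Integration.integrable_bound[OF assms(2)] elim!: eventually_mono)

lemma L2_bounded_mult:
  assumes "L2 F" "K \<in> borel_measurable circle_measure"
    and "AE w in circle_measure. norm (K w) \<le> B"
  shows "L2 (\<lambda>w. K w * F w)"
proof (rule L2_mono[where g = "\<lambda>w. B\<^sup>2 * (norm (F w))\<^sup>2"])
  show "(\<lambda>w. K w * F w) \<in> borel_measurable circle_measure"
    using assms(2) L2_measurable[OF assms(1)] by measurable
  show "integrable circle_measure (\<lambda>w. B\<^sup>2 * (norm (F w))\<^sup>2)"
    using assms(1) by (simp add: L2_def)
  show "AE w in circle_measure. (norm (K w * F w))\<^sup>2 \<le> B\<^sup>2 * (norm (F w))\<^sup>2"
    using assms(3) by eventually_elim (auto simp: norm_mult power_mult_distrib intro!: mult_right_mono power_mono)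
qed

lemma L2_cnj: "L2 F \<Longrightarrow> L2 (\<lambda>w. cnj (F w))"
  unfolding L2_def
  by (auto intro!: measurable_compose[OF _ borel_measurable_continuous_onI[of cnj]] continuous_intros)

lemma L2_cmult: "L2 F \<Longrightarrow> L2 (\<lambda>w. c * F w)"
  by (rule L2_bounded_mult[where B = "norm c"]) auto

lemma L2_add:
  assumes "L2 F" "L2 G"
  shows "L2 (\<lambda>w. F w + G w)"
proof (rule L2_mono[where g = "\<lambda>w. 2 * (norm (F w))\<^sup>2 + 2 * (norm (G w))\<^sup>2"])
  show "(\<lambda>w. F w + G w) \<in> borel_measurable circle_measure"
    using assms[THEN L2_measurable] by measurable
  show "integrable circle_measure (\<lambda>w. 2 * (norm (F w))\<^sup>2 + 2 * (norm (G w))\<^sup>2)"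
    using assms by (simp add: L2_def)
  have "(norm (a + b))\<^sup>2 \<le> 2 * (norm a)\<^sup>2 + 2 * (norm b)\<^sup>2" for a b :: complex
  proof -
    have "(norm (a + b))\<^sup>2 \<le> (norm a + norm b)\<^sup>2"
      by (intro power_mono norm_triangle_ineq) simp
    also have "\<dots> \<le> 2 * (norm a)\<^sup>2 + 2 * (norm b)\<^sup>2"
      using sum_squares_bound[of "norm a" "norm b"] by (simp add: power2_sum)
    finally show ?thesis .
  qed
  then show "AE w in circle_measure. (norm (F w + G w))\<^sup>2 \<le> 2 * (norm (F w))\<^sup>2 + 2 * (norm (G w))\<^sup>2"
    by auto
qed

lemma L2_diff:
  assumes "L2 F" "L2 G"
  shows "L2 (\<lambda>w. F w - G w)"
  using L2_add[OF assms(1) L2_cmult[OF assms(2), of "-1"]] by simp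

lemma L2_continuous:
  assumes "continuous_on (sphere 0 1) F"
  shows "L2 F"
  unfolding L2_def
  by (intro conjI circle_measurable_continuous circle_integrable_continuous continuous_intros assms)

lemma L2_norm_mult:
  assumes "L2 F" "L2 G"
  shows "integrable circle_measure (\<lambda>w. norm (F w) * norm (G w))"
proof (rule Bochner_Integration.integrable_bound)
  show "integrable circle_measure (\<lambda>w. (norm (F w))\<^sup>2 + (norm (G w))\<^sup>2)"
    using assms by (simp add: L2_def)
  show "(\<lambda>w. norm (F w) * norm (G w)) \<in> borel_measurable circle_measure"
    using assms[THEN L2_measurable] by measurable
  have "norm a * norm b \<le> (norm a)\<^sup>2 + (norm b)\<^sup>2" for a b :: complex
    using sum_squares_bound[of "norm a" "norm b"]
      mult_nonneg_nonneg[OF norm_ge_zero[of a] norm_ge_zero[of b]] by linarith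
  then show "AE w in circle_measure. norm (norm (F w) * norm (G w)) \<le> norm ((norm (F w))\<^sup>2 + (norm (G w))\<^sup>2)"
    by auto
qed

lemma L2_mult:
  assumes "L2 F" "L2 G"
  shows "integrable circle_measure (\<lambda>w. F w * G w)"
  using L2_norm_mult[OF assms]
  by (rule Bochner_Integration.integrable_bound)
     (use assms[THEN L2_measurable] in \<open>auto simp: norm_mult\<close>)

text \<open>The quadratic polynomial \<open>t \<mapsto> \<integral> (t |F| - |G|)\<^sup>2\<close> is nonnegative; the bound comes out at its minimum.\<close>

lemma l2_cauchy_schwarz:
  assumes "L2 F" "L2 G"
  shows "(\<integral>\<^sub>T w. norm (F w) * norm (G w)) \<le> l2_norm F * l2_norm G"
proof -
  define A where "A = (\<integral>\<^sub>T w. (norm (F w))\<^sup>2)"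
  define B where "B = (\<integral>\<^sub>T w. (norm (G w))\<^sup>2)"
  define I where "I = (\<integral>\<^sub>T w. norm (F w) * norm (G w))"
  have nn: "A \<ge> 0" "B \<ge> 0" "I \<ge> 0" by (auto simp: A_def B_def I_def)
  have q: "0 \<le> t\<^sup>2 * A - 2 * t * I + B" for t
  proof -
    have "0 \<le> (\<integral>\<^sub>T w. (t * norm (F w) - norm (G w))\<^sup>2)" by simp
    also have "\<dots> = (\<integral>\<^sub>T w. t\<^sup>2 * (norm (F w))\<^sup>2 - 2 * t * (norm (F w) * norm (G w)) + (norm (G w))\<^sup>2)"
      by (intro Bochner_Integration.integral_cong) (auto simp: power2_eq_square algebra_simps)
    also have "\<dots> = t\<^sup>2 * A - 2 * t * I + B"
      using assms L2_norm_mult[OF assms] by (simp add: A_def B_def I_def L2_def)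
    finally show ?thesis .
  qed
  have "I\<^sup>2 \<le> A * B"
  proof (cases "A = 0")
    case True
    have "I = 0"
    proof (rule ccontr)
      assume "I \<noteq> 0"
      then show False using q[of "(B + 1) / I"] True nn by simp
    qed
    then show ?thesis using nn by simp
  next
    case False
    then have "A > 0" using nn by simp
    have "0 \<le> A * ((I / A)\<^sup>2 * A - 2 * (I / A) * I + B)" using q[of "I / A"] nn by simp
    also have "\<dots> = A * B - I\<^sup>2" using \<open>A > 0\<close> by (simp add: field_simps power2_eq_square)
    finally show ?thesis by simp
  qed
  then have "sqrt (I\<^sup>2) \<le> sqrt (A * B)" by (rule real_sqrt_le_mono)
  then show ?thesis using nn by (simp add: real_sqrt_mult A_def B_def I_def l2_norm_def)
qed

lemma l2_inner_bound:
  assumes "L2 F" "L2 G"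
  shows "norm (\<integral>\<^sub>T w. F w * G w) \<le> l2_norm F * l2_norm G"
proof -
  have "norm (\<integral>\<^sub>T w. F w * G w) \<le> (\<integral>\<^sub>T w. norm (F w * G w))"
    by (rule integral_norm_bound)
  then show ?thesis using l2_cauchy_schwarz[OF assms] by (simp add: norm_mult)
qed

lemma l2_norm_triangle:
  assumes "L2 F" "L2 G"
  shows "l2_norm (\<lambda>w. F w + G w) \<le> l2_norm F + l2_norm G"
proof (rule power2_le_imp_le)
  have "(l2_norm (\<lambda>w. F w + G w))\<^sup>2 \<le>
      (\<integral>\<^sub>T w. (norm (F w))\<^sup>2 + 2 * (norm (F w) * norm (G w)) + (norm (G w))\<^sup>2)"
    unfolding l2_norm_sq
  proof (rule integral_mono)
    show "integrable circle_measure (\<lambda>w. (norm (F w + G w))\<^sup>2)"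
      using L2_add[OF assms] by (simp add: L2_def)
    show "integrable circle_measure (\<lambda>w. (norm (F w))\<^sup>2 + 2 * (norm (F w) * norm (G w)) + (norm (G w))\<^sup>2)"
      using assms L2_norm_mult[OF assms] by (simp add: L2_def)
    show "(norm (F w + G w))\<^sup>2 \<le> (norm (F w))\<^sup>2 + 2 * (norm (F w) * norm (G w)) + (norm (G w))\<^sup>2" for w
      using power_mono[OF norm_triangle_ineq norm_ge_zero, of "F w" "G w" 2]
      by (simp add: power2_sum)
  qed
  also have "\<dots> = (l2_norm F)\<^sup>2 + 2 * (\<integral>\<^sub>T w. norm (F w) * norm (G w)) + (l2_norm G)\<^sup>2"
    using assms L2_norm_mult[OF assms] by (simp add: L2_def l2_norm_sq)
  also have "\<dots> \<le> (l2_norm F + l2_norm G)\<^sup>2"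
    using l2_cauchy_schwarz[OF assms] by (simp add: power2_sum)
  finally show "(l2_norm (\<lambda>w. F w + G w))\<^sup>2 \<le> (l2_norm F + l2_norm G)\<^sup>2" .
qed simp

lemma l2_norm_cmult: "l2_norm (\<lambda>w. c * F w) = norm c * l2_norm F"
  by (simp add: l2_norm_def norm_mult power_mult_distrib real_sqrt_mult)

lemma l2_norm_cong:
  assumes "\<And>w. w \<in> sphere 0 1 \<Longrightarrow> norm (F w) = norm (G w)" shows "l2_norm F = l2_norm G"
  unfolding l2_norm_def using assms by (intro arg_cong[where f = sqrt] Bochner_Integration.integral_cong) auto

lemma l2_norm_cong_AE:
  assumes "F \<in> borel_measurable circle_measure" "G \<in> borel_measurable circle_measure"
    and "AE w in circle_measure. F w = G w"
  shows "l2_norm F = l2_norm G"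
proof -
  note [measurable] = assms(1,2)
  have "(\<integral>\<^sub>T w. (norm (F w))\<^sup>2) = (\<integral>\<^sub>T w. (norm (G w))\<^sup>2)"
    by (rule integral_cong_AE) (measurable, use assms(3) in \<open>auto elim: eventually_mono\<close>)
  then show ?thesis by (simp add: l2_norm_def)
qed

lemma l2_norm_le:
  assumes "L2 G" "F \<in> borel_measurable circle_measure"
    "AE w in circle_measure. norm (F w) \<le> B * norm (G w)" "B \<ge> 0"
  shows "l2_norm F \<le> B * l2_norm G"
proof (rule power2_le_imp_le)
  have i: "integrable circle_measure (\<lambda>w. B\<^sup>2 * (norm (G w))\<^sup>2)" using assms by (simp add: L2_def)
  have le: "AE w in circle_measure. (norm (F w))\<^sup>2 \<le> B\<^sup>2 * (norm (G w))\<^sup>2"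
    using assms(3) by eventually_elim (simp add: power_mono flip: power_mult_distrib)
  have "(l2_norm F)\<^sup>2 \<le> (\<integral>\<^sub>T w. B\<^sup>2 * (norm (G w))\<^sup>2)"
    unfolding l2_norm_sq
    using L2_mono[OF assms(2) i le]
    by (intro integral_mono_AE i le) (simp add: L2_def)
  then show "(l2_norm F)\<^sup>2 \<le> (B * l2_norm G)\<^sup>2" by (simp add: power_mult_distrib l2_norm_sq)
qed (simp add: assms)

lemma L2_monomial: "L2 (\<lambda>w. w ^ n)"
  by (intro L2_continuous continuous_intros)

lemma cnj_mult_self: "cnj z * z = of_real ((norm z)\<^sup>2)"
  using complex_norm_square[of z] by (simp add: mult.commute)

lemma l2_inner_trig_poly:
  assumes "L2 F"
  shows "(\<integral>\<^sub>T w. F w * cnj (\<Sum>n<N. c n * w ^ n)) =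
    (\<Sum>n<N. cnj (c n) * (\<integral>\<^sub>T w. F w * cnj (w ^ n)))"
proof -
  have *: "integrable circle_measure (\<lambda>w. F w * cnj (w ^ n))" for n
    by (intro L2_mult assms L2_cnj L2_monomial)
  have "(\<integral>\<^sub>T w. F w * cnj (\<Sum>n<N. c n * w ^ n)) =
      (\<integral>\<^sub>T w. (\<Sum>n<N. cnj (c n) * (F w * cnj (w ^ n))))"
    by (simp only: cnj_sum complex_cnj_mult sum_distrib_left mult.left_commute)
  also have "\<dots> = (\<Sum>n<N. (\<integral>\<^sub>T w. cnj (c n) * (F w * cnj (w ^ n))))"
    using * by (intro Bochner_Integration.integral_sum) auto
  finally show ?thesis by simp
qed

lemma l2_norm_trig_poly: "(l2_norm (\<lambda>w. \<Sum>n<N. c n * w ^ n))\<^sup>2 = (\<Sum>n<N. (norm (c n))\<^sup>2)"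
proof -
  let ?p = "\<lambda>w. \<Sum>n<N. c n * w ^ n"
  have p: "L2 ?p" by (intro L2_continuous continuous_intros)
  have "complex_of_real ((l2_norm ?p)\<^sup>2) = (\<integral>\<^sub>T w. ?p w * cnj (?p w))"
    unfolding l2_norm_sq
    by (simp only: cnj_mult_self mult.commute[of _ "cnj _"] integral_complex_of_real)
  also have "\<dots> = (\<Sum>n<N. cnj (c n) * (\<integral>\<^sub>T w. ?p w * cnj (w ^ n)))"
    by (rule l2_inner_trig_poly[OF p])
  also have "\<dots> = (\<Sum>n<N. cnj (c n) * c n)"
  proof (rule sum.cong[OF refl])
    fix n assume n: "n \<in> {..<N}"
    have "(\<integral>\<^sub>T w. w ^ n * cnj (?p w)) = (\<Sum>k<N. cnj (c k) * (if n = k then 1 else 0))"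
      by (simp only: l2_inner_trig_poly[OF L2_monomial] circle_orthonormal)
    also have "\<dots> = cnj (c n)" using n by (simp add: if_distrib cong: if_cong)
    finally have "cnj (\<integral>\<^sub>T w. w ^ n * cnj (?p w)) = c n" by simp
    also have "cnj (\<integral>\<^sub>T w. w ^ n * cnj (?p w)) = (\<integral>\<^sub>T w. cnj (w ^ n * cnj (?p w)))"
      by (rule Bochner_Integration.integral_cnj[symmetric])
    also have "\<dots> = (\<integral>\<^sub>T w. ?p w * cnj (w ^ n))"
      by (simp only: complex_cnj_mult complex_cnj_cnj mult.commute)
    finally show "cnj (c n) * (\<integral>\<^sub>T w. ?p w * cnj (w ^ n)) = cnj (c n) * c n" by simp
  qed
  also have "\<dots> = (\<Sum>n<N. of_real ((norm (c n))\<^sup>2))"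
    by (simp only: cnj_mult_self)
  also have "\<dots> = of_real (\<Sum>n<N. (norm (c n))\<^sup>2)" by simp
  finally show ?thesis unfolding of_real_eq_iff .
qed

text \<open>Pair \<open>F\<close> with its own partial Fourier sum \<open>p\<close>: the pairing equals \<open>\<parallel>p\<parallel>\<^sup>2\<close>, and Cauchy-Schwarz bounds it
  by \<open>\<parallel>F\<parallel> \<parallel>p\<parallel>\<close>.\<close>

lemma bessel_inequality:
  assumes "L2 F"
  shows "(\<Sum>n<N. (norm (\<integral>\<^sub>T w. F w * cnj (w ^ n)))\<^sup>2) \<le> (l2_norm F)\<^sup>2"
proof -
  define c where "c n = (\<integral>\<^sub>T w. F w * cnj (w ^ n))" for n
  define S where "S = (\<Sum>n<N. (norm (c n))\<^sup>2)"
  let ?p = "\<lambda>w. \<Sum>n<N. c n * w ^ n"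
  have p: "L2 ?p" by (intro L2_continuous continuous_intros)
  have S0: "S \<ge> 0" by (simp add: S_def sum_nonneg)
  have "(\<integral>\<^sub>T w. F w * cnj (?p w)) = (\<Sum>n<N. cnj (c n) * c n)"
    by (simp only: l2_inner_trig_poly[OF assms] c_def)
  also have "\<dots> = (\<Sum>n<N. of_real ((norm (c n))\<^sup>2))"
    by (simp only: cnj_mult_self)
  also have "\<dots> = of_real S" by (simp add: S_def)
  finally have "S = norm (\<integral>\<^sub>T w. F w * cnj (?p w))" using S0 by simp
  also have "\<dots> \<le> l2_norm F * l2_norm (\<lambda>w. cnj (?p w))"
    by (rule l2_inner_bound[OF assms L2_cnj[OF p]])
  also have "l2_norm (\<lambda>w. cnj (?p w)) = l2_norm ?p" by (rule l2_norm_cong) (rule complex_mod_cnj)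
  also have "\<dots> = sqrt S" using l2_norm_trig_poly[where c = c and N = N] S0
    by (metis S_def l2_norm_nonneg real_sqrt_unique)
  finally have "sqrt S * sqrt S \<le> l2_norm F * sqrt S" using S0 by simp
  then have "sqrt S \<le> l2_norm F"
    using S0 by (cases "S = 0") (auto simp del: real_sqrt_mult_self simp: mult_le_cancel_right)
  then have "(sqrt S)\<^sup>2 \<le> (l2_norm F)\<^sup>2" using S0 by (intro power_mono) auto
  then show ?thesis using S0 by (simp add: S_def c_def)
qed

section \<open>Taylor coefficients of Hardy space functions\<close>

text \<open>Coefficient sequences are kept as a separate datum, since membership in \<^const>\<open>hardy2\<close> and all norms
  are read off from them.\<close>

definition has_taylor :: "(nat \<Rightarrow> complex) \<Rightarrow> (complex \<Rightarrow> complex) \<Rightarrow> bool" where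
  "has_taylor a f \<longleftrightarrow> (\<forall>z\<in>ball 0 1. (\<lambda>n. a n * z ^ n) sums f z)"

lemma holomorphic_has_taylor:
  assumes "f holomorphic_on ball 0 1"
  obtains a where "has_taylor a f"
proof
  show "has_taylor (\<lambda>n. (deriv ^^ n) f 0 / fact n) f"
    unfolding has_taylor_def using holomorphic_power_series[OF assms] by simp
qed

lemma has_taylor_holomorphic: "has_taylor a f \<Longrightarrow> f holomorphic_on ball 0 1"
  unfolding has_taylor_def by (intro power_series_holomorphic[where a = a]) auto

lemma has_taylor_abs_summable:
  assumes "has_taylor a f" "0 \<le> r" "r < 1"
  shows "summable (\<lambda>n. norm (a n) * r ^ n)"
proof -
  have "of_real ((r + 1) / 2) \<in> ball (0::complex) 1" using assms by simp
  then have "summable (\<lambda>n. a n * of_real ((r + 1) / 2) ^ n)"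
    using assms(1) sums_summable unfolding has_taylor_def by blast
  then have "summable (\<lambda>n. norm (a n * of_real r ^ n))"
    by (rule powser_insidea) (use assms in simp)
  then show ?thesis using assms by (simp add: norm_mult norm_power)
qed

lemma dilation_mem_ball:
  assumes "0 \<le> r" "r < 1" "w \<in> cball 0 1"
  shows "of_real r * (w :: complex) \<in> ball 0 1"
proof -
  have "r * norm w \<le> r * 1" using assms by (intro mult_left_mono) auto
  then show "of_real r * w \<in> ball 0 1" using assms by (simp add: norm_mult)
qed

lemma dilation_continuous:
  assumes "f holomorphic_on ball 0 1" "0 \<le> r" "r < 1"
  shows "continuous_on (cball 0 1) (\<lambda>w. f (of_real r * w))"
  using dilation_mem_ball[OF assms(2,3)]
  by (intro continuous_on_compose2[OF holomorphic_on_imp_continuous_on[OF assms(1)]] continuous_intros) blast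

lemma dilation_continuous_sphere:
  assumes "f holomorphic_on ball 0 1" "0 \<le> r" "r < 1"
  shows "continuous_on (sphere 0 1) (\<lambda>w. f (of_real r * w))"
  using dilation_continuous[OF assms] continuous_on_subset sphere_cball by blast

lemma dilation_holomorphic:
  assumes "f holomorphic_on ball 0 1" "0 \<le> r" "r < 1"
  shows "(\<lambda>w. f (of_real r * w)) holomorphic_on ball 0 1"
  using dilation_mem_ball[OF assms(2,3)] ball_subset_cball
  by (intro holomorphic_on_compose_gen[OF _ assms(1), unfolded o_def] holomorphic_intros) blast

lemma dilation_L2:
  assumes "f holomorphic_on ball 0 1" "0 \<le> r" "r < 1"
  shows "L2 (\<lambda>w. f (of_real r * w))"
  by (intro L2_continuous dilation_continuous_sphere assms)

lemma taylor_partial_sums: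
  assumes "has_taylor a f" "0 \<le> r" "r < 1" "w \<in> sphere 0 1"
  shows "(\<lambda>N. \<Sum>n<N. (a n * of_real r ^ n) * w ^ n) \<longlonglongrightarrow> f (of_real r * w)"
    and "norm (\<Sum>n<N. (a n * of_real r ^ n) * w ^ n) \<le> (\<Sum>n. norm (a n) * r ^ n)"
proof -
  have "of_real r * w \<in> ball 0 1" using assms by (simp add: norm_mult)
  then have "(\<lambda>n. a n * (of_real r * w) ^ n) sums f (of_real r * w)"
    using assms(1) unfolding has_taylor_def by blast
  then show "(\<lambda>N. \<Sum>n<N. (a n * of_real r ^ n) * w ^ n) \<longlonglongrightarrow> f (of_real r * w)"
    by (simp add: sums_def power_mult_distrib mult.assoc)
  have "norm (\<Sum>n<N. (a n * of_real r ^ n) * w ^ n) \<le> (\<Sum>n<N. norm ((a n * of_real r ^ n) * w ^ n))"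
    by (rule norm_sum)
  also have "\<dots> = (\<Sum>n<N. norm (a n) * r ^ n)"
    using assms by (simp add: norm_mult norm_power)
  also have "\<dots> \<le> (\<Sum>n. norm (a n) * r ^ n)"
    by (intro sum_le_suminf has_taylor_abs_summable[OF assms(1-3)]) (use assms in auto)
  finally show "norm (\<Sum>n<N. (a n * of_real r ^ n) * w ^ n) \<le> (\<Sum>n. norm (a n) * r ^ n)" .
qed

text \<open>The Taylor series converges uniformly on the circle of radius \<open>r\<close>, so it may be integrated term
  by term against a monomial.\<close>

lemma dilation_coefficient:
  assumes "has_taylor a f" "0 \<le> r" "r < 1"
  shows "(\<integral>\<^sub>T w. f (of_real r * w) * cnj (w ^ n)) = a n * of_real r ^ n"
proof -
  let ?p = "\<lambda>N w. \<Sum>k<N. (a k * of_real r ^ k) * w ^ k"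
  have "(\<lambda>N. \<integral>\<^sub>T w. ?p N w * cnj (w ^ n)) \<longlonglongrightarrow>
      (\<integral>\<^sub>T w. f (of_real r * w) * cnj (w ^ n))"
  proof (rule integral_dominated_convergence[where w = "\<lambda>_. \<Sum>n. norm (a n) * r ^ n"])
    show "(\<lambda>w. f (of_real r * w) * cnj (w ^ n)) \<in> borel_measurable circle_measure"
      by (intro circle_measurable_continuous continuous_intros dilation_continuous_sphere assms
          has_taylor_holomorphic[OF assms(1)])
    show "(\<lambda>w. ?p N w * cnj (w ^ n)) \<in> borel_measurable circle_measure" for N
      by (intro circle_measurable_continuous continuous_intros)
    show "AE w in circle_measure. (\<lambda>N. ?p N w * cnj (w ^ n)) \<longlonglongrightarrow> f (of_real r * w) * cnj (w ^ n)"
      by (intro AE_I2 tendsto_intros taylor_partial_sums(1) assms) simp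
    show "AE w in circle_measure. norm (?p N w * cnj (w ^ n)) \<le> (\<Sum>n. norm (a n) * r ^ n)" for N
    proof (rule AE_I2)
      fix w assume "w \<in> space circle_measure"
      then show "norm (?p N w * cnj (w ^ n)) \<le> (\<Sum>n. norm (a n) * r ^ n)"
        using taylor_partial_sums(2)[OF assms, of w N] by (simp add: norm_mult norm_power)
    qed
  qed auto
  moreover have "(\<integral>\<^sub>T w. ?p N w * cnj (w ^ n)) = a n * of_real r ^ n" if "N > n" for N
  proof -
    have "(\<integral>\<^sub>T w. ?p N w * cnj (w ^ n)) =
        (\<integral>\<^sub>T w. (\<Sum>k<N. (a k * of_real r ^ k) * (w ^ k * cnj (w ^ n))))"
      by (simp only: sum_distrib_right mult.assoc)
    also have "\<dots> = (\<Sum>k<N. \<integral>\<^sub>T w. (a k * of_real r ^ k) * (w ^ k * cnj (w ^ n)))"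
      by (rule Bochner_Integration.integral_sum) (intro circle_integrable_continuous continuous_intros)
    also have "\<dots> = (\<Sum>k<N. (a k * of_real r ^ k) * (if k = n then 1 else 0))"
      by (simp only: integral_mult_right_zero circle_orthonormal)
    also have "\<dots> = a n * of_real r ^ n" using that by (simp add: if_distrib cong: if_cong)
    finally show ?thesis .
  qed
  then have "(\<lambda>N. \<integral>\<^sub>T w. ?p N w * cnj (w ^ n)) \<longlonglongrightarrow> a n * of_real r ^ n"
    by (intro tendsto_eventually eventually_sequentiallyI[of "Suc n"]) simp
  ultimately show ?thesis by (rule LIMSEQ_unique)
qed

text \<open>A fixed sequence in the interval from 0 to 1, tending to 1, along which dominated convergence is applied.\<close>

definition radius :: "nat \<Rightarrow> real" where "radius k = 1 - 1 / (real k + 2)"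

lemma radius_bounds: "0 \<le> radius k" "radius k < 1"
  by (simp_all add: radius_def field_simps)

lemma radius_tendsto: "radius \<longlonglongrightarrow> 1"
proof -
  have "(\<lambda>k. inverse (real (k + 2))) \<longlonglongrightarrow> 0"
    using LIMSEQ_ignore_initial_segment[OF lim_inverse_n, of 2] by simp
  then have "(\<lambda>k. 1 - inverse (real (k + 2))) \<longlonglongrightarrow> 1 - 0" by (intro tendsto_intros)
  then show ?thesis by (simp add: radius_def[abs_def] inverse_eq_divide add.commute)
qed

lemma radius_at_left: "filterlim radius (at_left 1) sequentially"
  using radius_tendsto radius_bounds(2) by (auto simp: filterlim_at less_le intro!: always_eventually)

text \<open>Bessel's inequality on the circle of radius \<open>r\<close> bounds each partial sum of \<open>|a n|\<^sup>2 r\<^bsup>2n\<^esup>\<close> by \<open>B\<close>;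
  in a fixed partial sum \<open>r\<close> may tend to 1.\<close>

lemma bounded_means_imp_taylor_summable:
  assumes "has_taylor a f"
    and "\<And>r. 0 \<le> r \<Longrightarrow> r < 1 \<Longrightarrow> (\<integral>\<^sub>T w. (norm (f (of_real r * w)))\<^sup>2) \<le> B"
  shows "summable (\<lambda>n. (norm (a n))\<^sup>2)" "(\<Sum>n. (norm (a n))\<^sup>2) \<le> B"
proof -
  have le: "(\<Sum>n<N. (norm (a n))\<^sup>2) \<le> B" for N
  proof (rule LIMSEQ_le_const2)
    have "(\<lambda>k. \<Sum>n<N. (norm (a n) * radius k ^ n)\<^sup>2) \<longlonglongrightarrow> (\<Sum>n<N. (norm (a n) * 1 ^ n)\<^sup>2)"
      by (intro tendsto_intros radius_tendsto)
    then show "(\<lambda>k. \<Sum>n<N. (norm (a n) * radius k ^ n)\<^sup>2) \<longlonglongrightarrow> (\<Sum>n<N. (norm (a n))\<^sup>2)" by simp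
    have "(\<Sum>n<N. (norm (a n) * radius k ^ n)\<^sup>2) \<le> B" for k
    proof -
      have "(\<Sum>n<N. (norm (a n) * radius k ^ n)\<^sup>2) \<le> (l2_norm (\<lambda>w. f (of_real (radius k) * w)))\<^sup>2"
        using bessel_inequality[OF dilation_L2[OF has_taylor_holomorphic[OF assms(1)]
            radius_bounds(1,2)], where N = N]
        by (simp only: dilation_coefficient[OF assms(1) radius_bounds(1,2)])
           (simp add: norm_mult norm_power radius_bounds)
      also have "\<dots> \<le> B" unfolding l2_norm_sq by (intro assms(2) radius_bounds)
      finally show ?thesis .
    qed
    then show "\<exists>N'. \<forall>k\<ge>N'. (\<Sum>n<N. (norm (a n) * radius k ^ n)\<^sup>2) \<le> B" by blast
  qed
  show s: "summable (\<lambda>n. (norm (a n))\<^sup>2)"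
    by (rule summableI_nonneg_bounded[OF _ le]) simp
  show "(\<Sum>n. (norm (a n))\<^sup>2) \<le> B"
    by (rule suminf_le_const[OF s le])
qed

lemma taylor_summable_imp_bounded_means:
  assumes "has_taylor a f" "summable (\<lambda>n. (norm (a n))\<^sup>2)" "0 \<le> r" "r < 1"
  shows "(\<integral>\<^sub>T w. (norm (f (of_real r * w)))\<^sup>2) \<le> (\<Sum>n. (norm (a n))\<^sup>2)"
proof -
  let ?p = "\<lambda>N w. \<Sum>k<N. (a k * of_real r ^ k) * w ^ k"
  let ?B = "\<Sum>n. norm (a n) * r ^ n"
  have "(\<lambda>N. \<integral>\<^sub>T w. (norm (?p N w))\<^sup>2) \<longlonglongrightarrow>
      (\<integral>\<^sub>T w. (norm (f (of_real r * w)))\<^sup>2)"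
  proof (rule integral_dominated_convergence[where w = "\<lambda>_. ?B\<^sup>2"])
    show "(\<lambda>w. (norm (f (of_real r * w)))\<^sup>2) \<in> borel_measurable circle_measure"
      by (intro circle_measurable_continuous continuous_intros dilation_continuous_sphere assms
          has_taylor_holomorphic[OF assms(1)])
    show "(\<lambda>w. (norm (?p N w))\<^sup>2) \<in> borel_measurable circle_measure" for N
      by (intro circle_measurable_continuous continuous_intros)
    show "AE w in circle_measure. (\<lambda>N. (norm (?p N w))\<^sup>2) \<longlonglongrightarrow> (norm (f (of_real r * w)))\<^sup>2"
      by (intro AE_I2 tendsto_intros taylor_partial_sums(1) assms) simp
    show "AE w in circle_measure. norm ((norm (?p N w))\<^sup>2) \<le> ?B\<^sup>2" for N
    proof (rule AE_I2)
      fix w assume "w \<in> space circle_measure"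
      then show "norm ((norm (?p N w))\<^sup>2) \<le> ?B\<^sup>2"
        using taylor_partial_sums(2)[OF assms(1,3,4), of w N] by (simp add: power_mono)
    qed
  qed auto
  moreover have "(\<integral>\<^sub>T w. (norm (?p N w))\<^sup>2) \<le> (\<Sum>n. (norm (a n))\<^sup>2)" for N
  proof -
    have "(\<integral>\<^sub>T w. (norm (?p N w))\<^sup>2) = (\<Sum>n<N. (norm (a n * of_real r ^ n))\<^sup>2)"
      by (simp only: l2_norm_sq[symmetric] l2_norm_trig_poly)
    also have "\<dots> \<le> (\<Sum>n<N. (norm (a n))\<^sup>2)"
    proof (intro sum_mono power_mono)
      fix n
      have "norm (a n) * r ^ n \<le> norm (a n) * 1"
        using assms by (intro mult_left_mono power_le_one) auto
      then show "norm (a n * of_real r ^ n) \<le> norm (a n)" using assms by (simp add: norm_mult norm_power)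
    qed simp
    also have "\<dots> \<le> (\<Sum>n. (norm (a n))\<^sup>2)" by (intro sum_le_suminf assms) auto
    finally show ?thesis .
  qed
  ultimately show ?thesis by (intro LIMSEQ_le_const2) auto
qed

lemma hardy2_iff_bounded:
  "f \<in> hardy2 \<longleftrightarrow> f holomorphic_on ball 0 1 \<and>
    (\<exists>B. \<forall>r. 0 \<le> r \<and> r < 1 \<longrightarrow> (\<integral>\<^sub>T w. (norm (f (of_real r * w)))\<^sup>2) \<le> B)"
  unfolding hardy2_def bdd_above_def by (simp, simp only: Ball_def atLeastLessThan_iff)

text \<open>The Hardy space is the sequence space \<open>\<ell>\<^sup>2\<close> of Taylor coefficients.\<close>

lemma hardy2_iff_taylor:
  assumes "has_taylor a f"
  shows "f \<in> hardy2 \<longleftrightarrow> summable (\<lambda>n. (norm (a n))\<^sup>2)"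
proof
  assume "f \<in> hardy2"
  then obtain B where
    "\<forall>r. 0 \<le> r \<and> r < 1 \<longrightarrow> (\<integral>\<^sub>T w. (norm (f (of_real r * w)))\<^sup>2) \<le> B"
    unfolding hardy2_iff_bounded by blast
  then show "summable (\<lambda>n. (norm (a n))\<^sup>2)"
    by (intro bounded_means_imp_taylor_summable(1)[OF assms, of B]) simp
next
  assume "summable (\<lambda>n. (norm (a n))\<^sup>2)"
  then show "f \<in> hardy2"
    unfolding hardy2_iff_bounded
    by (intro conjI exI[of _ "\<Sum>n. (norm (a n))\<^sup>2"] allI impI
        has_taylor_holomorphic[OF assms] taylor_summable_imp_bounded_means[OF assms]) auto
qed

lemma hardy2_holomorphic: "f \<in> hardy2 \<Longrightarrow> f holomorphic_on ball 0 1"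
  by (simp add: hardy2_def)

lemma hardy2_taylorE:
  assumes "f \<in> hardy2"
  obtains a where "has_taylor a f" "summable (\<lambda>n. (norm (a n))\<^sup>2)"
  using holomorphic_has_taylor[OF hardy2_holomorphic[OF assms]] hardy2_iff_taylor assms by metis

section \<open>The Poisson kernel\<close>

definition poisson :: "complex \<Rightarrow> complex \<Rightarrow> real" where
  "poisson z w = (1 - (norm z)\<^sup>2) / (norm (1 - cnj z * w))\<^sup>2"

lemma one_minus_cnj_mult_nonzero:
  assumes "norm z < 1" "norm w \<le> 1"
  shows "1 - cnj z * w \<noteq> 0" "1 - norm z \<le> norm (1 - cnj z * w)"
proof -
  have "norm (cnj z * w) \<le> norm z * 1" unfolding norm_mult complex_mod_cnj using assms by (intro mult_left_mono) auto
  then show "1 - norm z \<le> norm (1 - cnj z * w)" using norm_triangle_ineq2[of 1 "cnj z * w"] by simp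
  then show "1 - cnj z * w \<noteq> 0" using assms(1) by auto
qed

lemma poisson_nonneg: "norm z < 1 \<Longrightarrow> 0 \<le> poisson z w"
  by (simp add: poisson_def abs_square_le_1)

lemma poisson_bound:
  assumes "norm z \<le> q" "q < 1" "norm w = 1" shows "poisson z w \<le> 1 / (1 - q)\<^sup>2"
proof -
  have "1 - q \<le> norm (1 - cnj z * w)"
    using one_minus_cnj_mult_nonzero(2)[of z w] assms by linarith
  then have "(1 - q)\<^sup>2 \<le> (norm (1 - cnj z * w))\<^sup>2" using assms by (intro power_mono) auto
  moreover have "0 < (1 - q)\<^sup>2" using assms by simp
  ultimately show ?thesis unfolding poisson_def by (intro frac_le) (auto simp del: zero_less_power2)
qed

lemma poisson_continuous: "norm z < 1 \<Longrightarrow> continuous_on (sphere 0 1) (poisson z)"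
  unfolding poisson_def using one_minus_cnj_mult_nonzero(1)[of z] by (intro continuous_intros) auto

text \<open>Apply \<open>circle_cauchy\<close> to \<open>f w / (1 - cnj z * w)\<close>: the two denominators multiply to the squared modulus in
  the Poisson kernel.\<close>

lemma poisson_integral:
  assumes "continuous_on (cball 0 1) f" "f holomorphic_on ball 0 1" "norm z < 1"
  shows "(\<integral>\<^sub>T w. f w * of_real (poisson z w)) = f z"
proof -
  have nz: "1 - cnj z * w \<noteq> 0" if "w \<in> cball 0 1" for w
    using one_minus_cnj_mult_nonzero(1)[OF assms(3), of w] that by simp
  have cauchy: "(\<integral>\<^sub>T w. f w / (1 - cnj z * w) / (1 - z * cnj w)) = f z / (1 - cnj z * z)"
  proof (rule circle_cauchy[where f = "\<lambda>w. f w / (1 - cnj z * w)"])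
    show "continuous_on (cball 0 1) (\<lambda>w. f w / (1 - cnj z * w))"
      using nz by (intro continuous_intros assms) auto
    show "(\<lambda>w. f w / (1 - cnj z * w)) holomorphic_on ball 0 1"
      using nz by (intro holomorphic_intros assms) (auto simp: less_imp_le)
  qed (rule assms)
  have eq: "f w * of_real (poisson z w) = (1 - cnj z * z) * (f w / (1 - cnj z * w) / (1 - z * cnj w))"
    for w
  proof -
    have "complex_of_real ((norm (1 - cnj z * w))\<^sup>2) = (1 - cnj z * w) * (1 - z * cnj w)"
      unfolding cnj_mult_self[symmetric] by (simp add: mult.commute)
    then show ?thesis
      unfolding poisson_def of_real_divide of_real_diff cnj_mult_self by simp
  qed
  have "1 - cnj z * z \<noteq> 0" using nz[of z] assms by simp
  then show ?thesis
    by (simp only: eq integral_mult_right_zero cauchy) simp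
qed

lemma poisson_total: "norm z < 1 \<Longrightarrow> (\<integral>\<^sub>T w. poisson z w) = 1"
  using poisson_integral[of "\<lambda>_. 1" z]
  by (simp only: continuous_on_const holomorphic_on_const mult_1 integral_complex_of_real of_real_eq_1_iff)

text \<open>The kernel at \<open>z'\<close> is the real part of the analytic function \<open>(1 + cnj z' * w) / (1 - cnj z' * w)\<close>.
  The Poisson integral of that function is its value at \<open>z\<close>, so the composition of two Poisson
  kernels is again a Poisson kernel, at the radius \<open>|z| |z'|\<close>.\<close>

lemma poisson_composition:
  assumes "norm z < 1" "norm z' < 1"
  shows "(\<integral>\<^sub>T w. poisson z' w * poisson z w) =
    (1 - (norm z')\<^sup>2 * (norm z)\<^sup>2) / (norm (1 - cnj z' * z))\<^sup>2"
proof -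
  let ?g = "\<lambda>w. (1 + cnj z' * w) / (1 - cnj z' * w)"
  have nz: "1 - cnj z' * w \<noteq> 0" if "w \<in> cball 0 1" for w
    using one_minus_cnj_mult_nonzero(1)[OF assms(2), of w] that by simp
  have Re_g: "Re (?g w) = (1 - (norm z')\<^sup>2 * (norm w)\<^sup>2) / (norm (1 - cnj z' * w))\<^sup>2" for w
  proof -
    have "Re ((1 + a) / (1 - a)) = (1 - (norm a)\<^sup>2) / (norm (1 - a))\<^sup>2" for a
      unfolding cmod_power2 Re_divide by (simp add: power2_eq_square algebra_simps)
    then show ?thesis by (simp add: norm_mult power_mult_distrib)
  qed
  have cg: "continuous_on (cball 0 1) ?g" using nz by (intro continuous_intros) auto
  have "(\<integral>\<^sub>T w. ?g w * of_real (poisson z w)) = ?g z"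
  proof (rule poisson_integral[OF cg _ assms(1)])
    show "?g holomorphic_on ball 0 1" using nz by (intro holomorphic_intros) (auto simp: less_imp_le)
  qed
  then have "Re (?g z) = Re (\<integral>\<^sub>T w. ?g w * of_real (poisson z w))" by simp
  also have "\<dots> = (\<integral>\<^sub>T w. Re (?g w * of_real (poisson z w)))"
    by (intro integral_Re[symmetric] circle_integrable_continuous continuous_intros
        poisson_continuous assms continuous_on_subset[OF cg]) auto
  also have "\<dots> = (\<integral>\<^sub>T w. poisson z' w * poisson z w)"
    by (intro Bochner_Integration.integral_cong refl)
      (simp only: times_complex.sel Re_complex_of_real Im_complex_of_real Re_g, simp add: poisson_def)
  finally show ?thesis by (simp add: Re_g)
qed

text \<open>The composed kernel has a radius no larger than \<open>min r r'\<close>, so up to a constant it is dominated by the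
  wider of the two kernels: if \<open>r \<le> r'\<close> then \<open>1 - r\<^sup>2 r'\<^sup>2 \<le> 2 (1 - r\<^sup>2)\<close>, and moving \<open>z'\<close> out to the circle at most
  doubles the distance \<open>|1 - cnj z * z'|\<close>. The constant is \<open>8 = 2 \<cdot> 2\<^sup>2\<close>.\<close>

lemma poisson_quasi_triangle:
  assumes "norm w = 1" "norm w' = 1" "0 \<le> r" "r < 1" "0 \<le> r'" "r' < 1"
  defines "z \<equiv> of_real r * w" and "z' \<equiv> of_real r' * w'"
  shows "(1 - (norm z')\<^sup>2 * (norm z)\<^sup>2) / (norm (1 - cnj z' * z))\<^sup>2 \<le> 8 * (poisson z w' + poisson z' w)"
proof -
  have *: "(1 - r\<^sup>2 * r'\<^sup>2) / (norm (1 - cnj z * z'))\<^sup>2 \<le> 8 * poisson z w'"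
    if "norm w = 1" "norm w' = 1" "0 \<le> r" "r \<le> r'" "r' < 1" "z = of_real r * w" "z' = of_real r' * w'"
    for r r' :: real and w w' z z' :: complex
  proof -
    have nz: "norm z = r" "norm z' = r'" using that by (simp_all add: norm_mult)
    define D where "D = norm (1 - cnj z * z')"
    define N where "N = norm (1 - cnj z * w')"
    have D0: "D > 0" "N > 0" using one_minus_cnj_mult_nonzero(1)[of z] that nz by (auto simp: D_def N_def)
    have "1 - r' \<le> D"
    proof -
      have "norm (cnj z * z') \<le> 1 * r'" unfolding norm_mult complex_mod_cnj nz using that by (intro mult_right_mono) auto
      then show ?thesis unfolding D_def using norm_triangle_ineq2[of 1 "cnj z * z'"] by simp
    qed
    moreover have "N \<le> D + (1 - r')"
    proof -
      have e: "1 - cnj z * w' = (1 - cnj z * z') + cnj z * (z' - w')" by (simp add: algebra_simps)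
      have "z' - w' = of_real (r' - 1) * w'" using that by (simp add: algebra_simps)
      then have "norm (z' - w') = \<bar>r' - 1\<bar>" using that by (simp only: norm_mult norm_of_real mult_1_right)
      then have "norm (cnj z * (z' - w')) \<le> 1 * (1 - r')"
        unfolding norm_mult complex_mod_cnj nz using that by (intro mult_mono) auto
      then show ?thesis unfolding N_def D_def e using norm_triangle_ineq[of "1 - cnj z * z'" "cnj z * (z' - w')"] by simp
    qed
    ultimately have "N \<le> 2 * D" by simp
    then have "N\<^sup>2 \<le> (2 * D)\<^sup>2" using D0 by (intro power_mono) auto
    then have ND: "N\<^sup>2 \<le> 4 * D\<^sup>2" by (simp add: power_mult_distrib)
    have r2: "r\<^sup>2 \<le> r'\<^sup>2" "r\<^sup>2 \<le> 1" using that by (auto intro: power_mono simp: power_le_one)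
    then have "r\<^sup>2 * r\<^sup>2 \<le> r\<^sup>2 * r'\<^sup>2" by (intro mult_left_mono) auto
    moreover have "0 \<le> (1 - r\<^sup>2) * (1 - r\<^sup>2)" by simp
    ultimately have "1 - r\<^sup>2 * r'\<^sup>2 \<le> 2 * (1 - r\<^sup>2)" by (simp add: algebra_simps)
    then have "(1 - r\<^sup>2 * r'\<^sup>2) / D\<^sup>2 \<le> 2 * (1 - r\<^sup>2) / D\<^sup>2" using D0 by (intro divide_right_mono) auto
    also have "\<dots> = 8 * (1 - r\<^sup>2) / (4 * D\<^sup>2)" using D0 by (simp add: field_simps)
    also have "\<dots> \<le> 8 * (1 - r\<^sup>2) / N\<^sup>2" using D0 ND r2 by (intro divide_left_mono) auto
    finally show ?thesis by (simp add: poisson_def nz D_def N_def)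
  qed
  have nz: "norm z = r" "norm z' = r'" using assms by (simp_all add: norm_mult)
  have pos: "0 \<le> poisson z w'" "0 \<le> poisson z' w" using nz assms by (auto intro!: poisson_nonneg)
  have sym: "norm (1 - cnj z' * z) = norm (1 - cnj z * z')"
    by (subst complex_mod_cnj[symmetric]) (simp add: mult.commute)
  have comm: "(norm z')\<^sup>2 * (norm z)\<^sup>2 = r\<^sup>2 * r'\<^sup>2" by (simp add: nz)
  show ?thesis
  proof (cases "r \<le> r'")
    case True
    have "(1 - r\<^sup>2 * r'\<^sup>2) / (norm (1 - cnj z * z'))\<^sup>2 \<le> 8 * poisson z w'"
      by (rule *[OF assms(1-3) True assms(6)]) (simp_all add: z_def z'_def)
    then show ?thesis unfolding comm sym by (rule order_trans) (use pos in simp)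
  next
    case False
    then have "r' \<le> r" by simp
    have "(1 - r'\<^sup>2 * r\<^sup>2) / (norm (1 - cnj z' * z))\<^sup>2 \<le> 8 * poisson z' w"
      by (rule *[OF assms(2,1,5) \<open>r' \<le> r\<close> assms(4)]) (simp_all add: z_def z'_def)
    then show ?thesis unfolding nz by (rule order_trans) (use pos in simp)
  qed
qed

section \<open>A maximal inequality for Poisson integrals\<close>

interpretation circle_prod: finite_measure "circle_measure \<Otimes>\<^sub>M circle_measure"
  by (rule finite_measure_pair_measure) (rule circle.finite_measure_axioms)+

text \<open>This linearizes a maximum over finitely many radii: the maximum becomes the value at a radius chosen
  measurably from the point of the circle.\<close>

lemma exists_measurable_argmax:
  fixes g :: "real \<Rightarrow> complex \<Rightarrow> real"
  assumes "finite R" "R \<noteq> {}" "\<And>r. r \<in> R \<Longrightarrow> g r \<in> borel_measurable circle_measure"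
  obtains \<rho> where "\<rho> \<in> borel_measurable circle_measure"
    "(\<lambda>x. g (\<rho> x) x) \<in> borel_measurable circle_measure"
    "\<And>x. \<rho> x \<in> R" "\<And>x r. r \<in> R \<Longrightarrow> g r x \<le> g (\<rho> x) x"
  using assms
proof (induction R arbitrary: thesis rule: finite_ne_induct)
  case (singleton r)
  show ?case by (rule singleton(1)[of "\<lambda>_. r"]) (use singleton(2) in auto)
next
  case (insert r R)
  obtain \<rho> where \<rho>: "\<rho> \<in> borel_measurable circle_measure"
    "(\<lambda>x. g (\<rho> x) x) \<in> borel_measurable circle_measure"
    "\<And>x. \<rho> x \<in> R" "\<And>x r. r \<in> R \<Longrightarrow> g r x \<le> g (\<rho> x) x"
    using insert.IH insert.prems(2) by blast
  note [measurable] = \<rho>(1,2)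
  have [measurable]: "g r \<in> borel_measurable circle_measure" by (rule insert.prems(2)) simp
  let ?\<sigma> = "\<lambda>x. if g (\<rho> x) x \<le> g r x then r else \<rho> x"
  show ?case
  proof (rule insert.prems(1)[of ?\<sigma>])
    show "?\<sigma> \<in> borel_measurable circle_measure" by measurable
    have "(\<lambda>x. g (?\<sigma> x) x) = (\<lambda>x. if g (\<rho> x) x \<le> g r x then g r x else g (\<rho> x) x)" by auto
    also have "\<dots> \<in> borel_measurable circle_measure" by measurable
    finally show "(\<lambda>x. g (?\<sigma> x) x) \<in> borel_measurable circle_measure" .
    show "?\<sigma> x \<in> insert r R" for x using \<rho>(3) by auto
    show "g r' x \<le> g (?\<sigma> x) x" if "r' \<in> insert r R" for x r'
      using that \<rho>(4)[of r' x] by auto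
  qed
qed

text \<open>The method is \<open>TT*\<close>. Let \<open>K x w\<close> be the Poisson kernel at the point of radius \<open>\<rho> x\<close> over \<open>x\<close>. By
  \<open>poisson_quasi_triangle\<close>, the kernel \<open>\<integral> K x w K x' w dw\<close> of \<open>TT*\<close> is at most \<open>8 (K x x' + K x' x)\<close>, that is,
  \<open>TT* \<le> 8 (T + T*)\<close> on nonnegative functions. Hence \<open>\<parallel>T*\<parallel>\<^sup>2 \<le> 16 \<parallel>T*\<parallel>\<close>, so \<open>\<parallel>T\<parallel> \<le> 16\<close>, whatever the choice
  of \<open>\<rho>\<close>. The strict bound \<open>q\<close> on the radii makes all functions bounded, so that the norm that is cancelled
  is finite.\<close>

lemma linearized_maximal_inequality:
  fixes \<rho> :: "complex \<Rightarrow> real"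
  assumes g: "continuous_on (cball 0 1) g" "g holomorphic_on ball 0 1"
    and \<rho>: "\<rho> \<in> borel_measurable circle_measure" "\<And>x. 0 \<le> \<rho> x" "\<And>x. \<rho> x \<le> q" "q < 1"
    and gm: "(\<lambda>x. norm (g (of_real (\<rho> x) * x))) \<in> borel_measurable circle_measure"
  shows "(\<integral>\<^sub>T x. (norm (g (of_real (\<rho> x) * x)))\<^sup>2) \<le>
    256 * (\<integral>\<^sub>T x. (norm (g x))\<^sup>2)"
proof -
  note [measurable] = \<rho>(1) gm
  define h where "h x = norm (g (of_real (\<rho> x) * x))" for x
  define K where "K x w = poisson (of_real (\<rho> x) * x) w" for x w
  \<comment> \<open>\<open>T\<close> is the adjoint of the linearized maximal operator, applied to the maximal function \<open>h\<close> itself.\<close>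
  define T where "T w = (\<integral>\<^sub>T x. K x w * h x)" for w
  define C where "C = 1 / (1 - q)\<^sup>2"
  have [measurable]: "g \<in> borel_measurable circle_measure"
    by (intro circle_measurable_continuous continuous_on_subset[OF g(1)]) auto
  have hM[measurable]: "h \<in> borel_measurable circle_measure" unfolding h_def[abs_def] by measurable
  have id[measurable]: "(\<lambda>x. x) \<in> borel_measurable circle_measure"
    by (intro circle_measurable_continuous continuous_intros)
  have cnjM[measurable]: "cnj \<in> borel_measurable borel"
    by (intro borel_measurable_continuous_onI continuous_intros)
  have KM: "case_prod K \<in> borel_measurable (circle_measure \<Otimes>\<^sub>M circle_measure)"
    unfolding K_def poisson_def by measurable
  have KM'[measurable]: "(\<lambda>x. K (f x) (f' x)) \<in> borel_measurable N"
    if "f \<in> measurable N circle_measure" "f' \<in> measurable N circle_measure" for f f' and N :: "'z measure"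
    using measurable_compose[OF measurable_Pair[OF that] KM] by simp
  have norm_z: "norm (of_real (\<rho> x) * x) = \<rho> x" if "x \<in> sphere 0 1" for x
    using that \<rho>(2)[of x] by (simp add: norm_mult)
  have lt1: "\<rho> x < 1" for x using \<rho>(3)[of x] \<rho>(4) by simp
  have K0: "0 \<le> K x w" "K x w \<le> C" if "x \<in> sphere 0 1" "w \<in> sphere 0 1" for x w
    unfolding K_def C_def using norm_z[OF that(1)] lt1[of x] \<rho>(3)[of x] \<rho>(4) that
    by (auto intro!: poisson_nonneg poisson_bound)
  obtain B where B: "\<And>z. z \<in> cball 0 1 \<Longrightarrow> norm (g z) \<le> B"
    using compact_imp_bounded[OF compact_continuous_image[OF g(1) compact_cball]]
    unfolding bounded_iff by (metis imageI)
  have h0: "0 \<le> h x" for x by (simp add: h_def)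
  have hB: "h x \<le> B" if "x \<in> sphere 0 1" for x
    unfolding h_def using norm_z[OF that] lt1[of x] by (intro B) auto
  \<comment> \<open>Bounded measurable functions: closed under everything below, so no integrability question arises.\<close>
  define bd where "bd f \<longleftrightarrow> f \<in> borel_measurable circle_measure \<and> (\<exists>B. \<forall>x\<in>sphere 0 1. \<bar>f x\<bar> \<le> B)"
    for f :: "complex \<Rightarrow> real"
  have bd_int: "integrable circle_measure f" if "bd f" for f
  proof -
    obtain B where "\<forall>x\<in>sphere 0 1. \<bar>f x\<bar> \<le> B" using \<open>bd f\<close> unfolding bd_def by blast
    then show ?thesis
      using \<open>bd f\<close> unfolding bd_def by (intro circle_integrable_bounded[where B = B] AE_I2) auto
  qed
  have bd_mult: "bd (\<lambda>x. f x * f' x)" if "bd f" "bd f'" for f f'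
  proof -
    have [measurable]: "f \<in> borel_measurable circle_measure" "f' \<in> borel_measurable circle_measure"
      using that by (auto simp: bd_def)
    obtain B B' where B: "\<And>x. x\<in>sphere 0 1 \<Longrightarrow> \<bar>f x\<bar> \<le> B" "\<And>x. x\<in>sphere 0 1 \<Longrightarrow> \<bar>f' x\<bar> \<le> B'"
      using \<open>bd f\<close> \<open>bd f'\<close> unfolding bd_def by blast
    have "\<bar>f x * f' x\<bar> \<le> B * B'" if "x\<in>sphere 0 1" for x
      unfolding abs_mult using B(1)[OF that] B(2)[OF that] by (intro mult_mono) auto
    then show ?thesis unfolding bd_def by (intro conjI exI ballI) (measurable, blast)
  qed
  have bd_K: "bd (K x)" "bd (\<lambda>w. K w x)" if "x \<in> sphere 0 1" for x
  proof -
    have [measurable]: "(\<lambda>_. x) \<in> measurable circle_measure circle_measure" using that by simp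
    have "K x \<in> borel_measurable circle_measure" "(\<lambda>w. K w x) \<in> borel_measurable circle_measure"
      by measurable
    moreover have "\<bar>K x w\<bar> \<le> C" "\<bar>K w x\<bar> \<le> C" if "w \<in> sphere 0 1" for w
      using K0[of x w] K0[of w x] that \<open>x \<in> sphere 0 1\<close> by auto
    ultimately show "bd (K x)" "bd (\<lambda>w. K w x)" unfolding bd_def by blast+
  qed
  have bd_avg: "bd (\<lambda>x. \<integral>\<^sub>T w. K x w * b w)" "bd (\<lambda>w. \<integral>\<^sub>T x. K x w * b x)"
    if "bd b" for b
  proof -
    have [measurable]: "b \<in> borel_measurable circle_measure" using that by (simp add: bd_def)
    obtain B where B: "\<And>x. x\<in>sphere 0 1 \<Longrightarrow> \<bar>b x\<bar> \<le> B" using \<open>bd b\<close> unfolding bd_def by blast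
    have le: "\<bar>K x w\<bar> * \<bar>b w'\<bar> \<le> C * B" if "x \<in> sphere 0 1" "w \<in> sphere 0 1" "w' \<in> sphere 0 1" for x w w'
      using K0[OF that(1,2)] B[OF that(3)] by (intro mult_mono) auto
    have av: "\<bar>\<integral>\<^sub>T w. f w\<bar> \<le> C * B" if "bd f" "\<And>w. w \<in> sphere 0 1 \<Longrightarrow> \<bar>f w\<bar> \<le> C * B" for f
    proof -
      have "\<bar>\<integral>\<^sub>T w. f w\<bar> \<le> (\<integral>\<^sub>T w. \<bar>f w\<bar>)" by (rule integral_abs_bound)
      also have "\<dots> \<le> (\<integral>\<^sub>T w. C * B)"
        using that bd_int[OF that(1)] by (intro integral_mono) auto
      finally show ?thesis by simp
    qed
    show "bd (\<lambda>x. \<integral>\<^sub>T w. K x w * b w)" unfolding bd_def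
    proof (intro conjI exI ballI)
      show "(\<lambda>x. \<integral>\<^sub>T w. K x w * b w) \<in> borel_measurable circle_measure" by measurable
      show "\<bar>\<integral>\<^sub>T w. K x w * b w\<bar> \<le> C * B" if "x \<in> sphere 0 1" for x
        using le that by (intro av bd_mult bd_K \<open>bd b\<close>) (auto simp: abs_mult)
    qed
    show "bd (\<lambda>w. \<integral>\<^sub>T x. K x w * b x)" unfolding bd_def
    proof (intro conjI exI ballI)
      show "(\<lambda>w. \<integral>\<^sub>T x. K x w * b x) \<in> borel_measurable circle_measure" by measurable
      show "\<bar>\<integral>\<^sub>T x. K x w * b x\<bar> \<le> C * B" if "w \<in> sphere 0 1" for w
        using le that by (intro av bd_mult bd_K \<open>bd b\<close>) (auto simp: abs_mult)
    qed
  qed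
  have fubini: "(\<integral>\<^sub>T x. a x * (\<integral>\<^sub>T w. K x w * b w)) =
      (\<integral>\<^sub>T w. b w * (\<integral>\<^sub>T x. K x w * a x))" if ab: "bd a" "bd b" for a b
  proof -
    have [measurable]: "a \<in> borel_measurable circle_measure" "b \<in> borel_measurable circle_measure"
      using that by (auto simp: bd_def)
    obtain A B where B: "\<And>x. x\<in>sphere 0 1 \<Longrightarrow> \<bar>a x\<bar> \<le> A" "\<And>x. x\<in>sphere 0 1 \<Longrightarrow> \<bar>b x\<bar> \<le> B"
      using ab unfolding bd_def by blast
    have "integrable (circle_measure \<Otimes>\<^sub>M circle_measure) (\<lambda>(x, w). K x w * (a x * b w))"
    proof (rule circle_prod.integrable_const_bound)
      show "AE x in circle_measure \<Otimes>\<^sub>M circle_measure. norm (case x of (x, w) \<Rightarrow> K x w * (a x * b w)) \<le> C * (A * B)"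
      proof (rule AE_I2, clarsimp simp: space_pair_measure abs_mult)
        fix x w :: complex assume "norm x = 1" "norm w = 1"
        then show "\<bar>K x w\<bar> * (\<bar>a x\<bar> * \<bar>b w\<bar>) \<le> C * (A * B)"
          using K0[of x w] B(1)[of x] B(2)[of w] by (intro mult_mono) auto
      qed
    qed measurable
    then have "(\<integral>\<^sub>T w. (\<integral>\<^sub>T x. K x w * (a x * b w))) =
        (\<integral>\<^sub>T x. (\<integral>\<^sub>T w. K x w * (a x * b w)))"
      by (rule circle2.Fubini_integral)
    moreover have "(\<integral>\<^sub>T x. K x w * (a x * b w)) = b w * (\<integral>\<^sub>T x. K x w * a x)" for w
      by (subst integral_mult_right_zero[symmetric]) (simp only: mult_ac)
    moreover have "(\<integral>\<^sub>T w. K x w * (a x * b w)) = a x * (\<integral>\<^sub>T w. K x w * b w)" for x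
      by (subst integral_mult_right_zero[symmetric]) (simp only: mult_ac)
    ultimately show ?thesis by simp
  qed
  have bd_h: "bd h" unfolding bd_def using hM hB h0 by (auto simp: abs_of_nonneg intro!: exI[of _ B])
  have bd_T: "bd T" unfolding T_def[abs_def] by (rule bd_avg(2)[OF bd_h])
  have bd_g: "bd (\<lambda>w. norm (g w))" unfolding bd_def using B by (auto intro!: exI[of _ B])
  have T0: "0 \<le> T w" if "w \<in> sphere 0 1" for w
    unfolding T_def using K0 h0 that by (intro integral_nonneg_AE AE_I2 mult_nonneg_nonneg) auto
  \<comment> \<open>The second term of the bound for \<open>TT*\<close>; Fubini turns its pairing with \<open>h\<close> into that of \<open>T\<close> with \<open>h\<close>.\<close>
  define L where "L x = (\<integral>\<^sub>T w. K x w * h w)" for x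
  have bd_L: "bd L" unfolding L_def[abs_def] by (rule bd_avg(1)[OF bd_h])
  define I where "I = (\<integral>\<^sub>T w. h w * T w)"

  have KT: "(\<integral>\<^sub>T w. K x w * T w) \<le> 8 * (L x + T x)" if z: "x \<in> sphere 0 1" for x
  proof -
    have "(\<integral>\<^sub>T w. K x w * T w) =
        (\<integral>\<^sub>T x'. h x' * (\<integral>\<^sub>T w. K x' w * K x w))"
      unfolding T_def by (rule fubini[symmetric, OF bd_h bd_K(1)[OF z]])
    also have "\<dots> \<le> (\<integral>\<^sub>T x'. 8 * (K x x' * h x' + K x' x * h x'))"
    proof (rule integral_mono)
      show "integrable circle_measure (\<lambda>x'. h x' * (\<integral>\<^sub>T w. K x' w * K x w))"
        by (intro bd_int bd_mult bd_h bd_avg bd_K z)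
      show "integrable circle_measure (\<lambda>x'. 8 * (K x x' * h x' + K x' x * h x'))"
        by (intro integrable_mult_right Bochner_Integration.integrable_add bd_int bd_mult bd_h bd_K z)
      fix x' assume "x' \<in> space circle_measure"
      then have z': "x' \<in> sphere 0 1" by simp
      have "(\<integral>\<^sub>T w. K x' w * K x w) \<le> 8 * (K x x' + K x' x)"
        unfolding K_def
      proof (subst poisson_composition)
        show "norm (of_real (\<rho> x) * x) < 1" "norm (of_real (\<rho> x') * x') < 1"
          using norm_z z z' lt1 by simp_all
      qed (rule poisson_quasi_triangle, use z z' \<rho>(2) lt1 in auto)
      then have "h x' * (\<integral>\<^sub>T w. K x' w * K x w) \<le> h x' * (8 * (K x x' + K x' x))"
        by (intro mult_left_mono h0)
      then show "h x' * (\<integral>\<^sub>T w. K x' w * K x w) \<le> 8 * (K x x' * h x' + K x' x * h x')"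
        by (simp add: algebra_simps)
    qed
    also have "\<dots> = 8 * (L x + T x)"
      unfolding L_def T_def integral_mult_right_zero
      by (subst Bochner_Integration.integral_add) (intro bd_int bd_mult bd_h bd_K z refl)+
    finally show ?thesis .
  qed
  have hL: "(\<integral>\<^sub>T x. h x * L x) = I"
    unfolding L_def I_def T_def by (rule fubini[OF bd_h bd_h])
  have T_le: "(\<integral>\<^sub>T w. T w * T w) \<le> 16 * I"
  proof -
    have "(\<integral>\<^sub>T w. T w * T w) = (\<integral>\<^sub>T x. h x * (\<integral>\<^sub>T w. K x w * T w))"
      using fubini[OF bd_h bd_T] by (simp only: T_def[symmetric])
    also have "\<dots> \<le> (\<integral>\<^sub>T x. 8 * (h x * L x + h x * T x))"
    proof (rule integral_mono)
      show "integrable circle_measure (\<lambda>x. h x * (\<integral>\<^sub>T w. K x w * T w))"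
        by (intro bd_int bd_mult bd_h bd_avg bd_T)
      show "integrable circle_measure (\<lambda>x. 8 * (h x * L x + h x * T x))"
        by (intro integrable_mult_right Bochner_Integration.integrable_add bd_int bd_mult bd_h bd_L bd_T)
      fix x assume "x \<in> space circle_measure"
      then have "h x * (\<integral>\<^sub>T w. K x w * T w) \<le> h x * (8 * (L x + T x))"
        by (intro mult_left_mono h0 KT) simp
      then show "h x * (\<integral>\<^sub>T w. K x w * T w) \<le> 8 * (h x * L x + h x * T x)"
        by (simp add: algebra_simps)
    qed
    also have "\<dots> = 8 * (I + I)"
      unfolding integral_mult_right_zero hL[symmetric]
      by (subst Bochner_Integration.integral_add) (intro bd_int bd_mult bd_h bd_L bd_T, intro bd_int bd_mult bd_h bd_L bd_T, simp add: hL I_def)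
    finally show ?thesis by simp
  qed
  have h_le: "h x \<le> (\<integral>\<^sub>T w. K x w * norm (g w))" if "x \<in> sphere 0 1" for x
  proof -
    have n: "norm (of_real (\<rho> x) * x) < 1" using norm_z that lt1 by simp
    have "h x = norm (\<integral>\<^sub>T w. g w * of_real (K x w))"
      unfolding h_def K_def by (subst poisson_integral[OF g n]) simp
    also have "\<dots> \<le> (\<integral>\<^sub>T w. norm (g w * of_real (K x w)))" by (rule integral_norm_bound)
    also have "\<dots> = (\<integral>\<^sub>T w. K x w * norm (g w))"
      using K0(1)[OF that] by (intro Bochner_Integration.integral_cong) (auto simp: norm_mult)
    finally show ?thesis .
  qed
  have H_le: "(\<integral>\<^sub>T x. h x * h x) \<le> (\<integral>\<^sub>T w. norm (g w) * T w)"
  proof -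
    have "(\<integral>\<^sub>T x. h x * h x) \<le> (\<integral>\<^sub>T x. h x * (\<integral>\<^sub>T w. K x w * norm (g w)))"
      by (intro integral_mono bd_int bd_mult bd_h bd_avg bd_g mult_left_mono h_le h0) auto
    also have "\<dots> = (\<integral>\<^sub>T w. norm (g w) * T w)"
      using fubini[OF bd_h bd_g] by (simp only: T_def[symmetric])
    finally show ?thesis .
  qed
  \<comment> \<open>Two applications of Cauchy-Schwarz: \<open>tn\<^sup>2 \<le> 16 hn tn\<close> and \<open>hn\<^sup>2 \<le> gn tn\<close>, hence \<open>hn \<le> 16 gn\<close>.\<close>
  define hn where "hn = l2_norm (\<lambda>x. of_real (h x))"
  define tn where "tn = l2_norm (\<lambda>x. of_real (T x))"
  define gn where "gn = l2_norm g"
  have si: "L2 (\<lambda>x. of_real (f x))" if "bd f" for f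
    unfolding L2_def using that bd_int[OF bd_mult[OF that that]]
    by (auto simp: bd_def power2_eq_square)
  have sg: "L2 g"
    by (intro L2_continuous continuous_on_subset[OF g(1)]) auto
  have "tn\<^sup>2 \<le> 16 * (hn * tn)"
  proof -
    have "tn\<^sup>2 = (\<integral>\<^sub>T w. T w * T w)" unfolding tn_def l2_norm_sq by (simp add: power2_eq_square)
    moreover have "I \<le> hn * tn"
    proof -
      have "I = (\<integral>\<^sub>T w. norm (complex_of_real (h w)) * norm (complex_of_real (T w)))"
        unfolding I_def using T0 h0 by (intro Bochner_Integration.integral_cong) auto
      also have "\<dots> \<le> hn * tn" unfolding hn_def tn_def by (intro l2_cauchy_schwarz si bd_h bd_T)
      finally show ?thesis .
    qed
    ultimately show ?thesis using T_le by linarith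
  qed
  then have "tn * tn \<le> (16 * hn) * tn" by (simp add: power2_eq_square)
  moreover have nn: "0 \<le> tn" "0 \<le> hn" "0 \<le> gn" by (simp_all add: tn_def hn_def gn_def)
  ultimately have tn: "tn \<le> 16 * hn" by (cases "tn = 0") auto
  have "hn\<^sup>2 \<le> gn * tn"
  proof -
    have "hn\<^sup>2 = (\<integral>\<^sub>T w. h w * h w)" unfolding hn_def l2_norm_sq by (simp add: power2_eq_square)
    also have "\<dots> \<le> (\<integral>\<^sub>T w. norm (g w) * T w)" by (rule H_le)
    also have "\<dots> = (\<integral>\<^sub>T w. norm (g w) * norm (complex_of_real (T w)))"
      using T0 by (intro Bochner_Integration.integral_cong) auto
    also have "\<dots> \<le> gn * tn" unfolding gn_def tn_def by (intro l2_cauchy_schwarz si bd_T sg)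
    finally show ?thesis .
  qed
  also have "\<dots> \<le> gn * (16 * hn)" using tn nn by (intro mult_left_mono)
  finally have "hn * hn \<le> (16 * gn) * hn" by (simp add: power2_eq_square mult_ac)
  then have "hn \<le> 16 * gn" using nn by (cases "hn = 0") auto
  then have "hn\<^sup>2 \<le> (16 * gn)\<^sup>2" using nn by (intro power_mono) auto
  then show ?thesis by (simp add: hn_def gn_def l2_norm_sq power_mult_distrib h_def)
qed

section \<open>The radial maximal function\<close>

lemma le_on_rationals_imp_le:
  fixes \<phi> :: "real \<Rightarrow> real"
  assumes cont: "continuous_on {b<..<d} \<phi>" and le: "\<And>q. q \<in> {b<..<d} \<inter> \<rat> \<Longrightarrow> \<phi> q \<le> c" and r: "r \<in> {b<..<d}"
  shows "\<phi> r \<le> c"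
proof (rule ccontr)
  assume "\<not> \<phi> r \<le> c"
  define U where "U = {b<..<d} \<inter> \<phi> -` {c<..}"
  have "open U" unfolding U_def by (intro continuous_open_preimage cont) auto
  moreover have "r \<in> U" using r \<open>\<not> \<phi> r \<le> c\<close> by (simp add: U_def)
  ultimately obtain e where e: "e > 0" "ball r e \<subseteq> U" by (auto simp: open_contains_ball)
  obtain q where "q \<in> \<rat>" "r < q" "q < r + e" using Rats_dense_in_real[of r "r + e"] e by auto
  then have "q \<in> U" using e by (auto simp: dist_real_def)
  then show False using le[of q] \<open>q \<in> \<rat>\<close> by (auto simp: U_def)
qed

lemma radius_continuous:
  assumes "f holomorphic_on ball 0 1" "w \<in> sphere 0 1"
  shows "continuous_on {0<..<1} (\<lambda>r. f (of_real r * w))"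
proof -
  have "of_real r * w \<in> ball 0 1" if "r \<in> {0<..<1}" for r :: real
    using assms(2) that by (simp add: norm_mult)
  then show ?thesis
    by (intro continuous_on_compose2[OF holomorphic_on_imp_continuous_on[OF assms(1)]] continuous_intros) blast
qed

text \<open>The supremum runs over rational radii to make measurability evident; by continuity it bounds all
  radii.\<close>

definition radial_max :: "(complex \<Rightarrow> complex) \<Rightarrow> complex \<Rightarrow> ennreal" where
  "radial_max f w = (SUP r\<in>{0..<1} \<inter> \<rat>. ennreal ((norm (f (of_real r * w)))\<^sup>2))"

lemma countable_rational_radii: "countable ({0..<1} \<inter> (\<rat> :: real set))"
  using countable_rat countable_subset by blast

lemma radial_max_measurable:
  assumes "f holomorphic_on ball 0 1"
  shows "radial_max f \<in> borel_measurable circle_measure"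
proof -
  have "(\<lambda>w. ennreal ((norm (f (of_real r * w)))\<^sup>2)) \<in> borel_measurable circle_measure"
    if "r \<in> {0..<1} \<inter> \<rat>" for r :: real
    using that by (intro measurable_compose[OF _ measurable_ennreal] circle_measurable_continuous
        continuous_intros dilation_continuous_sphere assms) auto
  then show ?thesis
    unfolding radial_max_def[abs_def] by (intro borel_measurable_SUP countable_rational_radii)
qed

lemma le_radial_max:
  assumes "f holomorphic_on ball 0 1" "w \<in> sphere 0 1" "0 \<le> r" "r < 1"
  shows "ennreal ((norm (f (of_real r * w)))\<^sup>2) \<le> radial_max f w"
proof -
  have rat: "ennreal ((norm (f (of_real q * w)))\<^sup>2) \<le> radial_max f w" if "q \<in> {0..<1} \<inter> \<rat>" for q
    unfolding radial_max_def using that by (rule SUP_upper)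
  show ?thesis
  proof (cases "r = 0 \<or> radial_max f w = top")
    case True
    then show ?thesis using rat[of 0] by auto
  next
    case False
    then obtain m where m: "radial_max f w = ennreal m" "m \<ge> 0" by (cases "radial_max f w") auto
    have "(norm (f (of_real r * w)))\<^sup>2 \<le> m"
    proof (rule le_on_rationals_imp_le[of 0 1 "\<lambda>r. (norm (f (of_real r * w)))\<^sup>2"])
      show "continuous_on {0<..<1} (\<lambda>r. (norm (f (of_real r * w)))\<^sup>2)"
        by (intro continuous_intros radius_continuous assms)
      show "(norm (f (of_real q * w)))\<^sup>2 \<le> m" if "q \<in> {0<..<1} \<inter> \<rat>" for q
        using rat[of q] that m by auto
    qed (use False assms in auto)
    then show ?thesis using m by simp
  qed
qed

text \<open>Exhaust the rational radii by finite sets. On a finite set the linearized inequality is applied to a dilation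
  of \<open>f\<close> that is continuous up to the circle; its constant does not depend on the set.\<close>

lemma radial_maximal_inequality:
  assumes a: "has_taylor a f" "summable (\<lambda>n. (norm (a n))\<^sup>2)"
  shows "(\<integral>\<^sup>+w. radial_max f w \<partial>circle_measure) \<le> ennreal (256 * (\<Sum>n. (norm (a n))\<^sup>2))"
proof -
  let ?Q = "{0..<1} \<inter> (\<rat> :: real set)"
  let ?S = "\<Sum>n. (norm (a n))\<^sup>2"
  let ?F = "\<lambda>r w. ennreal ((norm (f (of_real r * w)))\<^sup>2)"
  have hol: "f holomorphic_on ball 0 1" by (rule has_taylor_holomorphic[OF a(1)])
  define e where "e = from_nat_into ?Q"
  have "0 \<in> ?Q" by simp
  then have "?Q \<noteq> {}" by blast
  then have e_range: "range e = ?Q" unfolding e_def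
    by (intro range_from_nat_into countable_rational_radii)
  then have e: "0 \<le> e j" "e j < 1" for j by auto
  have FM: "?F (e j) \<in> borel_measurable circle_measure" for j
    using e by (intro measurable_compose[OF _ measurable_ennreal] circle_measurable_continuous
        continuous_intros dilation_continuous_sphere hol) auto
  define M where "M k w = (SUP j\<in>{..k}. ?F (e j) w)" for k w
  have MM: "M k \<in> borel_measurable circle_measure" for k
    unfolding M_def[abs_def] by (intro borel_measurable_SUP FM) auto
  have "radial_max f w = (SUP k. M k w)" for w
  proof -
    have "radial_max f w = (SUP j. ?F (e j) w)"
      unfolding radial_max_def e_range[symmetric] by (simp add: image_image)
    also have "\<dots> = (SUP k. M k w)"
    proof (rule antisym)
      show "(SUP j. ?F (e j) w) \<le> (SUP k. M k w)"
        unfolding M_def by (intro SUP_mono) (auto intro!: SUP_upper)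
      show "(SUP k. M k w) \<le> (SUP j. ?F (e j) w)"
        unfolding M_def by (auto intro!: SUP_least intro: SUP_upper)
    qed
    finally show ?thesis .
  qed
  then have "(\<integral>\<^sup>+w. radial_max f w \<partial>circle_measure) = (\<integral>\<^sup>+w. (SUP k. M k w) \<partial>circle_measure)" by simp
  also have "\<dots> = (SUP k. \<integral>\<^sup>+w. M k w \<partial>circle_measure)"
  proof (rule nn_integral_monotone_convergence_SUP)
    show "incseq M" unfolding M_def by (auto simp: incseq_def le_fun_def intro!: SUP_subset_mono)
  qed (rule MM)
  also have "\<dots> \<le> ennreal (256 * ?S)"
  proof (rule SUP_least)
    fix k
    let ?R = "e ` {..k}"
    have R: "finite ?R" "?R \<noteq> {}" by auto
    define m where "m = Max ?R"
    have m: "0 \<le> m" "m < 1" using e Max_in[OF R] unfolding m_def by (metis imageE)+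
    have m_le: "r \<le> m" if "r \<in> ?R" for r using R that by (auto simp: m_def)
    \<comment> \<open>A radius between \<open>m\<close> and 1; relative to the dilation by \<open>s\<close> the radii are at most \<open>m / s < 1\<close>.\<close>
    define s where "s = (1 + m) / 2"
    have s: "0 < s" "s < 1" "m / s < 1" using m by (auto simp: s_def field_simps)
    obtain \<rho> where \<rho>: "\<rho> \<in> borel_measurable circle_measure"
      "(\<lambda>w. norm (f (of_real (\<rho> w) * w))) \<in> borel_measurable circle_measure"
      "\<And>w. \<rho> w \<in> ?R" "\<And>w r. r \<in> ?R \<Longrightarrow> norm (f (of_real r * w)) \<le> norm (f (of_real (\<rho> w) * w))"
    proof (rule exists_measurable_argmax[OF R, of "\<lambda>r w. norm (f (of_real r * w))"])
      fix r assume "r \<in> ?R"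
      then show "(\<lambda>w. norm (f (of_real r * w))) \<in> borel_measurable circle_measure"
        using e by (intro circle_measurable_continuous continuous_intros dilation_continuous_sphere hol) auto
    qed blast
    define g where "g z = f (of_real s * z)" for z
    have g_eq: "g (of_real (\<rho> w / s) * w) = f (of_real (\<rho> w) * w)" for w
      using s by (simp add: g_def)
    have "(\<integral>\<^sub>T w. (norm (g (of_real (\<rho> w / s) * w)))\<^sup>2) \<le>
        256 * (\<integral>\<^sub>T w. (norm (g w))\<^sup>2)"
    proof (rule linearized_maximal_inequality[where q = "m / s"])
      show "continuous_on (cball 0 1) g" "g holomorphic_on ball 0 1"
        unfolding g_def[abs_def] using s by (auto intro!: dilation_continuous dilation_holomorphic hol)
      show "(\<lambda>w. \<rho> w / s) \<in> borel_measurable circle_measure" using \<rho>(1) by measurable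
      show "0 \<le> \<rho> w / s" for w using \<rho>(3)[of w] e s by auto
      show "\<rho> w / s \<le> m / s" for w using m_le[OF \<rho>(3)[of w]] s by (intro divide_right_mono) auto
      show "(\<lambda>w. norm (g (of_real (\<rho> w / s) * w))) \<in> borel_measurable circle_measure"
        unfolding g_eq by (rule \<rho>(2))
    qed (rule s)
    also have "\<dots> \<le> 256 * ?S"
      unfolding g_def using s by (intro mult_left_mono taylor_summable_imp_bounded_means[OF a]) auto
    finally have le: "(\<integral>\<^sub>T w. (norm (f (of_real (\<rho> w) * w)))\<^sup>2) \<le> 256 * ?S"
      unfolding g_eq .
    have "bounded (f ` cball 0 m)"
      using m by (intro compact_imp_bounded compact_continuous_image
          continuous_on_subset[OF holomorphic_on_imp_continuous_on[OF hol]]) auto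
    then obtain B where B: "\<And>z. z \<in> cball 0 m \<Longrightarrow> norm (f z) \<le> B"
      unfolding bounded_iff by (metis imageI)
    have int: "integrable circle_measure (\<lambda>w. (norm (f (of_real (\<rho> w) * w)))\<^sup>2)"
    proof (rule circle_integrable_bounded[where B = "B\<^sup>2"])
      show "(\<lambda>w. (norm (f (of_real (\<rho> w) * w)))\<^sup>2) \<in> borel_measurable circle_measure"
        using \<rho>(2) by measurable
      show "AE w in circle_measure. norm ((norm (f (of_real (\<rho> w) * w)))\<^sup>2) \<le> B\<^sup>2"
      proof (rule AE_I2)
        fix w assume "w \<in> space circle_measure"
        then have "of_real (\<rho> w) * w \<in> cball 0 m"
          using m_le[OF \<rho>(3)[of w]] \<rho>(3)[of w] e by (auto simp: norm_mult)
        then show "norm ((norm (f (of_real (\<rho> w) * w)))\<^sup>2) \<le> B\<^sup>2"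
          using B by (auto intro!: power_mono)
      qed
    qed
    have "(\<integral>\<^sup>+w. M k w \<partial>circle_measure) \<le> (\<integral>\<^sup>+w. ennreal ((norm (f (of_real (\<rho> w) * w)))\<^sup>2) \<partial>circle_measure)"
      unfolding M_def by (intro nn_integral_mono SUP_least ennreal_leI power_mono \<rho>(4)) auto
    also have "\<dots> = ennreal (\<integral>\<^sub>T w. (norm (f (of_real (\<rho> w) * w)))\<^sup>2)"
      by (rule nn_integral_eq_integral[OF int]) simp
    also have "\<dots> \<le> ennreal (256 * ?S)" by (rule ennreal_leI[OF le])
    finally show "(\<integral>\<^sup>+w. M k w \<partial>circle_measure) \<le> ennreal (256 * ?S)" .
  qed
  finally show ?thesis .
qed

section \<open>Radial limits\<close>

text \<open>The default value of \<^const>\<open>boundary\<close> at points without a radial limit carries no information, so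
  algebraic rules for boundary values need this predicate.\<close>

definition has_radial_limit :: "(complex \<Rightarrow> complex) \<Rightarrow> complex \<Rightarrow> bool" where
  "has_radial_limit f w \<longleftrightarrow> ((\<lambda>r. f (of_real r * w)) \<longlongrightarrow> boundary f w) (at_left 1)"

lemma radial_limitI:
  assumes "((\<lambda>r. f (of_real r * w)) \<longlongrightarrow> l) (at_left 1)"
  shows "has_radial_limit f w" "boundary f w = l"
proof -
  show "boundary f w = l"
    unfolding boundary_def by (rule tendsto_Lim[OF trivial_limit_at_left_real assms])
  then show "has_radial_limit f w" using assms by (simp add: has_radial_limit_def)
qed

lemma has_radial_limit_LIMSEQ:
  assumes "has_radial_limit f w"
  shows "(\<lambda>k. f (of_real (radius k) * w)) \<longlonglongrightarrow> boundary f w"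
  using filterlim_compose[OF assms[unfolded has_radial_limit_def] radius_at_left] .

text \<open>The Cauchy criterion, with all quantifiers over countable sets: this shows that the set of points with
  a radial limit is measurable.\<close>

lemma radial_cauchy_iff:
  assumes hol: "f holomorphic_on ball 0 1" and w: "w \<in> sphere 0 1"
  shows "has_radial_limit f w \<longleftrightarrow> (\<forall>k. \<exists>n. \<forall>r\<in>{radius n<..<1} \<inter> \<rat>. \<forall>s\<in>{radius n<..<1} \<inter> \<rat>.
    dist (f (of_real r * w)) (f (of_real s * w)) \<le> 1 / real (Suc k))"
    (is "?L \<longleftrightarrow> ?R")
proof
  assume ?L
  show ?R
  proof
    fix k
    have "\<forall>\<^sub>F r in at_left 1. dist (f (of_real r * w)) (boundary f w) < 1 / (2 * real (Suc k))"
      using \<open>?L\<close> unfolding has_radial_limit_def by (rule tendstoD) simp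
    then obtain b where b: "b < 1" "\<And>r. b < r \<Longrightarrow> r < 1 \<Longrightarrow> dist (f (of_real r * w)) (boundary f w) < 1 / (2 * real (Suc k))"
      by (auto simp: eventually_at_left_field)
    have "\<forall>\<^sub>F n in sequentially. b < radius n" using order_tendstoD(1)[OF radius_tendsto b(1)] .
    then obtain n where n: "b < radius n" by (auto simp: eventually_sequentially)
    have "dist (f (of_real r * w)) (f (of_real s * w)) \<le> 1 / real (Suc k)"
      if "r \<in> {radius n<..<1}" "s \<in> {radius n<..<1}" for r s
    proof -
      have "dist (f (of_real r * w)) (f (of_real s * w)) \<le> 1 / (2 * real (Suc k)) + 1 / (2 * real (Suc k))"
        using b(2)[of r] b(2)[of s] that n dist_triangle2[of "f (of_real r * w)" "f (of_real s * w)" "boundary f w"]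
        by simp
      also have "\<dots> = 1 / real (Suc k)" by (simp add: field_simps)
      finally show ?thesis .
    qed
    then show "\<exists>n. \<forall>r\<in>{radius n<..<1} \<inter> \<rat>. \<forall>s\<in>{radius n<..<1} \<inter> \<rat>.
        dist (f (of_real r * w)) (f (of_real s * w)) \<le> 1 / real (Suc k)" by blast
  qed
next
  assume R: ?R
  have "cauchy_filter (filtermap (\<lambda>r. f (of_real r * w)) (at_left 1))"
    unfolding cauchy_filter_metric_filtermap
  proof (intro allI impI)
    fix e :: real assume "e > 0"
    then obtain k where k: "1 / real (Suc k) < e" using nat_approx_posE by metis
    obtain n where n: "\<And>r s. r \<in> {radius n<..<1} \<inter> \<rat> \<Longrightarrow> s \<in> {radius n<..<1} \<inter> \<rat> \<Longrightarrow>
      dist (f (of_real r * w)) (f (of_real s * w)) \<le> 1 / real (Suc k)" using R by blast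
    have cont: "continuous_on {radius n<..<1} (\<lambda>r. f (of_real r * w))"
      by (rule continuous_on_subset[OF radius_continuous[OF hol w]]) (use radius_bounds(1)[of n] in auto)
    have 1: "dist (f (of_real r * w)) (f (of_real s * w)) \<le> 1 / real (Suc k)"
      if r: "r \<in> {radius n<..<1}" and s: "s \<in> {radius n<..<1} \<inter> \<rat>" for r s
      by (rule le_on_rationals_imp_le[OF _ _ r]) (intro continuous_intros cont n s)+
    have 2: "dist (f (of_real r * w)) (f (of_real s * w)) \<le> 1 / real (Suc k)"
      if r: "r \<in> {radius n<..<1}" and s: "s \<in> {radius n<..<1}" for r s
      by (rule le_on_rationals_imp_le[OF _ _ s]) (intro continuous_intros cont 1 r)+
    have "\<forall>\<^sub>F r in at_left 1. r \<in> {radius n<..<1}"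
      using eventually_at_left_real[OF radius_bounds(2)[of n]] .
    then show "\<exists>P. (\<forall>\<^sub>F r in at_left 1. P r) \<and> (\<forall>x y. P x \<and> P y \<longrightarrow> dist (f (of_real x * w)) (f (of_real y * w)) < e)"
      using 2 k by (intro exI[of _ "\<lambda>r. r \<in> {radius n<..<1}"]) (auto intro: le_less_trans)
  qed
  moreover have "filtermap (\<lambda>r. f (of_real r * w)) (at_left 1) \<noteq> bot"
    by (simp add: filtermap_bot_iff)
  ultimately obtain l where "filtermap (\<lambda>r. f (of_real r * w)) (at_left 1) \<le> nhds l"
    using cauchy_filter_complete_converges[OF _ complete_UNIV] by auto
  then show ?L by (intro radial_limitI(1)) (simp add: filterlim_def)
qed

lemma has_radial_limit_sets:
  assumes hol: "f holomorphic_on ball 0 1"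
  shows "{w \<in> space circle_measure. has_radial_limit f w} \<in> sets circle_measure"
proof -
  have m: "(\<lambda>w. f (of_real r * w)) \<in> borel_measurable circle_measure" if "r \<in> {radius n<..<1}" for r n
    using that radius_bounds(1)[of n]
    by (intro circle_measurable_continuous dilation_continuous_sphere hol) auto
  have c: "countable ({radius n<..<1} \<inter> \<rat>)" for n using countable_rat countable_subset by blast
  have "{w \<in> space circle_measure. has_radial_limit f w} =
    {w \<in> space circle_measure. \<forall>k. \<exists>n. \<forall>r\<in>{radius n<..<1} \<inter> \<rat>. \<forall>s\<in>{radius n<..<1} \<inter> \<rat>.
    dist (f (of_real r * w)) (f (of_real s * w)) \<le> 1 / real (Suc k)}"
    using radial_cauchy_iff[OF hol] by auto
  also have "\<dots> \<in> sets circle_measure"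
  proof (intro sets.sets_Collect_countable_All sets.sets_Collect_countable_Ex sets.sets_Collect_countable_All' c)
    fix k n :: nat and r s :: real
    assume "r \<in> {radius n<..<1} \<inter> \<rat>" "s \<in> {radius n<..<1} \<inter> \<rat>"
    then have [measurable]: "(\<lambda>w. f (of_real r * w)) \<in> borel_measurable circle_measure"
      "(\<lambda>w. f (of_real s * w)) \<in> borel_measurable circle_measure" using m by auto
    show "{w \<in> space circle_measure. dist (f (of_real r * w)) (f (of_real s * w)) \<le> 1 / real (Suc k)} \<in> sets circle_measure"
      by measurable
  qed
  finally show ?thesis .
qed

text \<open>Where the radial limit fails to exist, \<^const>\<open>boundary\<close> takes one and the same value \<open>THE l. False\<close>; so it is
  measurable everywhere, not only up to a null set.\<close>

lemma boundary_measurable: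
  assumes hol: "f holomorphic_on ball 0 1"
  shows "boundary f \<in> borel_measurable circle_measure"
proof -
  define c :: complex where "c = (THE l. False)"
  have eq: "boundary f w = (if has_radial_limit f w then lim (\<lambda>k. f (of_real (radius k) * w)) else c)" for w
  proof (cases "has_radial_limit f w")
    case True
    then show ?thesis using limI[OF has_radial_limit_LIMSEQ[OF True]] by simp
  next
    case False
    then have "\<not> ((\<lambda>r. f (of_real r * w)) \<longlongrightarrow> l) (at_left 1)" for l
      using radial_limitI(1) by blast
    then show ?thesis using False by (simp add: boundary_def t2_space_class.Lim_def c_def)
  qed
  have "(\<lambda>w. f (of_real (radius k) * w)) \<in> borel_measurable circle_measure" for k
    by (intro circle_measurable_continuous dilation_continuous_sphere hol radius_bounds)
  then have "(\<lambda>w. lim (\<lambda>k. f (of_real (radius k) * w))) \<in> borel_measurable circle_measure"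
    by (rule borel_measurable_lim_metric)
  then show ?thesis
    unfolding eq[abs_def] using has_radial_limit_sets[OF hol] by (intro measurable_If) auto
qed

lemma taylor_tail:
  assumes "has_taylor a f"
  shows "has_taylor (\<lambda>n. if n < N then 0 else a n) (\<lambda>z. f z - (\<Sum>n<N. a n * z ^ n))"
  unfolding has_taylor_def
proof
  fix z :: complex assume "z \<in> ball 0 1"
  then have "(\<lambda>n. a n * z ^ n) sums f z" using assms by (simp add: has_taylor_def)
  moreover have "(\<lambda>n. if n \<in> {..<N} then a n * z ^ n else 0) sums (\<Sum>n<N. a n * z ^ n)"
    by (rule sums_If_finite_set) simp
  ultimately have "(\<lambda>n. a n * z ^ n - (if n \<in> {..<N} then a n * z ^ n else 0)) sums (f z - (\<Sum>n<N. a n * z ^ n))"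
    by (rule sums_diff)
  then show "(\<lambda>n. (if n < N then 0 else a n) * z ^ n) sums (f z - (\<Sum>n<N. a n * z ^ n))"
    by (rule sums_cong[THEN iffD1, rotated]) auto
qed

lemma summable_tail:
  fixes a :: "nat \<Rightarrow> complex"
  assumes "summable (\<lambda>n. (norm (a n))\<^sup>2)"
  shows "(\<lambda>n. (norm (if n < N then 0 else a n))\<^sup>2) sums ((\<Sum>n. (norm (a n))\<^sup>2) - (\<Sum>n<N. (norm (a n))\<^sup>2))"
proof -
  have "(\<lambda>n. (norm (a n))\<^sup>2 - (if n \<in> {..<N} then (norm (a n))\<^sup>2 else 0)) sums
      ((\<Sum>n. (norm (a n))\<^sup>2) - (\<Sum>n<N. (norm (a n))\<^sup>2))"
    by (intro sums_diff summable_sums assms sums_If_finite_set) simp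
  then show ?thesis by (rule sums_cong[THEN iffD1, rotated]) auto
qed

lemma tail_tendsto:
  fixes a :: "nat \<Rightarrow> complex"
  assumes "summable (\<lambda>n. (norm (a n))\<^sup>2)"
  shows "(\<lambda>N. \<Sum>n. (norm (if n < N then 0 else a n))\<^sup>2) \<longlonglongrightarrow> 0"
proof -
  have "(\<lambda>N. (\<Sum>n. (norm (a n))\<^sup>2) - (\<Sum>n<N. (norm (a n))\<^sup>2)) \<longlonglongrightarrow>
      (\<Sum>n. (norm (a n))\<^sup>2) - (\<Sum>n. (norm (a n))\<^sup>2)"
    by (intro tendsto_intros summable_LIMSEQ assms)
  then show ?thesis by (simp only: sums_unique[OF summable_tail[OF assms], symmetric]) simp
qed

text \<open>Let \<open>p N\<close> be the Taylor polynomials of \<open>f\<close>. By the maximal inequality the integral of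
  \<open>sup\<^sub>r |f - p N|\<^sup>2\<close> tends to 0, so at almost every point \<open>f\<close> is approximated along the whole radius, to any
  accuracy, by a polynomial. Polynomials are continuous up to the circle, hence \<open>f\<close> satisfies the Cauchy
  criterion.\<close>

theorem fatou_radial_limits:
  assumes "f \<in> hardy2"
  shows "AE w in circle_measure. has_radial_limit f w"
proof -
  obtain a where a: "has_taylor a f" "summable (\<lambda>n. (norm (a n))\<^sup>2)"
    using hardy2_taylorE[OF assms] .
  define p where "p N z = (\<Sum>n<N. a n * z ^ n)" for N z
  define g where "g N z = f z - p N z" for N z
  have g: "has_taylor (\<lambda>n. if n < N then 0 else a n) (g N)" for N
    using taylor_tail[OF a(1)] by (simp add: g_def[abs_def] p_def)
  note ghol = has_taylor_holomorphic[OF g]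
  \<comment> \<open>It is enough that the infimum over \<open>N\<close> vanishes: no subsequence has to be chosen.\<close>
  define J where "J w = (INF N. radial_max (g N) w)" for w
  have JM: "J \<in> borel_measurable circle_measure"
    unfolding J_def[abs_def] by (intro borel_measurable_INF radial_max_measurable ghol) simp
  have "(\<integral>\<^sup>+w. J w \<partial>circle_measure) \<le> ennreal (256 * (\<Sum>n. (norm (if n < N then 0 else a n))\<^sup>2))" for N
  proof -
    have "(\<integral>\<^sup>+w. J w \<partial>circle_measure) \<le> (\<integral>\<^sup>+w. radial_max (g N) w \<partial>circle_measure)"
      unfolding J_def by (intro nn_integral_mono INF_lower) simp
    also have "\<dots> \<le> ennreal (256 * (\<Sum>n. (norm (if n < N then 0 else a n))\<^sup>2))"
      by (intro radial_maximal_inequality g sums_summable[OF summable_tail[OF a(2)]])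
    finally show ?thesis .
  qed
  moreover have "(\<lambda>N. ennreal (256 * (\<Sum>n. (norm (if n < N then 0 else a n))\<^sup>2))) \<longlonglongrightarrow> ennreal (256 * 0)"
    by (intro tendsto_intros tail_tendsto a)
  ultimately have "(\<integral>\<^sup>+w. J w \<partial>circle_measure) \<le> 0"
    by (intro LIMSEQ_le_const) auto
  then have "AE w in circle_measure. J w = 0"
    using nn_integral_0_iff_AE[OF JM] by simp
  then show ?thesis
  proof (rule AE_mp, intro AE_I2 impI)
    fix w assume "w \<in> space circle_measure" and J0: "J w = 0"
    then have w: "w \<in> sphere 0 1" by simp
    show "has_radial_limit f w"
      unfolding radial_cauchy_iff[OF has_taylor_holomorphic[OF a(1)] w]
    proof
      fix k
      \<comment> \<open>The error \<open>e\<close> is spent as \<open>e/3\<close> on \<open>f - p N\<close> and \<open>e/6\<close> on the continuity of \<open>p N\<close>, twice.\<close>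
      define e where "e = 1 / real (Suc k)"
      have e: "e > 0" by (simp add: e_def)
      then have "J w < ennreal ((e/3)\<^sup>2)" using J0 by simp
      then obtain N where N: "radial_max (g N) w < ennreal ((e/3)\<^sup>2)"
        unfolding J_def by (auto simp: INF_less_iff)
      have close: "dist (f (of_real r * w)) (p N (of_real r * w)) \<le> e/3" if "0 \<le> r" "r < 1" for r
      proof -
        have "ennreal ((norm (g N (of_real r * w)))\<^sup>2) \<le> ennreal ((e/3)\<^sup>2)"
          using le_radial_max[OF ghol w that, of N] N by (meson less_imp_le order_trans)
        then have "norm (g N (of_real r * w)) \<le> e/3" using e by (simp add: power2_le_iff_abs_le)
        then show ?thesis by (simp add: g_def dist_norm)
      qed
      have "continuous_on UNIV (\<lambda>r::real. p N (of_real r * w))"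
        unfolding p_def by (intro continuous_intros)
      then have "isCont (\<lambda>r::real. p N (of_real r * w)) 1" by (simp add: continuous_on_eq_continuous_at)
      then obtain d where d: "d > 0" "\<And>r::real. dist r 1 < d \<Longrightarrow> dist (p N (of_real r * w)) (p N (of_real 1 * w)) < e/6"
        unfolding continuous_at_eps_delta using e by (metis zero_less_divide_iff zero_less_numeral)
      have "\<forall>\<^sub>F n in sequentially. 1 - d < radius n"
        using order_tendstoD(1)[OF radius_tendsto, of "1 - d"] d by simp
      then obtain n where n: "1 - d < radius n" by (auto simp: eventually_sequentially)
      have "dist (f (of_real r * w)) (p N (of_real 1 * w)) \<le> e/2" if "r \<in> {radius n<..<1}" for r
      proof -
        have "dist r 1 < d" using that n by (auto simp: dist_real_def)
        then show ?thesis
          using close[of r] d(2)[of r] that radius_bounds(1)[of n]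
            dist_triangle[of "f (of_real r * w)" "p N (of_real 1 * w)" "p N (of_real r * w)"] by simp
      qed
      then have "dist (f (of_real r * w)) (f (of_real s * w)) \<le> e"
        if "r \<in> {radius n<..<1}" "s \<in> {radius n<..<1}" for r s
        using dist_triangle2[of "f (of_real r * w)" "f (of_real s * w)" "p N (of_real 1 * w)"] that
        by (smt (verit) field_sum_of_halves)
      then show "\<exists>n. \<forall>r\<in>{radius n<..<1} \<inter> \<rat>. \<forall>s\<in>{radius n<..<1} \<inter> \<rat>.
          dist (f (of_real r * w)) (f (of_real s * w)) \<le> 1 / real (Suc k)"
        unfolding e_def by blast
    qed
  qed
qed

definition radial_bound :: "(complex \<Rightarrow> complex) \<Rightarrow> complex \<Rightarrow> real" where
  "radial_bound f w = enn2real (radial_max f w)"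

text \<open>An integrable majorant for the squares of all dilations: it makes dominated convergence available
  whenever \<open>r\<close> tends to 1.\<close>

lemma radial_bound:
  assumes "f \<in> hardy2"
  shows "integrable circle_measure (radial_bound f)"
    and "AE w in circle_measure. (\<forall>r. 0 \<le> r \<and> r < 1 \<longrightarrow> (norm (f (of_real r * w)))\<^sup>2 \<le> radial_bound f w) \<and>
      (norm (boundary f w))\<^sup>2 \<le> radial_bound f w"
proof -
  obtain a where a: "has_taylor a f" "summable (\<lambda>n. (norm (a n))\<^sup>2)"
    using hardy2_taylorE[OF assms] .
  have hol: "f holomorphic_on ball 0 1" using has_taylor_holomorphic[OF a(1)] .
  let ?m = "radial_bound f"
  have fin: "(\<integral>\<^sup>+w. radial_max f w \<partial>circle_measure) < \<infinity>"
    using radial_maximal_inequality[OF a] by (simp add: order_le_less_trans[OF _ ennreal_less_top])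
  have AE_fin: "AE w in circle_measure. radial_max f w \<noteq> \<infinity>"
    using fin by (intro nn_integral_PInf_AE radial_max_measurable hol) auto
  then have eq: "AE w in circle_measure. radial_max f w = ennreal (?m w)"
    by eventually_elim (simp add: radial_bound_def less_top)
  have "(\<integral>\<^sup>+w. ennreal (?m w) \<partial>circle_measure) = (\<integral>\<^sup>+w. radial_max f w \<partial>circle_measure)"
    using eq by (intro nn_integral_cong_AE) (auto elim: eventually_mono)
  then show "integrable circle_measure ?m"
    using fin radial_max_measurable[OF hol] unfolding radial_bound_def[abs_def]
    by (intro integrableI_nonneg) auto
  show "AE w in circle_measure. (\<forall>r. 0 \<le> r \<and> r < 1 \<longrightarrow> (norm (f (of_real r * w)))\<^sup>2 \<le> ?m w) \<and>
      (norm (boundary f w))\<^sup>2 \<le> ?m w"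
    using eq fatou_radial_limits[OF assms] AE_space
  proof eventually_elim
    case (elim w)
    have le: "(norm (f (of_real r * w)))\<^sup>2 \<le> ?m w" if "0 \<le> r" "r < 1" for r
    proof -
      have "ennreal ((norm (f (of_real r * w)))\<^sup>2) \<le> ennreal (?m w)"
        using le_radial_max[OF hol _ that, of w] elim by simp
      moreover have "0 \<le> ?m w" by (simp add: radial_bound_def)
      ultimately show ?thesis by simp
    qed
    have "(norm (boundary f w))\<^sup>2 \<le> ?m w"
    proof (rule LIMSEQ_le_const2)
      show "(\<lambda>k. (norm (f (of_real (radius k) * w)))\<^sup>2) \<longlonglongrightarrow> (norm (boundary f w))\<^sup>2"
        using elim by (intro tendsto_intros has_radial_limit_LIMSEQ)
    qed (use le radius_bounds in auto)
    then show ?case using le by blast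
  qed
qed

lemma boundary_L2:
  assumes "f \<in> hardy2"
  shows "L2 (boundary f)"
proof -
  show ?thesis
    by (rule L2_mono[OF boundary_measurable[OF hardy2_holomorphic[OF assms]] radial_bound(1)[OF assms]])
      (use radial_bound(2)[OF assms] in \<open>auto elim: eventually_mono\<close>)
qed

lemma radial_integral_limit:
  assumes f: "f \<in> hardy2" and g: "g \<in> hardy2"
    and W: "W \<in> borel_measurable circle_measure" "AE w in circle_measure. norm (W w) \<le> B"
  shows "(\<lambda>k. \<integral>\<^sub>T w. f (of_real (radius k) * w) * g (of_real (radius k) * w) * W w)
    \<longlonglongrightarrow> (\<integral>\<^sub>T w. boundary f w * boundary g w * W w)"
proof -
  let ?m = "radial_bound f"
  note m = radial_bound[OF f]
  let ?n = "radial_bound g"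
  note n = radial_bound[OF g]
  have [measurable]: "boundary f \<in> borel_measurable circle_measure" "boundary g \<in> borel_measurable circle_measure"
    using boundary_measurable hardy2_holomorphic f g by auto
  have [measurable]: "(\<lambda>w. f (of_real (radius k) * w)) \<in> borel_measurable circle_measure"
    "(\<lambda>w. g (of_real (radius k) * w)) \<in> borel_measurable circle_measure" for k
    using f g by (auto intro!: circle_measurable_continuous dilation_continuous_sphere radius_bounds hardy2_holomorphic)
  note [measurable] = W(1)
  show ?thesis
  proof (rule integral_dominated_convergence[where w = "\<lambda>w. \<bar>B\<bar> * (?m w + ?n w)"])
    show "integrable circle_measure (\<lambda>w. \<bar>B\<bar> * (?m w + ?n w))" using m(1) n(1) by simp
    show "AE w in circle_measure. (\<lambda>k. f (of_real (radius k) * w) * g (of_real (radius k) * w) * W w)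
        \<longlonglongrightarrow> boundary f w * boundary g w * W w"
      using fatou_radial_limits[OF f] fatou_radial_limits[OF g]
      by eventually_elim (intro tendsto_intros has_radial_limit_LIMSEQ)
    show "AE w in circle_measure. norm (f (of_real (radius k) * w) * g (of_real (radius k) * w) * W w)
        \<le> \<bar>B\<bar> * (?m w + ?n w)" for k
      using m(2) n(2) W(2)
    proof eventually_elim
      case (elim w)
      let ?x = "norm (f (of_real (radius k) * w))" and ?y = "norm (g (of_real (radius k) * w))"
      have "0 \<le> (?x - ?y)\<^sup>2" by simp
      moreover have "?x\<^sup>2 \<le> ?m w" "?y\<^sup>2 \<le> ?n w" using elim radius_bounds by auto
      moreover have "(?x - ?y)\<^sup>2 = ?x\<^sup>2 + ?y\<^sup>2 - 2 * (?x * ?y)" by (simp add: power2_eq_square algebra_simps)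
      moreover have "0 \<le> ?x * ?y" by simp
      ultimately have xy: "?x * ?y \<le> ?m w + ?n w" and "0 \<le> ?m w + ?n w" by linarith+
      moreover have "norm (W w) \<le> \<bar>B\<bar>" using elim by simp
      ultimately have "(?x * ?y) * norm (W w) \<le> (?m w + ?n w) * \<bar>B\<bar>" by (intro mult_mono) auto
      then show ?case by (simp add: norm_mult mult_ac)
    qed
  qed measurable
qed

section \<open>Boundary functions\<close>

lemma dilation_norm_tendsto:
  assumes f: "f \<in> hardy2"
  shows "(\<lambda>k. l2_norm (\<lambda>w. f (of_real (radius k) * w))) \<longlonglongrightarrow> l2_norm (boundary f)"
proof -
  let ?m = "radial_bound f"
  note m = radial_bound[OF f]
  have [measurable]: "boundary f \<in> borel_measurable circle_measure"
    by (intro boundary_measurable hardy2_holomorphic f)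
  have [measurable]: "(\<lambda>w. f (of_real (radius k) * w)) \<in> borel_measurable circle_measure" for k
    by (intro circle_measurable_continuous dilation_continuous_sphere radius_bounds hardy2_holomorphic f)
  have "(\<lambda>k. \<integral>\<^sub>T w. (norm (f (of_real (radius k) * w)))\<^sup>2) \<longlonglongrightarrow>
      (\<integral>\<^sub>T w. (norm (boundary f w))\<^sup>2)"
  proof (rule integral_dominated_convergence[where w = "radial_bound f"])
    show "AE w in circle_measure. (\<lambda>k. (norm (f (of_real (radius k) * w)))\<^sup>2) \<longlonglongrightarrow> (norm (boundary f w))\<^sup>2"
      using fatou_radial_limits[OF f]
      by eventually_elim (intro tendsto_intros has_radial_limit_LIMSEQ)
    show "AE w in circle_measure. norm ((norm (f (of_real (radius k) * w)))\<^sup>2) \<le> ?m w" for k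
      using m(2) by eventually_elim (simp add: radius_bounds)
  qed (use m(1) in measurable)
  then show ?thesis
    unfolding l2_norm_def by (rule tendsto_real_sqrt)
qed

lemma boundary_norm:
  assumes a: "has_taylor a f" and f: "f \<in> hardy2"
  shows "(l2_norm (boundary f))\<^sup>2 \<le> (\<Sum>n. (norm (a n))\<^sup>2)"
proof (rule LIMSEQ_le_const2)
  have S: "summable (\<lambda>n. (norm (a n))\<^sup>2)" using hardy2_iff_taylor[OF a] f by simp
  show "(\<lambda>k. (l2_norm (\<lambda>w. f (of_real (radius k) * w)))\<^sup>2) \<longlonglongrightarrow> (l2_norm (boundary f))\<^sup>2"
    by (intro tendsto_intros dilation_norm_tendsto f)
  show "\<exists>N. \<forall>k\<ge>N. (l2_norm (\<lambda>w. f (of_real (radius k) * w)))\<^sup>2 \<le> (\<Sum>n. (norm (a n))\<^sup>2)"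
    unfolding l2_norm_sq
    by (intro exI allI impI taylor_summable_imp_bounded_means[OF a S] radius_bounds)
qed

lemma const_hardy2: "(\<lambda>_. c) \<in> hardy2"
  unfolding hardy2_iff_bounded by (auto intro!: exI[of _ "(norm c)\<^sup>2"])

lemma hardy2_bounded_mult:
  assumes f: "f \<in> hardy2" and g: "g \<in> hardy_inf"
  shows "(\<lambda>z. g z * f z) \<in> hardy2"
proof -
  obtain B where B: "\<And>z. z \<in> ball 0 1 \<Longrightarrow> norm (g z) \<le> B"
    using g unfolding hardy_inf_def bounded_iff by blast
  have B0: "0 \<le> B" using order_trans[OF norm_ge_zero B[of 0]] by simp
  obtain C where C: "\<And>r. 0 \<le> r \<Longrightarrow> r < 1 \<Longrightarrow> (\<integral>\<^sub>T w. (norm (f (of_real r * w)))\<^sup>2) \<le> C"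
    using f unfolding hardy2_iff_bounded by blast
  note fh = hardy2_holomorphic[OF f]
  have h: "(\<lambda>z. g z * f z) holomorphic_on ball 0 1" using g by (auto simp: hardy_inf_def intro!: holomorphic_intros fh)
  have "(\<integral>\<^sub>T w. (norm (g (of_real r * w) * f (of_real r * w)))\<^sup>2) \<le> B\<^sup>2 * C" if r: "0 \<le> r" "r < 1" for r
  proof -
    have "l2_norm (\<lambda>w. g (of_real r * w) * f (of_real r * w)) \<le> B * l2_norm (\<lambda>w. f (of_real r * w))"
    proof (intro l2_norm_le dilation_L2[OF fh r] L2_measurable[OF dilation_L2[OF h r]] B0 AE_I2)
      fix w assume "w \<in> space circle_measure"
      then have "norm (g (of_real r * w)) \<le> B" using dilation_mem_ball[OF r, of w] by (intro B) auto
      then show "norm (g (of_real r * w) * f (of_real r * w)) \<le> B * norm (f (of_real r * w))"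
        by (simp add: norm_mult mult_right_mono)
    qed
    then have "(l2_norm (\<lambda>w. g (of_real r * w) * f (of_real r * w)))\<^sup>2 \<le> (B * l2_norm (\<lambda>w. f (of_real r * w)))\<^sup>2"
      by (intro power_mono) auto
    also have "\<dots> \<le> B\<^sup>2 * C" unfolding power_mult_distrib l2_norm_sq by (intro mult_left_mono C r) simp
    finally show ?thesis by (simp only: l2_norm_sq)
  qed
  then show ?thesis unfolding hardy2_iff_bounded using h by blast
qed

lemma hardy_inf_imp_hardy2: "g \<in> hardy_inf \<Longrightarrow> g \<in> hardy2"
  using hardy2_bounded_mult[OF const_hardy2[of 1]] by simp

lemma hardy2_add:
  assumes "f \<in> hardy2" "g \<in> hardy2" shows "(\<lambda>z. f z + g z) \<in> hardy2"
proof -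
  obtain A where A: "\<And>r. 0 \<le> r \<Longrightarrow> r < 1 \<Longrightarrow> (\<integral>\<^sub>T w. (norm (f (of_real r * w)))\<^sup>2) \<le> A"
    using assms(1) unfolding hardy2_iff_bounded by blast
  obtain B where B: "\<And>r. 0 \<le> r \<Longrightarrow> r < 1 \<Longrightarrow> (\<integral>\<^sub>T w. (norm (g (of_real r * w)))\<^sup>2) \<le> B"
    using assms(2) unfolding hardy2_iff_bounded by blast
  note h = assms[THEN hardy2_holomorphic]
  have "(\<integral>\<^sub>T w. (norm (f (of_real r * w) + g (of_real r * w)))\<^sup>2) \<le> (sqrt A + sqrt B)\<^sup>2"
    if r: "0 \<le> r" "r < 1" for r
  proof -
    note si = dilation_L2[OF h(1) r] dilation_L2[OF h(2) r]
    have "l2_norm (\<lambda>w. f (of_real r * w) + g (of_real r * w)) \<le> sqrt A + sqrt B"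
      using l2_norm_triangle[OF si] A[OF r] B[OF r] unfolding l2_norm_def
      by (meson add_mono order_trans real_sqrt_le_mono)
    then have "(l2_norm (\<lambda>w. f (of_real r * w) + g (of_real r * w)))\<^sup>2 \<le> (sqrt A + sqrt B)\<^sup>2"
      by (intro power_mono) auto
    then show ?thesis by (simp add: l2_norm_sq)
  qed
  then show ?thesis unfolding hardy2_iff_bounded using h by (blast intro: holomorphic_intros)
qed

lemma const_hardy_inf: "(\<lambda>_. c) \<in> hardy_inf"
  by (simp add: hardy_inf_def bounded_iff) blast

lemma monomial_hardy_inf: "(\<lambda>z. z ^ n) \<in> hardy_inf"
  unfolding hardy_inf_def bounded_iff
  by (auto intro!: holomorphic_intros exI[of _ 1] simp: norm_power power_le_one)

lemma hardy_inf_mult: "f \<in> hardy_inf \<Longrightarrow> g \<in> hardy_inf \<Longrightarrow> (\<lambda>z. f z * g z) \<in> hardy_inf"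
proof -
  assume f: "f \<in> hardy_inf" and g: "g \<in> hardy_inf"
  obtain A where A: "\<And>z. z \<in> ball 0 1 \<Longrightarrow> norm (f z) \<le> A"
    using f unfolding hardy_inf_def bounded_iff by blast
  obtain B where B: "\<And>z. z \<in> ball 0 1 \<Longrightarrow> norm (g z) \<le> B"
    using g unfolding hardy_inf_def bounded_iff by blast
  have "norm (f z * g z) \<le> A * B" if "z \<in> ball 0 1" for z
    unfolding norm_mult using A[OF that] B[OF that] norm_ge_zero order_trans by (intro mult_mono) blast+
  then show ?thesis
    using f g unfolding hardy_inf_def bounded_iff by (auto intro!: holomorphic_intros exI[of _ "A * B"])
qed

lemma hardy2_cmult: "f \<in> hardy2 \<Longrightarrow> (\<lambda>z. c * f z) \<in> hardy2"
  using hardy2_bounded_mult[OF _ const_hardy_inf] .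

lemma hardy2_diff: "f \<in> hardy2 \<Longrightarrow> g \<in> hardy2 \<Longrightarrow> (\<lambda>z. f z - g z) \<in> hardy2"
  using hardy2_add[of f "\<lambda>z. (-1) * g z"] hardy2_cmult[of g "-1"] by simp

lemma boundary_add:
  assumes "has_radial_limit f w" "has_radial_limit g w"
  shows "boundary (\<lambda>z. f z + g z) w = boundary f w + boundary g w"
  using assms unfolding has_radial_limit_def[of f] has_radial_limit_def[of g]
  by (intro radial_limitI(2) tendsto_add)

lemma boundary_diff:
  assumes "has_radial_limit f w" "has_radial_limit g w"
  shows "boundary (\<lambda>z. f z - g z) w = boundary f w - boundary g w"
  using assms unfolding has_radial_limit_def[of f] has_radial_limit_def[of g]
  by (intro radial_limitI(2) tendsto_diff)

lemma boundary_mult: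
  assumes "has_radial_limit f w" "has_radial_limit g w"
  shows "boundary (\<lambda>z. f z * g z) w = boundary f w * boundary g w"
  using assms unfolding has_radial_limit_def[of f] has_radial_limit_def[of g]
  by (intro radial_limitI(2) tendsto_mult)

lemma radial_limit_id: "((\<lambda>r. of_real r * w) \<longlongrightarrow> (w :: complex)) (at_left 1)"
proof -
  have "((\<lambda>r. of_real r * w) \<longlongrightarrow> of_real 1 * w) (at_left 1)" by (intro tendsto_intros)
  then show ?thesis by simp
qed

lemma boundary_const: "has_radial_limit (\<lambda>_. c) w" "boundary (\<lambda>_. c) w = c"
  by (rule radial_limitI, rule tendsto_const)+

lemma boundary_cmult:
  "has_radial_limit f w \<Longrightarrow> boundary (\<lambda>z. c * f z) w = c * boundary f w"
  using boundary_mult[OF boundary_const(1)] by (simp add: boundary_const)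

lemma boundary_polynomial:
  "has_radial_limit (\<lambda>z. \<Sum>n<N. a n * z ^ n) w" "boundary (\<lambda>z. \<Sum>n<N. a n * z ^ n) w = (\<Sum>n<N. a n * w ^ n)"
proof -
  have "((\<lambda>r. \<Sum>n<N. a n * (of_real r * w) ^ n) \<longlongrightarrow> (\<Sum>n<N. a n * w ^ n)) (at_left 1)"
    by (intro tendsto_sum tendsto_mult tendsto_const tendsto_power radial_limit_id)
  then show "has_radial_limit (\<lambda>z. \<Sum>n<N. a n * z ^ n) w"
    "boundary (\<lambda>z. \<Sum>n<N. a n * z ^ n) w = (\<Sum>n<N. a n * w ^ n)"
    by (rule radial_limitI)+
qed

lemma boundary_monomial: "has_radial_limit (\<lambda>z. z ^ n) w" "boundary (\<lambda>z. z ^ n) w = w ^ n"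
proof -
  have "((\<lambda>r. (of_real r * w) ^ n) \<longlongrightarrow> w ^ n) (at_left 1)"
    by (intro tendsto_power radial_limit_id)
  then show "has_radial_limit (\<lambda>z. z ^ n) w" "boundary (\<lambda>z. z ^ n) w = w ^ n"
    by (rule radial_limitI)+
qed

text \<open>Stated for a product, since \<open>f * g\<close> need not be in the Hardy space; \<open>g = 1\<close> gives the Fourier
  coefficients of a single boundary function.\<close>

lemma boundary_product_coefficient:
  assumes f: "f \<in> hardy2" and g: "g \<in> hardy2" and c: "has_taylor c (\<lambda>z. f z * g z)"
  shows "(\<integral>\<^sub>T w. boundary f w * boundary g w * cnj (w ^ n)) = c n"
proof (rule LIMSEQ_unique)
  show "(\<lambda>k. \<integral>\<^sub>T w. f (of_real (radius k) * w) * g (of_real (radius k) * w) * cnj (w ^ n))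
    \<longlonglongrightarrow> (\<integral>\<^sub>T w. boundary f w * boundary g w * cnj (w ^ n))"
    by (rule radial_integral_limit[OF f g, where B = 1])
      (auto intro!: circle_measurable_continuous continuous_intros simp: norm_power)
  have "(\<lambda>k. c n * of_real (radius k) ^ n) \<longlonglongrightarrow> c n * of_real 1 ^ n"
    by (intro tendsto_intros radius_tendsto)
  then show "(\<lambda>k. \<integral>\<^sub>T w. f (of_real (radius k) * w) * g (of_real (radius k) * w) * cnj (w ^ n))
    \<longlonglongrightarrow> c n"
    using dilation_coefficient[OF c radius_bounds(1,2)] by simp
qed

lemma boundary_coefficient:
  assumes "f \<in> hardy2" "has_taylor a f"
  shows "(\<integral>\<^sub>T w. boundary f w * cnj (w ^ n)) = a n"
  using boundary_product_coefficient[OF assms(1) const_hardy2[of 1], of a n] assms(2)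
  by (simp add: boundary_const)

text \<open>A case of Smirnov's theorem. The Taylor coefficients of \<open>f * g\<close> are Fourier coefficients of the product of the
  boundary functions, so Bessel's inequality makes them square summable.\<close>

lemma product_in_hardy2:
  assumes f: "f \<in> hardy2" and g: "g \<in> hardy2"
    and fg: "L2 (\<lambda>w. boundary f w * boundary g w)"
  shows "(\<lambda>z. f z * g z) \<in> hardy2"
proof -
  have "(\<lambda>z. f z * g z) holomorphic_on ball 0 1"
    using f g by (intro holomorphic_intros hardy2_holomorphic)
  then obtain c where c: "has_taylor c (\<lambda>z. f z * g z)" using holomorphic_has_taylor by blast
  have "(\<Sum>n<N. (norm (c n))\<^sup>2) \<le> (l2_norm (\<lambda>w. boundary f w * boundary g w))\<^sup>2" for N
    using bessel_inequality[OF fg, of N] by (simp only: boundary_product_coefficient[OF f g c])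
  then have "summable (\<lambda>n. (norm (c n))\<^sup>2)" by (rule summableI_nonneg_bounded[rotated]) simp
  then show ?thesis using hardy2_iff_taylor[OF c] by simp
qed

lemma boundary_partial_sums:
  assumes f: "f \<in> hardy2" and a: "has_taylor a f"
  shows "(\<lambda>N. l2_norm (\<lambda>w. boundary f w - (\<Sum>n<N. a n * w ^ n))) \<longlonglongrightarrow> 0"
proof -
  have S: "summable (\<lambda>n. (norm (a n))\<^sup>2)" using hardy2_iff_taylor[OF a] f by simp
  have le: "l2_norm (\<lambda>w. boundary f w - (\<Sum>n<N. a n * w ^ n)) \<le>
      sqrt (\<Sum>n. (norm (if n < N then 0 else a n))\<^sup>2)" for N
  proof -
    let ?g = "\<lambda>z. f z - (\<Sum>n<N. a n * z ^ n)"
    have g: "?g \<in> hardy2"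
      using hardy2_iff_taylor[OF taylor_tail[OF a]] sums_summable[OF summable_tail[OF S]] by blast
    have "l2_norm (\<lambda>w. boundary f w - (\<Sum>n<N. a n * w ^ n)) = l2_norm (boundary ?g)"
    proof (rule l2_norm_cong_AE)
      show "AE w in circle_measure. boundary f w - (\<Sum>n<N. a n * w ^ n) = boundary ?g w"
        using fatou_radial_limits[OF f] by eventually_elim (simp add: boundary_diff boundary_polynomial)
    qed (intro L2_measurable L2_diff boundary_L2 f g L2_continuous continuous_intros)+
    then have "(l2_norm (\<lambda>w. boundary f w - (\<Sum>n<N. a n * w ^ n)))\<^sup>2 = (l2_norm (boundary ?g))\<^sup>2" by simp
    also have "\<dots> \<le> (\<Sum>n. (norm (if n < N then 0 else a n))\<^sup>2)"
      by (rule boundary_norm[OF taylor_tail[OF a] g])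
    finally show ?thesis by (rule real_le_rsqrt)
  qed
  show ?thesis
  proof (rule tendsto_sandwich[OF _ _ tendsto_const])
    show "(\<lambda>N. sqrt (\<Sum>n. (norm (if n < N then 0 else a n))\<^sup>2)) \<longlonglongrightarrow> 0"
      using tendsto_real_sqrt[OF tail_tendsto[OF S]] by simp
  qed (use le in auto)
qed

text \<open>Boundary functions are limits of polynomials in the mean, by \<open>boundary_partial_sums\<close>.\<close>

lemma orthogonal_to_monomials_imp_hardy2:
  assumes F: "L2 F" and n: "\<And>n. (\<integral>\<^sub>T w. F w * cnj (w ^ n)) = 0"
    and h: "h \<in> hardy2"
  shows "(\<integral>\<^sub>T w. F w * cnj (boundary h w)) = 0"
proof -
  obtain a where a: "has_taylor a h" using hardy2_taylorE[OF h] by blast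
  let ?p = "\<lambda>N w. \<Sum>n<N. a n * w ^ n"
  have bh: "L2 (boundary h)" by (rule boundary_L2[OF h])
  have p: "L2 (?p N)" for N by (intro L2_continuous continuous_intros)
  have "norm (\<integral>\<^sub>T w. F w * cnj (boundary h w)) \<le>
      l2_norm F * l2_norm (\<lambda>w. boundary h w - ?p N w)" for N
  proof -
    have "(\<integral>\<^sub>T w. F w * cnj (?p N w)) = 0"
      by (simp only: l2_inner_trig_poly[OF F] n) simp
    then have "(\<integral>\<^sub>T w. F w * cnj (boundary h w)) =
        (\<integral>\<^sub>T w. F w * cnj (boundary h w)) - (\<integral>\<^sub>T w. F w * cnj (?p N w))" by simp
    also have "\<dots> = (\<integral>\<^sub>T w. F w * cnj (boundary h w) - F w * cnj (?p N w))"
      by (intro Bochner_Integration.integral_diff[symmetric] L2_mult F L2_cnj bh p)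
    also have "\<dots> = (\<integral>\<^sub>T w. F w * cnj (boundary h w - ?p N w))"
      by (simp only: complex_cnj_diff right_diff_distrib)
    also have "norm \<dots> \<le> l2_norm F * l2_norm (\<lambda>w. cnj (boundary h w - ?p N w))"
      by (intro l2_inner_bound F L2_cnj L2_diff bh p)
    also have "l2_norm (\<lambda>w. cnj (boundary h w - ?p N w)) = l2_norm (\<lambda>w. boundary h w - ?p N w)"
      by (rule l2_norm_cong) (rule complex_mod_cnj)
    finally show ?thesis .
  qed
  moreover have "(\<lambda>N. l2_norm F * l2_norm (\<lambda>w. boundary h w - ?p N w)) \<longlonglongrightarrow> l2_norm F * 0"
    by (intro tendsto_intros boundary_partial_sums h a)
  ultimately have "norm (\<integral>\<^sub>T w. F w * cnj (boundary h w)) \<le> l2_norm F * 0"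
    by (intro LIMSEQ_le_const) auto
  then show ?thesis by simp
qed

lemma l2_norm_eq_0_imp:
  assumes "f \<in> hardy2" "l2_norm (boundary f) = 0" "z \<in> ball 0 1"
  shows "f z = 0"
proof -
  obtain a where a: "has_taylor a f" using hardy2_taylorE[OF assms(1)] by blast
  have "a n = 0" for n
  proof -
    have "norm (a n) \<le> l2_norm (boundary f) * l2_norm (\<lambda>w. cnj (w ^ n))"
      using l2_inner_bound[OF boundary_L2[OF assms(1)] L2_cnj[OF L2_monomial]]
      by (simp only: boundary_coefficient[OF assms(1) a])
    then show ?thesis using assms(2) by simp
  qed
  then have "(\<lambda>n. 0) sums f z" using a assms(3) by (simp add: has_taylor_def)
  then show ?thesis using sums_unique2 sums_zero by blast
qed

text \<open>The projection is the power series whose coefficients are the Fourier coefficients of \<open>F\<close> of nonnegative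
  index; Bessel's inequality puts it into the Hardy space.\<close>

lemma riesz_projection_exists:
  assumes F: "L2 F"
  shows "\<exists>g. g \<in> hardy2 \<and> (\<forall>h\<in>hardy2. l2_inner (\<lambda>w. F w - boundary g w) (boundary h) = 0)"
proof -
  define c where "c n = (\<integral>\<^sub>T w. F w * cnj (w ^ n))" for n
  have S: "summable (\<lambda>n. (norm (c n))\<^sup>2)"
    by (rule summableI_nonneg_bounded) (simp, unfold c_def, rule bessel_inequality[OF F])
  have "has_taylor c (\<lambda>z. \<Sum>n. c n * z ^ n)"
    unfolding has_taylor_def
  proof
    fix z :: complex assume z: "z \<in> ball 0 1"
    have "(\<lambda>n. (norm (c n))\<^sup>2) \<longlonglongrightarrow> 0" by (rule summable_LIMSEQ_zero[OF S])
    then have "Bseq (\<lambda>n. (norm (c n))\<^sup>2)" by (intro convergent_imp_Bseq convergentI)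
    then obtain B where B: "B > 0" "\<And>n. norm ((norm (c n))\<^sup>2) \<le> B" unfolding Bseq_def by blast
    have "norm (c n) \<le> sqrt B" for n
      by (rule real_le_rsqrt) (use B(2)[of n] in simp)
    then have le: "norm (c n * z ^ n) \<le> sqrt B * norm z ^ n" for n
      unfolding norm_mult norm_power by (intro mult_right_mono) auto
    have "summable (\<lambda>n. sqrt B * norm z ^ n)" using z by (intro summable_mult summable_geometric) simp
    then have "summable (\<lambda>n. c n * z ^ n)" by (rule summable_comparison_test'[where N = 0]) (rule le)
    then show "(\<lambda>n. c n * z ^ n) sums (\<Sum>n. c n * z ^ n)" by (rule summable_sums)
  qed
  then obtain g where c: "has_taylor c g" by blast
  have g: "g \<in> hardy2" using hardy2_iff_taylor[OF c] S by simp
  have bg: "L2 (boundary g)" by (rule boundary_L2[OF g])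
  have "l2_inner (\<lambda>w. F w - boundary g w) (boundary h) = 0" if "h \<in> hardy2" for h
    unfolding l2_inner_def
  proof (rule orthogonal_to_monomials_imp_hardy2[OF L2_diff[OF F bg] _ that])
    fix n
    have "(\<integral>\<^sub>T w. (F w - boundary g w) * cnj (w ^ n)) =
        (\<integral>\<^sub>T w. F w * cnj (w ^ n)) - (\<integral>\<^sub>T w. boundary g w * cnj (w ^ n))"
      unfolding left_diff_distrib
      by (intro Bochner_Integration.integral_diff L2_mult F bg L2_cnj L2_monomial)
    then show "(\<integral>\<^sub>T w. (F w - boundary g w) * cnj (w ^ n)) = 0"
      by (simp only: boundary_coefficient[OF g c] c_def) simp
  qed
  then show ?thesis using g by blast
qed

lemma riesz_projection:
  assumes "L2 F"
  shows "riesz_projection F \<in> hardy2"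
    "h \<in> hardy2 \<Longrightarrow> (\<integral>\<^sub>T w. (F w - boundary (riesz_projection F) w) * cnj (boundary h w)) = 0"
  using someI_ex[OF riesz_projection_exists[OF assms], folded riesz_projection_def]
  by (auto simp: l2_inner_def)

lemma riesz_projection_eq_0_iff:
  assumes F: "L2 F"
  shows "(\<forall>z\<in>ball 0 1. riesz_projection F z = 0) \<longleftrightarrow>
    (\<forall>h\<in>hardy2. (\<integral>\<^sub>T w. F w * cnj (boundary h w)) = 0)"
proof -
  let ?g = "riesz_projection F"
  note g = riesz_projection[OF F]
  have bg: "L2 (boundary ?g)" by (rule boundary_L2[OF g(1)])
  have eq: "(\<integral>\<^sub>T w. F w * cnj (boundary h w)) = (\<integral>\<^sub>T w. boundary ?g w * cnj (boundary h w))"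
    if "h \<in> hardy2" for h
  proof -
    have "(\<integral>\<^sub>T w. F w * cnj (boundary h w)) - (\<integral>\<^sub>T w. boundary ?g w * cnj (boundary h w)) = 0"
      using g(2)[OF that] unfolding left_diff_distrib
      by (subst Bochner_Integration.integral_diff[symmetric])
        (auto intro!: L2_mult F bg L2_cnj boundary_L2 that)
    then show ?thesis by simp
  qed
  show ?thesis
  proof
    assume 0: "\<forall>z\<in>ball 0 1. ?g z = 0"
    have "boundary ?g w = 0" if "w \<in> sphere 0 1" for w
    proof (rule radial_limitI(2))
      have "\<forall>\<^sub>F r in at_left (1::real). r \<in> {0<..<1}" by (rule eventually_at_left_real) simp
      then have "\<forall>\<^sub>F r in at_left 1. 0 = ?g (of_real r * w)"
        by eventually_elim (use 0 that dilation_mem_ball[of _ w] in auto)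
      then show "((\<lambda>r. ?g (of_real r * w)) \<longlongrightarrow> 0) (at_left 1)"
        by (rule Lim_transform_eventually[OF tendsto_const])
    qed
    then have "(\<integral>\<^sub>T w. boundary ?g w * cnj (boundary h w)) = (\<integral>\<^sub>T w. 0)" for h
      by (intro Bochner_Integration.integral_cong refl) simp
    then show "\<forall>h\<in>hardy2. (\<integral>\<^sub>T w. F w * cnj (boundary h w)) = 0"
      using eq by simp
  next
    assume 0: "\<forall>h\<in>hardy2. (\<integral>\<^sub>T w. F w * cnj (boundary h w)) = 0"
    then have "(\<integral>\<^sub>T w. boundary ?g w * cnj (boundary ?g w)) = 0" using eq[OF g(1)] g(1) by simp
    then have "complex_of_real ((l2_norm (boundary ?g))\<^sup>2) = 0"
      by (simp only: l2_norm_sq mult.commute[of _ "cnj _"] cnj_mult_self integral_complex_of_real)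
    then have "l2_norm (boundary ?g) = 0" by simp
    then show "\<forall>z\<in>ball 0 1. ?g z = 0" using l2_norm_eq_0_imp[OF g(1)] by blast
  qed
qed

lemma poisson_representation:
  assumes f: "f \<in> hardy2" and z: "norm z < 1"
  shows "(\<integral>\<^sub>T w. boundary f w * of_real (poisson z w)) = f z"
proof (rule LIMSEQ_unique)
  have P: "(\<lambda>w. complex_of_real (poisson z w)) \<in> borel_measurable circle_measure"
    by (intro circle_measurable_continuous continuous_intros poisson_continuous z)
  have B: "AE w in circle_measure. norm (complex_of_real (poisson z w)) \<le> 1 / (1 - norm z)\<^sup>2"
    using poisson_bound[OF order_refl z] poisson_nonneg[OF z] by (intro AE_I2) auto
  show "(\<lambda>k. f (of_real (radius k) * z)) \<longlonglongrightarrow> (\<integral>\<^sub>T w. boundary f w * of_real (poisson z w))"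
  proof -
    have "(\<integral>\<^sub>T w. f (of_real (radius k) * w) * of_real (poisson z w)) = f (of_real (radius k) * z)" for k
      by (intro poisson_integral[OF dilation_continuous dilation_holomorphic z] radius_bounds hardy2_holomorphic f)
    then show ?thesis
      using radial_integral_limit[OF f const_hardy2[of 1] P B] by (simp only: boundary_const mult_1_right)
  qed
  have "isCont f z" using hardy2_holomorphic[OF f] z
    by (auto dest!: holomorphic_on_imp_continuous_on simp: continuous_on_eq_continuous_at)
  moreover have "(\<lambda>k. of_real (radius k) * z) \<longlonglongrightarrow> of_real 1 * z" by (intro tendsto_intros radius_tendsto)
  ultimately show "(\<lambda>k. f (of_real (radius k) * z)) \<longlonglongrightarrow> f z"
    using isCont_tendsto_compose by force
qed

text \<open>The maximum principle for boundary values: the Poisson kernel is a probability density.\<close>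

lemma boundary_bounded_imp_bounded:
  assumes f: "f \<in> hardy2" and B: "AE w in circle_measure. norm (boundary f w) \<le> B" and z: "z \<in> ball 0 1"
  shows "norm (f z) \<le> B"
proof -
  have z: "norm z < 1" using z by simp
  have P: "integrable circle_measure (poisson z)" by (intro circle_integrable_continuous poisson_continuous z)
  have "norm (f z) \<le> (\<integral>\<^sub>T w. norm (boundary f w * of_real (poisson z w)))"
    using integral_norm_bound[of circle_measure "\<lambda>w. boundary f w * of_real (poisson z w)"]
    by (simp only: poisson_representation[OF f z])
  also have "\<dots> \<le> (\<integral>\<^sub>T w. B * poisson z w)"
  proof (rule integral_mono_AE)
    have "L2 (\<lambda>w. of_real (poisson z w))"
      by (intro L2_continuous continuous_intros poisson_continuous z)
    then show "integrable circle_measure (\<lambda>w. norm (boundary f w * of_real (poisson z w)))"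
      by (intro integrable_norm L2_mult boundary_L2 f)
    show "integrable circle_measure (\<lambda>w. B * poisson z w)" using P by simp
    show "AE w in circle_measure. norm (boundary f w * of_real (poisson z w)) \<le> B * poisson z w"
      using B by eventually_elim (simp add: norm_mult poisson_nonneg[OF z] mult_right_mono)
  qed
  also have "\<dots> = B" using poisson_total[OF z] by simp
  finally show ?thesis .
qed

lemma hardy2_pointwise_bound:
  assumes f: "f \<in> hardy2" and z: "norm z \<le> r" "r < 1"
  shows "norm (f z) \<le> 1 / (1 - r)\<^sup>2 * l2_norm (boundary f)"
proof -
  have z1: "norm z < 1" using z by simp
  let ?P = "\<lambda>w. complex_of_real (poisson z w)"
  have P: "L2 ?P"
    by (intro L2_continuous continuous_intros poisson_continuous z1)
  have one: "L2 (\<lambda>_. 1)" by (intro L2_continuous continuous_intros)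
  have "norm (f z) \<le> l2_norm (boundary f) * l2_norm ?P"
    using l2_inner_bound[OF boundary_L2[OF f] P] by (simp only: poisson_representation[OF f z1])
  moreover have P_le: "l2_norm ?P \<le> 1 / (1 - r)\<^sup>2 * l2_norm (\<lambda>_. 1)"
    using poisson_bound[OF z] poisson_nonneg[OF z1]
    by (intro l2_norm_le one L2_measurable P AE_I2) auto
  moreover have "l2_norm (boundary f) * l2_norm ?P \<le> l2_norm (boundary f) * (1 / (1 - r)\<^sup>2)"
    using P_le by (intro mult_left_mono) (simp_all add: l2_norm_def)
  ultimately have "norm (f z) \<le> l2_norm (boundary f) * (1 / (1 - r)\<^sup>2)" by linarith
  then show ?thesis by (simp only: mult.commute)
qed

section \<open>Completeness and uniform boundedness\<close>

definition hardy_norm :: "(complex \<Rightarrow> complex) \<Rightarrow> real" where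
  "hardy_norm f = l2_norm (boundary f)"

lemma hardy_norm_nonneg [simp]: "0 \<le> hardy_norm f"
  by (simp add: hardy_norm_def)

lemma hardy_norm_add:
  assumes "f \<in> hardy2" "g \<in> hardy2"
  shows "hardy_norm (\<lambda>z. f z + g z) \<le> hardy_norm f + hardy_norm g"
proof -
  have si: "L2 (boundary f)" "L2 (boundary g)"
    using assms by (auto intro: boundary_L2)
  have "l2_norm (boundary (\<lambda>z. f z + g z)) = l2_norm (\<lambda>w. boundary f w + boundary g w)"
  proof (rule l2_norm_cong_AE)
    show "AE w in circle_measure. boundary (\<lambda>z. f z + g z) w = boundary f w + boundary g w"
      using assms[THEN fatou_radial_limits] by eventually_elim (rule boundary_add)
  qed (intro L2_measurable boundary_L2 hardy2_add L2_add assms)+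
  then show ?thesis using l2_norm_triangle[OF si] by (simp add: hardy_norm_def)
qed

lemma hardy_norm_cmult:
  assumes "f \<in> hardy2"
  shows "hardy_norm (\<lambda>z. c * f z) = norm c * hardy_norm f"
proof -
  have "l2_norm (boundary (\<lambda>z. c * f z)) = l2_norm (\<lambda>w. c * boundary f w)"
  proof (rule l2_norm_cong_AE)
    show "AE w in circle_measure. boundary (\<lambda>z. c * f z) w = c * boundary f w"
      using fatou_radial_limits[OF assms] by eventually_elim (rule boundary_cmult)
  qed (intro L2_measurable boundary_L2 hardy2_cmult L2_cmult assms)+
  then show ?thesis by (simp add: hardy_norm_def l2_norm_cmult)
qed

lemma dilation_norm_le:
  assumes f: "f \<in> hardy2" and r: "0 \<le> r" "r < 1"
  shows "l2_norm (\<lambda>w. f (of_real r * w)) \<le> hardy_norm f"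
proof -
  obtain a where a: "has_taylor a f" "summable (\<lambda>n. (norm (a n))\<^sup>2)" using hardy2_taylorE[OF f] .
  have "(l2_norm (\<lambda>w. f (of_real r * w)))\<^sup>2 \<le> (\<Sum>n. (norm (a n))\<^sup>2)"
    unfolding l2_norm_sq by (rule taylor_summable_imp_bounded_means[OF a r])
  also have "\<dots> \<le> (l2_norm (boundary f))\<^sup>2"
  proof (rule suminf_le_const[OF a(2)])
    show "(\<Sum>n<N. (norm (a n))\<^sup>2) \<le> (l2_norm (boundary f))\<^sup>2" for N
      using bessel_inequality[OF boundary_L2[OF f], of N]
      by (simp only: boundary_coefficient[OF f a(1)])
  qed
  finally show ?thesis unfolding hardy_norm_def by (rule power2_le_imp_le) simp
qed

text \<open>Pointwise bounds turn norm convergence into locally uniform convergence, which produces a holomorphic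
  limit; the norm estimate passes to the limit on each circle of radius \<open>r < 1\<close>. The geometric rate is the
  one that the uniform boundedness principle below produces.\<close>

lemma hardy2_complete:
  assumes x: "\<And>n. x n \<in> hardy2"
    and d: "\<And>n. hardy_norm (\<lambda>z. x (Suc n) z - x n z) \<le> (1/3) ^ n"
  obtains y where "y \<in> hardy2" "\<And>n. hardy_norm (\<lambda>z. y z - x n z) \<le> 3/2 * (1/3) ^ n"
proof -
  have diff: "hardy_norm (\<lambda>z. x (n + j) z - x n z) \<le> 3/2 * ((1/3) ^ n - (1/3) ^ (n + j))" for n j
  proof (induction j)
    case 0
    have "(\<lambda>z. x n z - x n z) = (\<lambda>z. 0 * x n z)" by auto
    then show ?case using hardy_norm_cmult[OF x[of n], of 0] by simp
  next
    case (Suc j)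
    have "hardy_norm (\<lambda>z. x (n + Suc j) z - x n z) =
        hardy_norm (\<lambda>z. (x (Suc (n + j)) z - x (n + j) z) + (x (n + j) z - x n z))" by simp
    also have "\<dots> \<le> (1/3) ^ (n + j) + 3/2 * ((1/3) ^ n - (1/3) ^ (n + j))"
      using hardy_norm_add[OF hardy2_diff[OF x x] hardy2_diff[OF x x], of "Suc (n + j)" "n + j" "n + j" n]
        Suc.IH d[of "n + j"] by linarith
    also have "\<dots> = 3/2 * ((1/3) ^ n - (1/3) ^ (n + Suc j))" by (simp add: field_simps)
    finally show ?case .
  qed
  have le: "hardy_norm (\<lambda>z. x m z - x n z) \<le> 3/2 * (1/3) ^ n" if "n \<le> m" for n m
  proof -
    obtain j where m: "m = n + j" using \<open>n \<le> m\<close> by (auto simp: le_iff_add)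
    have "3/2 * ((1/3) ^ n - (1/3) ^ (n + j)) \<le> 3/2 * (1/3 :: real) ^ n"
      by (intro mult_left_mono) auto
    with diff[of n j] show ?thesis unfolding m by (rule order_trans)
  qed
  have pw: "norm (x m z - x n z) \<le> 1 / (1 - r)\<^sup>2 * (3/2 * (1/3) ^ n)" if "n \<le> m" "norm z \<le> r" "r < 1" for m n z r
  proof -
    have "norm (x m z - x n z) \<le> 1 / (1 - r)\<^sup>2 * hardy_norm (\<lambda>z. x m z - x n z)"
      unfolding hardy_norm_def by (rule hardy2_pointwise_bound[OF hardy2_diff[OF x x] that(2,3)])
    also have "\<dots> \<le> 1 / (1 - r)\<^sup>2 * (3/2 * (1/3) ^ n)" by (intro mult_left_mono le that) simp
    finally show ?thesis .
  qed
  have zero: "(\<lambda>n. c * (3/2 * (1/3) ^ n)) \<longlonglongrightarrow> c * (3/2 * 0)" for c :: real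
    by (intro tendsto_intros LIMSEQ_power_zero) simp
  have "Cauchy (\<lambda>n. x n z)" if "norm z < 1" for z
  proof (rule metric_CauchyI)
    fix e :: real assume "e > 0"
    then have "\<forall>\<^sub>F n in sequentially. 1 / (1 - norm z)\<^sup>2 * (3/2 * (1/3) ^ n) < e"
      using order_tendstoD(2)[OF zero[of "1 / (1 - norm z)\<^sup>2"]] by simp
    then obtain N where N: "\<And>n. n \<ge> N \<Longrightarrow> 1 / (1 - norm z)\<^sup>2 * (3/2 * (1/3) ^ n) < e"
      by (auto simp: eventually_sequentially)
    have "dist (x m z) (x n z) < e" if "n \<ge> N" "n \<le> m" for m n
      using pw[OF that(2) order_refl \<open>norm z < 1\<close>] N[OF that(1)] by (simp add: dist_norm)
    then show "\<exists>M. \<forall>m\<ge>M. \<forall>n\<ge>M. dist (x m z) (x n z) < e"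
      by (metis dist_commute linear)
  qed
  then have lim: "(\<lambda>n. x n z) \<longlonglongrightarrow> lim (\<lambda>n. x n z)" if "norm z < 1" for z
    using that Cauchy_convergent_iff convergent_LIMSEQ_iff by blast
  define y where "y z = lim (\<lambda>n. x n z)" for z
  have pwy: "norm (y z - x n z) \<le> 1 / (1 - r)\<^sup>2 * (3/2 * (1/3) ^ n)" if "norm z \<le> r" "r < 1" for n z r
  proof (rule LIMSEQ_le_const2)
    show "(\<lambda>m. norm (x m z - x n z)) \<longlonglongrightarrow> norm (y z - x n z)"
      unfolding y_def using that by (intro tendsto_intros lim) simp
    show "\<exists>N. \<forall>m\<ge>N. norm (x m z - x n z) \<le> 1 / (1 - r)\<^sup>2 * (3/2 * (1/3) ^ n)"
      using pw that by blast
  qed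
  have hol: "y holomorphic_on ball 0 1"
  proof (rule holomorphic_uniform_sequence)
    show "x n holomorphic_on ball 0 1" for n by (rule hardy2_holomorphic[OF x])
    fix z :: complex assume z: "z \<in> ball 0 1"
    define r where "r = (1 + norm z) / 2"
    define e where "e = (1 - norm z) / 2"
    have r: "r < 1" "e > 0" using z by (auto simp: r_def e_def)
    have sub: "norm w \<le> r" if "w \<in> cball z e" for w
      using norm_triangle_ineq2[of w z] that by (simp add: dist_norm norm_minus_commute r_def e_def field_simps)
    have "uniform_limit (cball z e) x y sequentially"
    proof (rule uniform_limitI)
      fix \<epsilon> :: real assume "\<epsilon> > 0"
      then have "\<forall>\<^sub>F n in sequentially. 1 / (1 - r)\<^sup>2 * (3/2 * (1/3) ^ n) < \<epsilon>"
        using order_tendstoD(2)[OF zero[of "1 / (1 - r)\<^sup>2"]] by simp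
      then show "\<forall>\<^sub>F n in sequentially. \<forall>w\<in>cball z e. dist (x n w) (y w) < \<epsilon>"
      proof eventually_elim
        case (elim n)
        show ?case
        proof
          fix w assume "w \<in> cball z e"
          then show "dist (x n w) (y w) < \<epsilon>"
            using pwy[OF sub r(1), of w n] elim by (simp add: dist_norm norm_minus_commute)
        qed
      qed
    qed
    moreover have "cball z e \<subseteq> ball 0 1" using sub r by force
    ultimately show "\<exists>d>0. cball z d \<subseteq> ball 0 1 \<and> uniform_limit (cball z d) x y sequentially"
      using r by blast
  qed simp
  have mean: "l2_norm (\<lambda>w. y (of_real r * w) - x n (of_real r * w)) \<le> 3/2 * (1/3) ^ n"
    if r: "0 \<le> r" "r < 1" for r n
  proof (rule LIMSEQ_le_const)
    show "(\<lambda>m. 1 / (1 - r)\<^sup>2 * (3/2 * (1/3) ^ m) + 3/2 * (1/3) ^ n) \<longlonglongrightarrow> 3/2 * (1/3) ^ n"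
      using tendsto_add[OF zero[of "1 / (1 - r)\<^sup>2"] tendsto_const[of "3/2 * (1/3) ^ n"]] by simp
    have "l2_norm (\<lambda>w. y (of_real r * w) - x n (of_real r * w)) \<le>
        1 / (1 - r)\<^sup>2 * (3/2 * (1/3) ^ m) + 3/2 * (1/3) ^ n" if "n \<le> m" for m
    proof -
      have si: "L2 (\<lambda>w. y (of_real r * w) - x m (of_real r * w))"
        "L2 (\<lambda>w. x m (of_real r * w) - x n (of_real r * w))"
        by (intro L2_diff dilation_L2 r hol hardy2_holomorphic x)+
      have one: "L2 (\<lambda>_. 1)" by (intro L2_continuous continuous_intros)
      have "l2_norm (\<lambda>w. y (of_real r * w) - x n (of_real r * w)) =
          l2_norm (\<lambda>w. (y (of_real r * w) - x m (of_real r * w)) + (x m (of_real r * w) - x n (of_real r * w)))"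
        by simp
      also have "\<dots> \<le> l2_norm (\<lambda>w. y (of_real r * w) - x m (of_real r * w)) +
          l2_norm (\<lambda>w. x m (of_real r * w) - x n (of_real r * w))"
        by (rule l2_norm_triangle[OF si])
      also have "\<dots> \<le> 1 / (1 - r)\<^sup>2 * (3/2 * (1/3) ^ m) * l2_norm (\<lambda>_. 1) + 3/2 * (1/3) ^ n"
      proof (rule add_mono)
        show "l2_norm (\<lambda>w. y (of_real r * w) - x m (of_real r * w)) \<le> 1 / (1 - r)\<^sup>2 * (3/2 * (1/3) ^ m) * l2_norm (\<lambda>_. 1)"
        proof (intro l2_norm_le one L2_measurable si AE_I2)
          fix w assume "w \<in> space circle_measure"
          then have "norm (of_real r * w) \<le> r" using r by (simp add: norm_mult)
          from pwy[OF this r(2), of m]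
          show "norm (y (of_real r * w) - x m (of_real r * w)) \<le> 1 / (1 - r)\<^sup>2 * (3/2 * (1/3) ^ m) * norm (1::complex)"
            by simp
        qed simp
        show "l2_norm (\<lambda>w. x m (of_real r * w) - x n (of_real r * w)) \<le> 3/2 * (1/3) ^ n"
          using dilation_norm_le[OF hardy2_diff[OF x x] r, of m n] le[OF that] by linarith
      qed
      finally show ?thesis by (simp add: l2_norm_def)
    qed
    then show "\<exists>N. \<forall>m\<ge>N. l2_norm (\<lambda>w. y (of_real r * w) - x n (of_real r * w)) \<le>
        1 / (1 - r)\<^sup>2 * (3/2 * (1/3) ^ m) + 3/2 * (1/3) ^ n" by blast
  qed
  have yx: "(\<lambda>z. y z - x n z) \<in> hardy2" for n
    unfolding hardy2_iff_bounded
  proof (intro conjI exI allI impI)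
    show "(\<lambda>z. y z - x n z) holomorphic_on ball 0 1" by (intro holomorphic_intros hol hardy2_holomorphic x)
    show "(\<integral>\<^sub>T w. (norm (y (of_real r * w) - x n (of_real r * w)))\<^sup>2) \<le> (3/2 * (1/3) ^ n)\<^sup>2"
      if "0 \<le> r \<and> r < 1" for r
      unfolding l2_norm_sq[symmetric] using that by (intro power_mono mean) auto
  qed
  have "y \<in> hardy2" using hardy2_add[OF yx[of 0] x[of 0]] by simp
  moreover have "hardy_norm (\<lambda>z. y z - x n z) \<le> 3/2 * (1/3) ^ n" for n
    unfolding hardy_norm_def
    by (rule LIMSEQ_le_const2[OF dilation_norm_tendsto[OF yx]]) (intro exI allI impI mean radius_bounds)
  ultimately show ?thesis using that by blast
qed

text \<open>Sokal's proof of the uniform boundedness principle. If the seminorms were not uniformly bounded, choose indices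
  \<open>k n\<close> with operator norms \<open>Q (k n) > 4\<^sup>n\<close> and almost extremal vectors \<open>h n\<close> of norm at most \<open>3\<^bsup>-n\<^esup>\<close>. Since
  \<open>2 h = (x + h) - (x - h)\<close>, one of \<open>x \<plusminus> h n\<close> has seminorm at least that of \<open>h n\<close>. Adding the vectors with such
  signs gives a limit on which the seminorms grow at least like \<open>(4/3)\<^sup>n\<close>.\<close>

lemma hardy2_uniform_boundedness:
  fixes p :: "nat \<Rightarrow> (complex \<Rightarrow> complex) \<Rightarrow> real"
  assumes K: "K \<subseteq> hardy2" "(\<lambda>_. 0) \<in> K" "\<And>f g. f \<in> K \<Longrightarrow> g \<in> K \<Longrightarrow> (\<lambda>z. f z + g z) \<in> K"
      "\<And>f c. f \<in> K \<Longrightarrow> (\<lambda>z. c * f z) \<in> K"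
    and closed: "\<And>x y. (\<And>n. x n \<in> K) \<Longrightarrow> y \<in> hardy2 \<Longrightarrow>
      (\<lambda>n. hardy_norm (\<lambda>z. y z - x n z)) \<longlonglongrightarrow> 0 \<Longrightarrow> y \<in> K"
    and p: "\<And>k f g. f \<in> K \<Longrightarrow> g \<in> K \<Longrightarrow> p k (\<lambda>z. f z + g z) \<le> p k f + p k g"
      "\<And>k f c. f \<in> K \<Longrightarrow> p k (\<lambda>z. c * f z) = norm c * p k f"
      "\<And>k f. f \<in> K \<Longrightarrow> p k f \<le> A k * hardy_norm f"
    and pointwise: "\<And>f. f \<in> K \<Longrightarrow> \<exists>M. \<forall>k. p k f \<le> M"
  shows "\<exists>C. \<forall>f\<in>K. \<forall>k. p k f \<le> C * hardy_norm f"
proof (rule ccontr)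
  assume no: "\<not> (\<exists>C. \<forall>f\<in>K. \<forall>k. p k f \<le> C * hardy_norm f)"
  have Kdiff: "(\<lambda>z. f z - g z) \<in> K" if "f \<in> K" "g \<in> K" for f g
    using K(3)[OF that(1) K(4)[OF that(2), of "-1"]] by simp
  \<comment> \<open>\<open>Q k\<close> is the operator norm of \<open>p k\<close>.\<close>
  define S where "S k = p k ` {f \<in> K. hardy_norm f \<le> 1}" for k
  define Q where "Q k = Sup (S k)" for k
  have bdd: "bdd_above (S k)" for k
  proof (rule bdd_aboveI[of _ "\<bar>A k\<bar>"])
    fix t assume "t \<in> S k"
    then obtain f where f: "f \<in> K" "hardy_norm f \<le> 1" "t = p k f" by (auto simp: S_def)
    have "p k f \<le> \<bar>A k\<bar> * hardy_norm f"
      using p(3)[OF f(1), of k] mult_right_mono[OF abs_ge_self hardy_norm_nonneg, of "A k" f] by linarith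
    also have "\<dots> \<le> \<bar>A k\<bar> * 1" using f by (intro mult_left_mono) auto
    finally show "t \<le> \<bar>A k\<bar>" using f by simp
  qed
  have zero_in: "p k (\<lambda>_. 0) \<in> S k" "p k (\<lambda>_. 0) = 0" for k
    using p(2)[OF K(2), of k 0] hardy_norm_cmult[of "\<lambda>_. 0" 0] K(1,2) by (auto simp: S_def)
  have pQ: "p k f \<le> Q k * hardy_norm f" if "f \<in> K" for k f
  proof (cases "hardy_norm f = 0")
    case True
    then show ?thesis using p(3)[OF that, of k] by simp
  next
    case False
    then have pos: "hardy_norm f > 0" by (simp add: less_le)
    let ?c = "complex_of_real (1 / hardy_norm f)"
    have "hardy_norm (\<lambda>z. ?c * f z) = 1"
      using hardy_norm_cmult[of f ?c] that K(1) pos by (auto simp: norm_divide)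
    then have "p k (\<lambda>z. ?c * f z) \<in> S k" unfolding S_def by (intro imageI CollectI conjI K(4) that) simp
    then have "p k (\<lambda>z. ?c * f z) \<le> Q k" unfolding Q_def by (intro cSup_upper bdd)
    then have "norm ?c * p k f \<le> Q k" by (simp only: p(2)[OF that])
    then have "1 / hardy_norm f * p k f \<le> Q k" using pos by (simp only: norm_of_real abs_of_pos zero_less_divide_1_iff)
    then show ?thesis using pos by (simp add: field_simps)
  qed
  have "\<exists>k. Q k > 4 ^ n" for n
  proof (rule ccontr)
    assume "\<not> (\<exists>k. Q k > 4 ^ n)"
    then have "Q k * hardy_norm f \<le> 4 ^ n * hardy_norm f" for k f by (intro mult_right_mono) (auto simp: not_less)
    then have "\<forall>f\<in>K. \<forall>k. p k f \<le> 4 ^ n * hardy_norm f" using pQ order_trans by blast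
    then show False using no by blast
  qed
  then obtain k where k: "\<And>n. Q (k n) > 4 ^ n" by metis
  have "\<exists>h. h \<in> K \<and> hardy_norm h \<le> (1/3) ^ n \<and> p (k n) h \<ge> 3/4 * Q (k n) * (1/3) ^ n" for n
  proof -
    have Qpos: "Q (k n) > 0" using k[of n] by (smt (verit) zero_le_power)
    then have "3/4 * Q (k n) < Sup (S (k n))" unfolding Q_def by simp
    then obtain t where t: "t \<in> S (k n)" "3/4 * Q (k n) < t"
      using less_cSup_iff[OF _ bdd, of "k n"] zero_in by blast
    then obtain f where f: "f \<in> K" "hardy_norm f \<le> 1" "3/4 * Q (k n) < p (k n) f" by (auto simp: S_def)
    let ?h = "\<lambda>z. complex_of_real ((1/3) ^ n) * f z"
    have nc: "norm (complex_of_real ((1/3) ^ n)) = (1/3) ^ n" by (simp only: norm_of_real) simp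
    have "hardy_norm ?h \<le> (1/3) ^ n" using hardy_norm_cmult[of f] f K(1) nc by (auto simp: mult_left_le)
    moreover have "p (k n) ?h \<ge> 3/4 * Q (k n) * (1/3) ^ n"
      unfolding p(2)[OF f(1)] nc using f(3) by (subst mult.commute, intro mult_right_mono) auto
    ultimately show ?thesis using K(4)[OF f(1)] by blast
  qed
  then obtain h where h: "\<And>n. h n \<in> K" "\<And>n. hardy_norm (h n) \<le> (1/3) ^ n"
    "\<And>n. p (k n) (h n) \<ge> 3/4 * Q (k n) * (1/3) ^ n" by metis
  \<comment> \<open>The sign of each summand is chosen so that the seminorm does not drop below that of \<open>h n\<close>.\<close>
  define x where "x = rec_nat (\<lambda>_. 0) (\<lambda>n y. if p (k n) (h n) \<le> p (k n) (\<lambda>z. y z + h n z)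
    then (\<lambda>z. y z + h n z) else (\<lambda>z. y z - h n z))"
  have x0: "x 0 = (\<lambda>_. 0)" by (simp add: x_def)
  have xS: "x (Suc n) = (if p (k n) (h n) \<le> p (k n) (\<lambda>z. x n z + h n z)
    then (\<lambda>z. x n z + h n z) else (\<lambda>z. x n z - h n z))" for n by (simp add: x_def)
  have xK: "x n \<in> K" for n by (induction n) (auto simp: x0 xS K(2,3) Kdiff h(1))
  have x_large: "p (k n) (h n) \<le> p (k n) (x (Suc n))" for n
  proof (cases "p (k n) (h n) \<le> p (k n) (\<lambda>z. x n z + h n z)")
    case False
    have K1: "(\<lambda>z. x n z + h n z) \<in> K" "(\<lambda>z. x n z - h n z) \<in> K" using K(3) Kdiff xK h(1) by auto
    have "2 * p (k n) (h n) = p (k n) (\<lambda>z. 2 * h n z)" using p(2)[OF h(1), of "k n" 2] by simp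
    also have "(\<lambda>z. 2 * h n z) = (\<lambda>z. (x n z + h n z) + (-1) * (x n z - h n z))" by (auto simp: algebra_simps)
    also have "p (k n) \<dots> \<le> p (k n) (\<lambda>z. x n z + h n z) + p (k n) (\<lambda>z. (-1) * (x n z - h n z))"
      by (rule p(1)[OF K1(1) K(4)[OF K1(2)]])
    also have "p (k n) (\<lambda>z. (-1) * (x n z - h n z)) = p (k n) (\<lambda>z. x n z - h n z)"
      using p(2)[OF K1(2), of "k n" "-1"] by simp
    finally show ?thesis using False by (simp add: xS)
  qed (simp add: xS)
  have step: "hardy_norm (\<lambda>z. x (Suc n) z - x n z) \<le> (1/3) ^ n" for n
  proof -
    have "hardy_norm (\<lambda>z. (-1) * h n z) = hardy_norm (h n)" using hardy_norm_cmult[of "h n" "-1"] h(1) K(1) by auto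
    then show ?thesis using h(2)[of n] by (auto simp: xS)
  qed
  obtain y where y: "y \<in> hardy2" "\<And>n. hardy_norm (\<lambda>z. y z - x n z) \<le> 3/2 * (1/3) ^ n"
    using hardy2_complete[of x, OF subsetD[OF K(1) xK] step] by blast
  have yK: "y \<in> K"
  proof (rule closed[OF xK y(1)])
    show "(\<lambda>n. hardy_norm (\<lambda>z. y z - x n z)) \<longlonglongrightarrow> 0"
    proof (rule tendsto_sandwich[where f = "\<lambda>_. 0" and h = "\<lambda>n. 3/2 * (1/3) ^ n"])
      have "(\<lambda>n. 3/2 * (1/3) ^ n) \<longlonglongrightarrow> 3/2 * (0::real)" by (intro tendsto_intros LIMSEQ_power_zero) simp
      then show "(\<lambda>n. 3/2 * (1/3) ^ n) \<longlonglongrightarrow> (0::real)" by simp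
    qed (intro always_eventually allI hardy_norm_nonneg y(2) tendsto_const)+
  qed
  obtain M where M: "\<And>j. p j y \<le> M" using pointwise[OF yK] by blast
  \<comment> \<open>The tail of the series after step \<open>n\<close> has norm at most \<open>1/2 (1/3)\<^sup>n\<close>, which leaves \<open>3/4 - 1/2 = 1/4\<close> of the extremal value.\<close>
  have large: "1/4 * (4/3) ^ n \<le> M" for n
  proof -
    have xy: "(\<lambda>z. x (Suc n) z - y z) \<in> K" by (rule Kdiff[OF xK yK])
    have "hardy_norm (\<lambda>z. (-1) * (y z - x (Suc n) z)) = hardy_norm (\<lambda>z. y z - x (Suc n) z)"
      using hardy_norm_cmult[of "\<lambda>z. y z - x (Suc n) z" "-1"] Kdiff[OF yK xK] K(1) by auto
    then have n: "hardy_norm (\<lambda>z. x (Suc n) z - y z) \<le> 1/2 * (1/3) ^ n" using y(2)[of "Suc n"] by simp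
    have "p (k n) (x (Suc n)) = p (k n) (\<lambda>z. y z + (x (Suc n) z - y z))" by simp
    also have "\<dots> \<le> p (k n) y + p (k n) (\<lambda>z. x (Suc n) z - y z)" by (rule p(1)[OF yK xy])
    also have "\<dots> \<le> M + Q (k n) * (1/2 * (1/3) ^ n)"
    proof (rule add_mono[OF M])
      have "Q (k n) \<ge> 0" using k[of n] by (smt (verit) zero_le_power)
      then show "p (k n) (\<lambda>z. x (Suc n) z - y z) \<le> Q (k n) * (1/2 * (1/3) ^ n)"
        using pQ[OF xy, of "k n"] mult_left_mono[OF n, of "Q (k n)"] by linarith
    qed
    finally have "3/4 * Q (k n) * (1/3) ^ n \<le> M + Q (k n) * (1/2 * (1/3) ^ n)"
      using h(3)[of n] x_large[of n] by linarith
    then have "1/4 * (Q (k n) * (1/3) ^ n) \<le> M" by (simp add: algebra_simps)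
    moreover have "4 ^ n * (1/3) ^ n \<le> Q (k n) * (1/3) ^ n" using k[of n] by (intro mult_right_mono) auto
    ultimately have "1/4 * (4 ^ n * (1/3) ^ n) \<le> M" by linarith
    then show ?thesis by (simp add: power_mult_distrib[symmetric])
  qed
  obtain n where "4 * M < (4/3) ^ n" using real_arch_pow[of "4/3" "4 * M"] by auto
  then show False using large[of n] by simp
qed

section \<open>Inner functions and the backward shift\<close>

lemma inner_function_hardy_inf: "inner_function u \<Longrightarrow> u \<in> hardy_inf"
  by (simp add: inner_function_def)

lemma inner_function_unimodular:
  assumes "inner_function u"
  shows "AE w in circle_measure. norm (boundary u w) = 1"
proof -
  have "AE w in circle_measure. \<exists>l. ((\<lambda>r::real. u (of_real r * w)) \<longlongrightarrow> l) (at_left 1) \<and> norm l = 1"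
    using assms by (simp add: inner_function_def)
  then show ?thesis
  proof eventually_elim
    case (elim w)
    then obtain l where l: "((\<lambda>r::real. u (of_real r * w)) \<longlongrightarrow> l) (at_left 1)" "norm l = 1" by blast
    show ?case using radial_limitI(2)[OF l(1)] l(2) by simp
  qed
qed

lemma inner_function_le_1:
  assumes "inner_function u" "z \<in> ball 0 1"
  shows "norm (u z) \<le> 1"
  using inner_function_unimodular[OF assms(1)]
  by (intro boundary_bounded_imp_bounded[OF hardy_inf_imp_hardy2[OF inner_function_hardy_inf[OF assms(1)]] _ assms(2)])
    (auto elim: eventually_mono)

text \<open>By the maximum modulus principle. This is where the assumption that \<open>u\<close> is nonconstant enters: it makes
  \<open>1 - u(0) cnj u\<close> invertible.\<close>

lemma inner_function_strict:
  assumes "inner_function u" "\<not> u constant_on ball 0 1"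
  shows "norm (u 0) < 1"
proof (rule ccontr)
  assume "\<not> norm (u 0) < 1"
  then have "norm (u z) \<le> norm (u 0)" if "z \<in> ball 0 1" for z
    using inner_function_le_1[OF assms(1) that] by simp
  then have "u constant_on ball 0 1"
    using inner_function_hardy_inf[OF assms(1)]
    by (intro maximum_modulus_principle[of u "ball 0 1" "ball 0 1" 0]) (auto simp: hardy_inf_def)
  then show False using assms(2) by simp
qed

lemma unimodular_cancel:
  assumes "norm (a :: complex) = 1" shows "a * cnj a = 1" "a * (cnj a * x) = x" "cnj a * (a * x) = x"
proof -
  show 1: "a * cnj a = 1" using complex_norm_square[of a] assms by simp
  then have 2: "cnj a * a = 1" by (simp add: mult.commute)
  show "a * (cnj a * x) = x" "cnj a * (a * x) = x" by (simp_all only: mult.assoc[symmetric] 1 2 mult_1_left)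
qed

lemma hardy2_mult_hardy_inf: "f \<in> hardy2 \<Longrightarrow> g \<in> hardy_inf \<Longrightarrow> (\<lambda>z. f z * g z) \<in> hardy2"
  using hardy2_bounded_mult by (simp add: mult.commute)

lemma hardy2_shift_pow: "f \<in> hardy2 \<Longrightarrow> (\<lambda>z. z ^ n * f z) \<in> hardy2"
  using hardy2_bounded_mult[OF _ monomial_hardy_inf] .

text \<open>The integral is the value at 0 of the analytic function \<open>z * f z\<close>.\<close>

lemma boundary_mean_zero:
  assumes "f \<in> hardy2"
  shows "(\<integral>\<^sub>T w. w * boundary f w) = 0"
proof -
  have id: "(\<lambda>z. z) \<in> hardy2" using hardy_inf_imp_hardy2[OF monomial_hardy_inf[of 1]] by simp
  have "(\<lambda>z. z * f z) holomorphic_on ball 0 1" by (intro holomorphic_intros hardy2_holomorphic assms)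
  then obtain c where c: "has_taylor c (\<lambda>z. z * f z)" using holomorphic_has_taylor by blast
  then have "(\<lambda>n. c n * 0 ^ n) sums (0 * f 0)" unfolding has_taylor_def by fastforce
  then have "c 0 = 0" by simp
  moreover have "boundary (\<lambda>z. z) w = w" for w using boundary_monomial(2)[of 1 w] by simp
  ultimately show ?thesis using boundary_product_coefficient[OF id assms c, of 0] by simp
qed

lemma AE_circle: "AE w in circle_measure. norm w = 1"
  by (rule AE_I2) simp

lemma model_space_iff:
  assumes \<Theta>: "\<Theta> \<in> hardy_inf"
  shows "f \<in> model_space \<Theta> \<longleftrightarrow> f \<in> hardy2 \<and>
    (\<forall>h\<in>hardy2. (\<integral>\<^sub>T w. boundary f w * cnj (boundary \<Theta> w * boundary h w)) = 0)"
proof -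
  have "l2_inner (boundary f) (boundary (\<lambda>z. \<Theta> z * h z)) =
      (\<integral>\<^sub>T w. boundary f w * cnj (boundary \<Theta> w * boundary h w))"
    if f: "f \<in> hardy2" and h: "h \<in> hardy2" for h
    unfolding l2_inner_def
  proof (rule integral_cong_AE)
    have [measurable]: "boundary f \<in> borel_measurable circle_measure" "boundary h \<in> borel_measurable circle_measure"
      "boundary \<Theta> \<in> borel_measurable circle_measure" "boundary (\<lambda>z. \<Theta> z * h z) \<in> borel_measurable circle_measure"
      by (intro boundary_measurable hardy2_holomorphic hardy2_bounded_mult f h \<Theta> hardy_inf_imp_hardy2)+
    have [measurable]: "cnj \<in> borel_measurable borel"
      by (intro borel_measurable_continuous_onI continuous_intros)
    show "(\<lambda>w. boundary f w * cnj (boundary (\<lambda>z. \<Theta> z * h z) w)) \<in> borel_measurable circle_measure"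
      "(\<lambda>w. boundary f w * cnj (boundary \<Theta> w * boundary h w)) \<in> borel_measurable circle_measure"
      by measurable
    show "AE w in circle_measure. boundary f w * cnj (boundary (\<lambda>z. \<Theta> z * h z) w) =
        boundary f w * cnj (boundary \<Theta> w * boundary h w)"
      using fatou_radial_limits[OF h] fatou_radial_limits[OF hardy_inf_imp_hardy2[OF \<Theta>]]
      by eventually_elim (simp add: boundary_mult)
  qed
  then show ?thesis unfolding model_space_def by auto
qed

lemma backward_shift_hardy_inf:
  assumes "f \<in> hardy_inf"
  shows "backward_shift f \<in> hardy_inf"
proof -
  have f: "f holomorphic_on ball 0 1" using assms by (simp add: hardy_inf_def)
  obtain B where B: "\<And>z. z \<in> ball 0 1 \<Longrightarrow> norm (f z) \<le> B"
    using assms unfolding hardy_inf_def bounded_iff by blast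
  have "backward_shift f = (\<lambda>z. if z = 0 then deriv f 0 else (f z - f 0) / (z - 0))"
    by (auto simp: backward_shift_def)
  then have hol: "backward_shift f holomorphic_on ball 0 1"
    using pole_lemma[OF f, of 0] by simp
  then have "bounded (backward_shift f ` cball 0 (1/2))"
    by (intro compact_imp_bounded compact_continuous_image holomorphic_on_imp_continuous_on
        holomorphic_on_subset[OF hol]) auto
  then obtain C where C: "\<And>z. z \<in> cball 0 (1/2) \<Longrightarrow> norm (backward_shift f z) \<le> C"
    unfolding bounded_iff by (metis imageI)
  have B0: "0 \<le> B" using order_trans[OF norm_ge_zero B[of 0]] by simp
  have "norm (backward_shift f z) \<le> max C (4 * B)" if z: "z \<in> ball 0 1" for z
  proof (cases "norm z \<le> 1/2")
    case True
    then show ?thesis using C[of z] by simp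
  next
    case False
    have "norm (f z - f 0) \<le> 2 * B" using norm_triangle_ineq4[of "f z" "f 0"] B[OF z] B[of 0] by simp
    then have "norm (f z - f 0) / norm z \<le> (2 * B) / (1/2)"
      using False B0 by (intro frac_le) auto
    moreover have "backward_shift f z = (f z - f 0) / z" using False by (auto simp: backward_shift_def)
    ultimately show ?thesis by (simp add: norm_divide)
  qed
  then show ?thesis using hol unfolding hardy_inf_def bounded_iff by blast
qed

lemma boundary_backward_shift:
  assumes u: "has_radial_limit u w" and w: "norm w = 1"
  shows "has_radial_limit (backward_shift u) w" "boundary (backward_shift u) w = cnj w * (boundary u w - u 0)"
proof -
  have nz: "w \<noteq> 0" using w by auto
  have inv: "cnj w = inverse w" using unimodular_cancel(1)[OF w] nz by (simp add: field_simps)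
  have "((\<lambda>r. (u (of_real r * w) - u 0) / (of_real r * w)) \<longlongrightarrow> (boundary u w - u 0) / w) (at_left 1)"
    by (intro tendsto_divide tendsto_diff tendsto_const radial_limit_id nz u[unfolded has_radial_limit_def])
  moreover have "\<forall>\<^sub>F r in at_left (1::real). r \<in> {0<..<1}" by (rule eventually_at_left_real) simp
  then have "\<forall>\<^sub>F r in at_left (1::real). (u (of_real r * w) - u 0) / (of_real r * w) = backward_shift u (of_real r * w)"
    by eventually_elim (use nz in \<open>simp add: backward_shift_def\<close>)
  ultimately have "((\<lambda>r. backward_shift u (of_real r * w)) \<longlongrightarrow> (boundary u w - u 0) / w) (at_left 1)"
    by (rule Lim_transform_eventually)
  from radial_limitI[OF this]
  show "has_radial_limit (backward_shift u) w" "boundary (backward_shift u) w = cnj w * (boundary u w - u 0)"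
    by (simp_all add: inv field_simps)
qed

lemma boundary_hardy_inf_bounded:
  assumes "g \<in> hardy_inf"
  obtains B where "0 \<le> B" "AE w in circle_measure. norm (boundary g w) \<le> B"
proof -
  obtain B where B: "\<And>z. z \<in> ball 0 1 \<Longrightarrow> norm (g z) \<le> B"
    using assms unfolding hardy_inf_def bounded_iff by blast
  have "AE w in circle_measure. norm (boundary g w) \<le> B"
    using fatou_radial_limits[OF hardy_inf_imp_hardy2[OF assms]] AE_circle
  proof eventually_elim
    case (elim w)
    have le: "norm (g (of_real (radius k) * w)) \<le> B" for k
      by (intro B dilation_mem_ball radius_bounds) (use elim in simp)
    show ?case
      by (rule LIMSEQ_le_const2[OF tendsto_norm[OF has_radial_limit_LIMSEQ[OF elim(1)]]])
        (intro exI allI impI le)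
  qed
  moreover have "0 \<le> B" using order_trans[OF norm_ge_zero B[of 0]] by simp
  ultimately show ?thesis using that by blast
qed

lemma boundary_hardy_inf_measurable: "g \<in> hardy_inf \<Longrightarrow> boundary g \<in> borel_measurable circle_measure"
  by (intro boundary_measurable) (simp add: hardy_inf_def)

lemma L2_mult_hardy_inf:
  assumes "L2 F" "g \<in> hardy_inf"
  shows "L2 (\<lambda>w. boundary g w * F w)" "L2 (\<lambda>w. cnj (boundary g w) * F w)"
proof -
  obtain B where B: "AE w in circle_measure. norm (boundary g w) \<le> B"
    using boundary_hardy_inf_bounded[OF assms(2)] .
  note m[measurable] = boundary_hardy_inf_measurable[OF assms(2)]
  have [measurable]: "cnj \<in> borel_measurable borel"
    by (intro borel_measurable_continuous_onI continuous_intros)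
  show "L2 (\<lambda>w. boundary g w * F w)"
    by (rule L2_bounded_mult[OF assms(1) m B])
  have "(\<lambda>w. cnj (boundary g w)) \<in> borel_measurable circle_measure" by measurable
  then show "L2 (\<lambda>w. cnj (boundary g w) * F w)"
    using B by (intro L2_bounded_mult[OF assms(1), where B = B]) simp_all
qed

lemma L2_mult_monomial:
  assumes "L2 F"
  shows "L2 (\<lambda>w. w ^ n * F w)" "L2 (\<lambda>w. cnj w ^ n * F w)"
proof -
  show "L2 (\<lambda>w. w ^ n * F w)"
  proof (rule L2_bounded_mult[OF assms, where B = 1])
    show "(\<lambda>w. w ^ n) \<in> borel_measurable circle_measure"
      by (intro circle_measurable_continuous continuous_intros)
  qed (auto simp: norm_power)
  show "L2 (\<lambda>w. cnj w ^ n * F w)"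
  proof (rule L2_bounded_mult[OF assms, where B = 1])
    show "(\<lambda>w. cnj w ^ n) \<in> borel_measurable circle_measure"
      by (intro circle_measurable_continuous continuous_intros)
  qed (auto simp: norm_power)
qed

lemma boundary_mult_AE:
  assumes "f \<in> hardy2" "g \<in> hardy2"
  shows "AE w in circle_measure. boundary (\<lambda>z. f z * g z) w = boundary f w * boundary g w"
  using assms[THEN fatou_radial_limits] by eventually_elim (rule boundary_mult)

lemma circle_integral_eqI:
  fixes F G :: "complex \<Rightarrow> complex"
  assumes "AE w in circle_measure. F w = G w" "integrable circle_measure F" "integrable circle_measure G"
  shows "(\<integral>\<^sub>T w. F w) = (\<integral>\<^sub>T w. G w)"
  using assms by (intro integral_cong_AE borel_measurable_integrable)

section \<open>Conjugation on a model space\<close>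

lemma l2_norm_eq_0_AE:
  assumes "L2 F" "l2_norm F = 0"
  shows "AE w in circle_measure. F w = 0"
proof -
  have "(\<integral>\<^sub>T w. (norm (F w))\<^sup>2) = 0" using assms(2) by (simp flip: l2_norm_sq)
  then have "AE w in circle_measure. (norm (F w))\<^sup>2 = 0"
    using assms(1) by (subst (asm) integral_nonneg_eq_0_iff_AE) (auto simp: L2_def)
  then show ?thesis by simp
qed

text \<open>The conjugation \<open>f \<mapsto> u cnj(z f)\<close> maps the model space into the Hardy space. The function
  \<open>G = u cnj(z f)\<close> has no Fourier coefficients of negative index because \<open>f\<close> is orthogonal to \<open>u z\<^sup>k\<close>, so
  \<open>D = G - P\<^sub>+ G\<close> has no Fourier coefficients at all. Then \<open>D\<close> is orthogonal to every shift of the boundary function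
  of \<open>u\<close>, and therefore to \<open>G\<close>, whose factor \<open>cnj f\<close> is a limit of antianalytic polynomials. So \<open>D\<close> is orthogonal
  to itself.\<close>

lemma model_space_conjugation:
  assumes u: "inner_function u" and f: "f \<in> model_space u"
  obtains g where "g \<in> hardy2" "AE w in circle_measure. boundary g w = boundary u w * cnj (w * boundary f w)"
proof -
  have ui: "u \<in> hardy_inf" by (rule inner_function_hardy_inf[OF u])
  note u2 = hardy_inf_imp_hardy2[OF ui]
  have f2: "f \<in> hardy2" and perp: "\<And>h. h \<in> hardy2 \<Longrightarrow>
    (\<integral>\<^sub>T w. boundary f w * cnj (boundary u w * boundary h w)) = 0"
    using f by (auto simp: model_space_iff[OF ui])
  note bf = boundary_L2[OF f2]
  define G where "G w = boundary u w * cnj (w * boundary f w)" for w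
  have G: "L2 G"
    unfolding G_def[abs_def]
    using L2_mult_monomial(1)[OF bf, of 1]
    by (intro L2_mult_hardy_inf(1)[OF _ ui] L2_cnj) simp
  define g where "g = riesz_projection G"
  have g2: "g \<in> hardy2" unfolding g_def by (rule riesz_projection(1)[OF G])
  note bg = boundary_L2[OF g2]
  define D where "D w = G w - boundary g w" for w
  have D: "L2 D" unfolding D_def[abs_def] by (intro L2_diff G bg)
  have D_perp: "(\<integral>\<^sub>T w. D w * cnj (boundary h w)) = 0" if "h \<in> hardy2" for h
    unfolding D_def g_def by (rule riesz_projection(2)[OF G that])
  have mono2: "(\<lambda>z. z ^ k) \<in> hardy2" for k by (intro hardy_inf_imp_hardy2 monomial_hardy_inf)
  have D_neg: "(\<integral>\<^sub>T w. D w * cnj (w ^ k)) = 0" for k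
    using D_perp[OF mono2[of k]] by (simp only: boundary_monomial)
  \<comment> \<open>Frequencies below zero: those of \<open>G\<close> vanish since \<open>f\<close> is orthogonal to \<open>u z\<^sup>k\<close>, those of \<open>g\<close> by the mean value property.\<close>
  have D_pos: "(\<integral>\<^sub>T w. D w * w ^ Suc k) = 0" for k
  proof -
    have "(\<integral>\<^sub>T w. G w * w ^ Suc k) =
        (\<integral>\<^sub>T w. cnj (boundary f w * cnj (boundary u w * boundary (\<lambda>z. z ^ k) w)))"
      unfolding boundary_monomial
    proof (intro Bochner_Integration.integral_cong refl)
      fix w assume "w \<in> space circle_measure"
      then have "norm w = 1" by simp
      from unimodular_cancel(1)[OF this]
      show "G w * w ^ Suc k = cnj (boundary f w * cnj (boundary u w * w ^ k))"
        unfolding G_def by (simp add: mult_ac)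
    qed
    also have "\<dots> = cnj (\<integral>\<^sub>T w. boundary f w * cnj (boundary u w * boundary (\<lambda>z. z ^ k) w))"
      by (rule Bochner_Integration.integral_cnj)
    finally have 1: "(\<integral>\<^sub>T w. G w * w ^ Suc k) = 0" using perp[OF mono2[of k]] by simp
    have kg: "(\<lambda>z. z ^ k * g z) \<in> hardy2" by (rule hardy2_shift_pow[OF g2])
    have "(\<integral>\<^sub>T w. boundary g w * w ^ Suc k) = (\<integral>\<^sub>T w. w * boundary (\<lambda>z. z ^ k * g z) w)"
    proof (rule circle_integral_eqI)
      show "AE w in circle_measure. boundary g w * w ^ Suc k = w * boundary (\<lambda>z. z ^ k * g z) w"
        using boundary_mult_AE[OF mono2[of k] g2]
        by eventually_elim (simp only: boundary_monomial power_Suc mult_ac)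
      show "integrable circle_measure (\<lambda>w. boundary g w * w ^ Suc k)"
        by (intro L2_mult bg L2_monomial)
      show "integrable circle_measure (\<lambda>w. w * boundary (\<lambda>z. z ^ k * g z) w)"
        using L2_mult[OF L2_monomial[of 1] boundary_L2[OF kg]] by simp
    qed
    also have "\<dots> = 0" by (rule boundary_mean_zero[OF kg])
    finally have 2: "(\<integral>\<^sub>T w. boundary g w * w ^ Suc k) = 0" .
    have "(\<integral>\<^sub>T w. D w * w ^ Suc k) =
        (\<integral>\<^sub>T w. G w * w ^ Suc k) - (\<integral>\<^sub>T w. boundary g w * w ^ Suc k)"
      unfolding D_def left_diff_distrib
      by (intro Bochner_Integration.integral_diff L2_mult G bg L2_monomial)
    then show ?thesis using 1 2 by simp
  qed
  \<comment> \<open>Every shift \<open>w\<^sup>k D\<close> is orthogonal to the monomials as well, hence to \<open>u\<close>.\<close>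
  have D_u: "(\<integral>\<^sub>T w. w ^ k * D w * cnj (boundary u w)) = 0" for k
  proof (rule orthogonal_to_monomials_imp_hardy2[OF L2_mult_monomial(1)[OF D] _ u2])
    fix n
    show "(\<integral>\<^sub>T w. w ^ k * D w * cnj (w ^ n)) = 0"
    proof (cases "k \<le> n")
      case True
      have "(\<integral>\<^sub>T w. w ^ k * D w * cnj (w ^ n)) = (\<integral>\<^sub>T w. D w * cnj (w ^ (n - k)))"
      proof (intro Bochner_Integration.integral_cong refl)
        fix w assume "w \<in> space circle_measure"
        then have "cnj (w ^ n * cnj w ^ k) = cnj (w ^ (n - k))" using True by (subst circle_power_cnj) auto
        then show "w ^ k * D w * cnj (w ^ n) = D w * cnj (w ^ (n - k))" by (simp add: mult_ac)
      qed
      then show ?thesis using D_neg by simp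
    next
      case False
      then obtain j where j: "k - n = Suc j" by (metis Suc_diff_Suc not_le)
      have "(\<integral>\<^sub>T w. w ^ k * D w * cnj (w ^ n)) = (\<integral>\<^sub>T w. D w * w ^ Suc j)"
      proof (intro Bochner_Integration.integral_cong refl)
        fix w assume "w \<in> space circle_measure"
        then have "w ^ k * cnj w ^ n = w ^ Suc j" using False j by (subst circle_power_cnj) auto
        then show "w ^ k * D w * cnj (w ^ n) = D w * w ^ Suc j" by (simp add: mult_ac)
      qed
      then show ?thesis using D_pos by simp
    qed
  qed
  \<comment> \<open>The pairing of \<open>H\<close> with \<open>f\<close> is the conjugate of that of \<open>D\<close> with \<open>G\<close>, and the Fourier coefficients of \<open>H\<close> are known from \<open>D_u\<close>.\<close>
  define H where "H w = cnj (w * D w * cnj (boundary u w))" for w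
  have H: "L2 H"
    unfolding H_def[abs_def]
    using L2_mult_hardy_inf(2)[OF L2_mult_monomial(1)[OF D, of 1] ui]
    by (intro L2_cnj) (simp add: mult_ac)
  have "(\<integral>\<^sub>T w. H w * cnj (boundary f w)) = 0"
  proof (rule orthogonal_to_monomials_imp_hardy2[OF H _ f2])
    fix n
    have "(\<integral>\<^sub>T w. H w * cnj (w ^ n)) =
        (\<integral>\<^sub>T w. cnj (w ^ Suc n * D w * cnj (boundary u w)))"
      unfolding H_def by (intro Bochner_Integration.integral_cong refl) (simp add: mult_ac)
    also have "\<dots> = cnj (\<integral>\<^sub>T w. w ^ Suc n * D w * cnj (boundary u w))"
      by (rule Bochner_Integration.integral_cnj)
    finally show "(\<integral>\<^sub>T w. H w * cnj (w ^ n)) = 0" by (simp only: D_u) simp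
  qed
  moreover have "(\<integral>\<^sub>T w. H w * cnj (boundary f w)) = (\<integral>\<^sub>T w. cnj (D w * cnj (G w)))"
    unfolding H_def G_def by (intro Bochner_Integration.integral_cong refl) (simp add: mult_ac)
  moreover have "(\<integral>\<^sub>T w. cnj (D w * cnj (G w))) = cnj (\<integral>\<^sub>T w. D w * cnj (G w))"
    by (rule Bochner_Integration.integral_cnj)
  ultimately have DG: "(\<integral>\<^sub>T w. D w * cnj (G w)) = 0" by simp
  have "complex_of_real ((l2_norm D)\<^sup>2) = (\<integral>\<^sub>T w. D w * cnj (D w))"
    by (simp only: l2_norm_sq mult.commute[of _ "cnj _"] cnj_mult_self integral_complex_of_real)
  also have "\<dots> = (\<integral>\<^sub>T w. D w * cnj (G w) - D w * cnj (boundary g w))"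
    by (intro Bochner_Integration.integral_cong refl) (simp add: D_def algebra_simps)
  also have "\<dots> = (\<integral>\<^sub>T w. D w * cnj (G w)) - (\<integral>\<^sub>T w. D w * cnj (boundary g w))"
    by (intro Bochner_Integration.integral_diff L2_mult D L2_cnj G bg)
  also have "\<dots> = 0" using DG D_perp[OF g2] by simp
  finally have "l2_norm D = 0" by simp
  then have "AE w in circle_measure. D w = 0" by (rule l2_norm_eq_0_AE[OF D])
  then have "AE w in circle_measure. boundary g w = boundary u w * cnj (w * boundary f w)"
    by eventually_elim (simp add: D_def G_def)
  then show ?thesis using that g2 by blast
qed

section \<open>The kernel condition and the backward shift\<close>

definition orthogonal_hardy2 :: "(complex \<Rightarrow> complex) \<Rightarrow> bool" where
  "orthogonal_hardy2 F \<longleftrightarrow> (\<forall>h\<in>hardy2. (\<integral>\<^sub>T w. F w * cnj (boundary h w)) = 0)"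

text \<open>The function on the circle whose orthogonal projection to the Hardy space is the Toeplitz operator with
  symbol \<open>cnj(z v) u\<close>, applied to \<open>\<phi>\<close>.\<close>

definition twist :: "(complex \<Rightarrow> complex) \<Rightarrow> (complex \<Rightarrow> complex) \<Rightarrow> (complex \<Rightarrow> complex) \<Rightarrow> complex \<Rightarrow> complex" where
  "twist u v \<phi> w = cnj (w * boundary v w) * boundary u w * boundary \<phi> w"

lemma twist_L2:
  assumes "u \<in> hardy_inf" "v \<in> hardy_inf" "\<phi> \<in> hardy2"
  shows "L2 (twist u v \<phi>)"
proof -
  have "L2 (\<lambda>w. cnj w ^ 1 * (cnj (boundary v w) * (boundary u w * boundary \<phi> w)))"
    by (intro L2_mult_monomial L2_mult_hardy_inf boundary_L2 assms)
  then show ?thesis by (simp add: twist_def[abs_def] mult_ac)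
qed

lemma toeplitz_kernel_iff:
  assumes "u \<in> hardy_inf" "v \<in> hardy_inf" "\<phi> \<in> hardy2"
  shows "\<phi> \<in> toeplitz_kernel (\<lambda>w. cnj (w * boundary v w) * boundary u w) \<longleftrightarrow>
    orthogonal_hardy2 (twist u v \<phi>)"
  using riesz_projection_eq_0_iff[OF twist_L2[OF assms]] assms(3)
  by (simp add: toeplitz_kernel_def toeplitz_def orthogonal_hardy2_def twist_def[abs_def])

text \<open>On the circle \<open>S* u = cnj z (u - u(0))\<close> and \<open>|u| = 1\<close>, whence
  \<open>\<phi> S* u cnj v = F (1 - u(0) cnj u)\<close> for \<open>F = twist u v \<phi>\<close>. Pairing with \<open>h\<close> is the same as pairing \<open>F\<close> with
  \<open>h\<close> and with \<open>u h\<close>.\<close>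

lemma orthogonal_imp_shift_in_model_space:
  assumes u: "inner_function u" and v: "inner_function v" and \<phi>: "\<phi> \<in> hardy2"
    and F: "orthogonal_hardy2 (twist u v \<phi>)"
  shows "(\<lambda>z. \<phi> z * backward_shift u z) \<in> model_space v"
proof -
  let ?P = "\<lambda>z. \<phi> z * backward_shift u z"
  have ui: "u \<in> hardy_inf" and vi: "v \<in> hardy_inf" using u v by (auto intro: inner_function_hardy_inf)
  note u2 = hardy_inf_imp_hardy2[OF ui]
  note Si = backward_shift_hardy_inf[OF ui]
  note S2 = hardy_inf_imp_hardy2[OF Si]
  have P2: "?P \<in> hardy2" by (rule hardy2_mult_hardy_inf[OF \<phi> Si])
  note tw = twist_L2[OF ui vi \<phi>]
  have "(\<integral>\<^sub>T w. boundary ?P w * cnj (boundary v w * boundary h w)) = 0"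
    if h: "h \<in> hardy2" for h
  proof -
    have uh: "(\<lambda>z. u z * h z) \<in> hardy2" by (rule hardy2_bounded_mult[OF h ui])
    have i: "integrable circle_measure (\<lambda>w. twist u v \<phi> w * cnj (boundary h w))"
      "integrable circle_measure (\<lambda>w. u 0 * (twist u v \<phi> w * cnj (boundary (\<lambda>z. u z * h z) w)))"
      by (intro integrable_mult_right L2_mult tw L2_cnj boundary_L2 h uh)+
    have "(\<integral>\<^sub>T w. boundary ?P w * cnj (boundary v w * boundary h w)) =
      (\<integral>\<^sub>T w. twist u v \<phi> w * cnj (boundary h w) - u 0 * (twist u v \<phi> w * cnj (boundary (\<lambda>z. u z * h z) w)))"
    proof (rule circle_integral_eqI)
      show "AE w in circle_measure. boundary ?P w * cnj (boundary v w * boundary h w) =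
        twist u v \<phi> w * cnj (boundary h w) - u 0 * (twist u v \<phi> w * cnj (boundary (\<lambda>z. u z * h z) w))"
        using boundary_mult_AE[OF \<phi> S2] boundary_mult_AE[OF u2 h] fatou_radial_limits[OF u2]
          inner_function_unimodular[OF u] AE_circle
      proof eventually_elim
        case (elim w)
        show ?case
          unfolding boundary_backward_shift(2)[OF elim(3,5)] elim(1,2) twist_def
          using unimodular_cancel[OF elim(4)] by (simp add: algebra_simps)
      qed
      show "integrable circle_measure (\<lambda>w. boundary ?P w * cnj (boundary v w * boundary h w))"
        by (intro L2_mult L2_cnj L2_mult_hardy_inf boundary_L2 P2 h vi)
    qed (intro Bochner_Integration.integrable_diff i)
    also have "\<dots> = (\<integral>\<^sub>T w. twist u v \<phi> w * cnj (boundary h w)) -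
        u 0 * (\<integral>\<^sub>T w. twist u v \<phi> w * cnj (boundary (\<lambda>z. u z * h z) w))"
      by (subst Bochner_Integration.integral_diff[OF i]) (simp only: integral_mult_right_zero)
    also have "\<dots> = 0" using F h uh by (simp add: orthogonal_hardy2_def)
    finally show ?thesis .
  qed
  then show ?thesis using P2 by (simp add: model_space_iff[OF vi])
qed

text \<open>The previous lemma with \<open>v = u\<close> and \<open>\<phi> = 1\<close>, for which the twist is \<open>cnj z\<close>.\<close>

lemma backward_shift_in_model_space:
  assumes u: "inner_function u"
  shows "backward_shift u \<in> model_space u"
proof -
  have ui: "u \<in> hardy_inf" by (rule inner_function_hardy_inf[OF u])
  have "(\<integral>\<^sub>T w. twist u u (\<lambda>_. 1) w * cnj (boundary h w)) = 0" if h: "h \<in> hardy2" for h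
  proof -
    have "(\<integral>\<^sub>T w. twist u u (\<lambda>_. 1) w * cnj (boundary h w)) = (\<integral>\<^sub>T w. cnj (w * boundary h w))"
    proof (rule circle_integral_eqI)
      show "AE w in circle_measure. twist u u (\<lambda>_. 1) w * cnj (boundary h w) = cnj (w * boundary h w)"
        using inner_function_unimodular[OF u]
        by eventually_elim (simp add: twist_def boundary_const unimodular_cancel mult_ac)
      show "integrable circle_measure (\<lambda>w. twist u u (\<lambda>_. 1) w * cnj (boundary h w))"
        by (intro L2_mult twist_L2 L2_cnj boundary_L2 ui const_hardy2 h)
      show "integrable circle_measure (\<lambda>w. cnj (w * boundary h w))"
        by (intro integrable_cnj L2_mult boundary_L2 h L2_continuous continuous_intros)
    qed
    also have "\<dots> = cnj (\<integral>\<^sub>T w. w * boundary h w)" by (rule Bochner_Integration.integral_cnj)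
    finally show ?thesis by (simp add: boundary_mean_zero[OF h])
  qed
  then show ?thesis
    using orthogonal_imp_shift_in_model_space[OF u u const_hardy2[of 1]] by (simp add: orthogonal_hardy2_def)
qed

text \<open>The factor \<open>1 - u(0) cnj u\<close> of \<open>\<phi> S* u cnj v = F (1 - u(0) cnj u)\<close> can be divided out: its inverse is the
  conjugate of the bounded analytic function \<open>k\<close>, so instead of with \<open>h\<close> one pairs with \<open>k h\<close>.\<close>

lemma shift_in_model_space_imp_orthogonal:
  assumes u: "inner_function u" "\<not> u constant_on ball 0 1" and v: "inner_function v" and \<phi>: "\<phi> \<in> hardy2"
    and P: "(\<lambda>z. \<phi> z * backward_shift u z) \<in> model_space v"
  shows "orthogonal_hardy2 (twist u v \<phi>)"
  unfolding orthogonal_hardy2_def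
proof
  let ?P = "\<lambda>z. \<phi> z * backward_shift u z"
  fix h assume h: "h \<in> hardy2"
  have ui: "u \<in> hardy_inf" and vi: "v \<in> hardy_inf" using u v by (auto intro: inner_function_hardy_inf)
  note u2 = hardy_inf_imp_hardy2[OF ui]
  note S2 = hardy_inf_imp_hardy2[OF backward_shift_hardy_inf[OF ui]]
  define c where "c = cnj (u 0)"
  have c: "norm c < 1" using inner_function_strict[OF u] by (simp add: c_def)
  have lower: "1 - norm c \<le> norm (1 - c * w)" if "norm w \<le> 1" for w
  proof -
    have "norm (c * w) \<le> norm c * 1" unfolding norm_mult using that by (intro mult_left_mono) auto
    then show ?thesis using norm_triangle_ineq2[of 1 "c * w"] by simp
  qed
  then have nz: "1 - c * w \<noteq> 0" if "norm w \<le> 1" for w using c that by fastforce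
  \<comment> \<open>On the circle \<open>cnj k\<close> is the inverse of \<open>1 - u(0) cnj u\<close>.\<close>
  define k where "k z = 1 / (1 - c * u z)" for z
  have ki: "k \<in> hardy_inf"
    unfolding hardy_inf_def bounded_iff
  proof (intro CollectI conjI exI ballI)
    show "k holomorphic_on ball 0 1"
      unfolding k_def using ui nz inner_function_le_1[OF u(1)]
      by (intro holomorphic_intros) (auto simp: hardy_inf_def)
    fix y assume "y \<in> k ` ball 0 1"
    then obtain z where z: "z \<in> ball 0 1" "y = k z" by blast
    then show "norm y \<le> 1 / (1 - norm c)"
      unfolding z(2) k_def norm_divide norm_one using lower[OF inner_function_le_1[OF u(1) z(1)]] c
      by (intro frac_le) auto
  qed
  have kh: "(\<lambda>z. k z * h z) \<in> hardy2" by (rule hardy2_bounded_mult[OF h ki])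
  have perp: "(\<integral>\<^sub>T w. boundary ?P w * cnj (boundary v w * boundary (\<lambda>z. k z * h z) w)) = 0"
    using P kh by (simp add: model_space_iff[OF vi])
  have P2: "?P \<in> hardy2" using P by (simp add: model_space_iff[OF vi])
  have "(\<integral>\<^sub>T w. twist u v \<phi> w * cnj (boundary h w)) =
    (\<integral>\<^sub>T w. boundary ?P w * cnj (boundary v w * boundary (\<lambda>z. k z * h z) w))"
  proof (rule circle_integral_eqI)
    show "AE w in circle_measure. twist u v \<phi> w * cnj (boundary h w) =
        boundary ?P w * cnj (boundary v w * boundary (\<lambda>z. k z * h z) w)"
      using boundary_mult_AE[OF \<phi> S2] boundary_mult_AE[OF hardy_inf_imp_hardy2[OF ki] h]
        fatou_radial_limits[OF u2] inner_function_unimodular[OF u(1)] AE_circle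
    proof eventually_elim
      case (elim w)
      have nz': "1 - c * boundary u w \<noteq> 0" using nz elim by simp
      have "((\<lambda>r. 1 / (1 - c * u (of_real r * w))) \<longlongrightarrow> 1 / (1 - c * boundary u w)) (at_left 1)"
        using elim(3)[unfolded has_radial_limit_def] nz' by (intro tendsto_intros)
      then have bk: "boundary k w = 1 / (1 - c * boundary u w)"
        unfolding k_def by (rule radial_limitI(2))
      have "cnj (1 - c * boundary u w) \<noteq> 0" using nz' complex_cnj_zero_iff by blast
      then have nz'': "1 - u 0 * cnj (boundary u w) \<noteq> 0" by (simp add: c_def)
      have "boundary u w - u 0 = boundary u w * (1 - u 0 * cnj (boundary u w))"
        using unimodular_cancel[OF elim(4)] by (simp add: algebra_simps)
      then show ?case
        unfolding boundary_backward_shift(2)[OF elim(3,5)] elim(1,2) bk twist_def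
        using nz'' by (simp add: c_def)
    qed
    show "integrable circle_measure (\<lambda>w. twist u v \<phi> w * cnj (boundary h w))"
      by (intro L2_mult twist_L2 L2_cnj boundary_L2 ui vi \<phi> h)
    show "integrable circle_measure (\<lambda>w. boundary ?P w * cnj (boundary v w * boundary (\<lambda>z. k z * h z) w))"
      by (intro L2_mult L2_cnj L2_mult_hardy_inf boundary_L2 P2 kh vi)
  qed
  then show "(\<integral>\<^sub>T w. twist u v \<phi> w * cnj (boundary h w)) = 0" using perp by simp
qed

text \<open>Write \<open>f = u cnj(z g)\<close> on the circle, with \<open>g\<close> in the Hardy space. Then \<open>\<phi> f cnj v = F cnj g\<close> for
  \<open>F = twist u v \<phi>\<close>, and the pairing of this with a monomial \<open>z\<^sup>n\<close> is the pairing of \<open>F\<close> with \<open>z\<^sup>n g\<close>.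
  Monomials suffice, because \<open>\<phi> f cnj v\<close> is square integrable.\<close>

lemma orthogonal_imp_product_in_model_space:
  assumes u: "inner_function u" and v: "inner_function v" and \<phi>: "\<phi> \<in> hardy2"
    and F: "orthogonal_hardy2 (twist u v \<phi>)"
    and f: "f \<in> model_space u" and si: "L2 (\<lambda>w. boundary \<phi> w * boundary f w)"
  shows "(\<lambda>z. \<phi> z * f z) \<in> model_space v"
proof -
  have ui: "u \<in> hardy_inf" and vi: "v \<in> hardy_inf" using u v by (auto intro: inner_function_hardy_inf)
  have f2: "f \<in> hardy2" using f by (simp add: model_space_iff[OF ui])
  have P2: "(\<lambda>z. \<phi> z * f z) \<in> hardy2" by (rule product_in_hardy2[OF \<phi> f2 si])
  obtain g where g: "g \<in> hardy2" "AE w in circle_measure. boundary g w = boundary u w * cnj (w * boundary f w)"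
    using model_space_conjugation[OF u f] .
  define X where "X w = boundary (\<lambda>z. \<phi> z * f z) w * cnj (boundary v w)" for w
  have X: "L2 X"
    using L2_mult_hardy_inf(2)[OF boundary_L2[OF P2] vi]
    by (simp add: X_def[abs_def] mult.commute)
  have mono: "(\<integral>\<^sub>T w. X w * cnj (w ^ n)) = 0" for n
  proof -
    have ng: "(\<lambda>z. z ^ n * g z) \<in> hardy2" by (rule hardy2_shift_pow[OF g(1)])
    have "(\<integral>\<^sub>T w. X w * cnj (w ^ n)) =
        (\<integral>\<^sub>T w. twist u v \<phi> w * cnj (boundary (\<lambda>z. z ^ n * g z) w))"
    proof (rule circle_integral_eqI)
      show "AE w in circle_measure. X w * cnj (w ^ n) = twist u v \<phi> w * cnj (boundary (\<lambda>z. z ^ n * g z) w)"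
        using boundary_mult_AE[OF \<phi> f2] boundary_mult_AE[OF hardy_inf_imp_hardy2[OF monomial_hardy_inf[of n]] g(1)] g(2)
          inner_function_unimodular[OF u] AE_circle
      proof eventually_elim
        case (elim w)
        have "twist u v \<phi> w * cnj (boundary (\<lambda>z. z ^ n * g z) w) =
            (w * cnj w) * (boundary u w * cnj (boundary u w)) *
            (cnj (boundary v w) * boundary \<phi> w * cnj (w ^ n) * boundary f w)"
          unfolding elim(2,3) boundary_monomial twist_def by (simp add: mult_ac)
        also have "\<dots> = X w * cnj (w ^ n)"
          unfolding unimodular_cancel(1)[OF elim(4)] unimodular_cancel(1)[OF elim(5)] X_def elim(1)
          by (simp add: mult_ac)
        finally show ?case by simp
      qed
      show "integrable circle_measure (\<lambda>w. X w * cnj (w ^ n))"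
        by (intro L2_mult X L2_cnj L2_monomial)
      show "integrable circle_measure (\<lambda>w. twist u v \<phi> w * cnj (boundary (\<lambda>z. z ^ n * g z) w))"
        by (intro L2_mult twist_L2 L2_cnj boundary_L2 ui vi \<phi> ng)
    qed
    then show ?thesis using F ng by (simp add: orthogonal_hardy2_def)
  qed
  have "(\<integral>\<^sub>T w. boundary (\<lambda>z. \<phi> z * f z) w * cnj (boundary v w * boundary h w)) = 0" if "h \<in> hardy2" for h
    using orthogonal_to_monomials_imp_hardy2[OF X mono that] by (simp add: X_def mult_ac)
  then show ?thesis using P2 by (simp add: model_space_iff[OF vi])
qed

section \<open>Carleson measures and multipliers\<close>

abbreviation weight :: "(complex \<Rightarrow> complex) \<Rightarrow> complex measure" where
  "weight \<phi> \<equiv> density circle_measure (\<lambda>w. ennreal ((norm (boundary \<phi> w))\<^sup>2))"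

lemma carleson_iff:
  fixes \<phi> :: "complex \<Rightarrow> complex"
  assumes \<phi>: "\<phi> \<in> hardy2" and X: "X \<subseteq> hardy2"
  shows "carleson_measure_for (weight \<phi>) X \<longleftrightarrow>
    (\<exists>C. \<forall>f\<in>X. (\<integral>\<^sup>+w. ennreal ((norm (boundary \<phi> w * boundary f w))\<^sup>2) \<partial>circle_measure)
      \<le> ennreal (C * (hardy_norm f)\<^sup>2))"
proof -
  have "(\<integral>\<^sup>+w. ennreal ((norm (boundary f w))\<^sup>2) \<partial>weight \<phi>) =
      (\<integral>\<^sup>+w. ennreal ((norm (boundary \<phi> w * boundary f w))\<^sup>2) \<partial>circle_measure)" if "f \<in> X" for f
  proof -
    have [measurable]: "boundary f \<in> borel_measurable circle_measure" "boundary \<phi> \<in> borel_measurable circle_measure"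
      using that \<phi> X by (auto intro!: boundary_measurable hardy2_holomorphic)
    show ?thesis
      by (subst nn_integral_density) (auto simp: norm_mult power_mult_distrib ennreal_mult)
  qed
  then show ?thesis unfolding carleson_measure_for_def hardy_norm_def by simp
qed

lemma model_space_subset_hardy2: "model_space u \<subseteq> hardy2"
  by (auto simp: model_space_def)

lemma carleson_imp_L2:
  assumes \<phi>: "\<phi> \<in> hardy2" and X: "X \<subseteq> hardy2" and f: "f \<in> X"
    and C: "carleson_measure_for (weight \<phi>) X"
  shows "L2 (\<lambda>w. boundary \<phi> w * boundary f w)"
proof -
  obtain C where C: "(\<integral>\<^sup>+w. ennreal ((norm (boundary \<phi> w * boundary f w))\<^sup>2) \<partial>circle_measure) \<le> ennreal (C * (hardy_norm f)\<^sup>2)"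
    using C f unfolding carleson_iff[OF \<phi> X] by blast
  have [measurable]: "boundary f \<in> borel_measurable circle_measure" "boundary \<phi> \<in> borel_measurable circle_measure"
    using f \<phi> X by (auto intro!: boundary_measurable hardy2_holomorphic)
  have "integrable circle_measure (\<lambda>w. (norm (boundary \<phi> w * boundary f w))\<^sup>2)"
    by (rule integrableI_nonneg) (measurable, simp, rule order_le_less_trans[OF C], simp)
  then show ?thesis unfolding L2_def by simp
qed

lemma bounded_multiplication_imp_carleson:
  assumes \<phi>: "\<phi> \<in> hardy2" and X: "X \<subseteq> hardy2"
    and f: "\<And>f. f \<in> X \<Longrightarrow> L2 (\<lambda>w. boundary \<phi> w * boundary f w)"
    and C: "\<And>f. f \<in> X \<Longrightarrow> l2_norm (\<lambda>w. boundary \<phi> w * boundary f w) \<le> C * hardy_norm f"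
  shows "carleson_measure_for (weight \<phi>) X"
  unfolding carleson_iff[OF \<phi> X]
proof (intro exI ballI)
  fix f assume fX: "f \<in> X"
  have "(\<integral>\<^sup>+w. ennreal ((norm (boundary \<phi> w * boundary f w))\<^sup>2) \<partial>circle_measure) =
      ennreal ((l2_norm (\<lambda>w. boundary \<phi> w * boundary f w))\<^sup>2)"
    unfolding l2_norm_sq using f[OF fX] by (intro nn_integral_eq_integral) (auto simp: L2_def)
  also have "\<dots> \<le> ennreal ((C * hardy_norm f)\<^sup>2)"
    by (intro ennreal_leI power_mono C fX) simp
  finally show "(\<integral>\<^sup>+w. ennreal ((norm (boundary \<phi> w * boundary f w))\<^sup>2) \<partial>circle_measure) \<le> ennreal (C\<^sup>2 * (hardy_norm f)\<^sup>2)"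
    by (simp add: power_mult_distrib)
qed

lemma bounded_imp_carleson:
  assumes \<phi>: "\<phi> \<in> hardy_inf" and X: "X \<subseteq> hardy2"
  shows "carleson_measure_for (weight \<phi>) X"
proof -
  obtain B where B: "0 \<le> B" "AE w in circle_measure. norm (boundary \<phi> w) \<le> B"
    using boundary_hardy_inf_bounded[OF \<phi>] .
  have si: "L2 (\<lambda>w. boundary \<phi> w * boundary f w)" if "f \<in> X" for f
    using that X by (intro L2_mult_hardy_inf boundary_L2 \<phi>) auto
  show ?thesis
  proof (rule bounded_multiplication_imp_carleson[OF hardy_inf_imp_hardy2[OF \<phi>] X si])
    fix f assume f: "f \<in> X"
    show "l2_norm (\<lambda>w. boundary \<phi> w * boundary f w) \<le> B * hardy_norm f"
      unfolding hardy_norm_def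
    proof (rule l2_norm_le[OF _ _ _ B(1)])
      show "L2 (boundary f)" using f X by (auto intro: boundary_L2)
      show "(\<lambda>w. boundary \<phi> w * boundary f w) \<in> borel_measurable circle_measure"
        by (rule L2_measurable[OF si[OF f]])
      show "AE w in circle_measure. norm (boundary \<phi> w * boundary f w) \<le> B * norm (boundary f w)"
        using B(2) by eventually_elim (simp add: norm_mult mult_right_mono)
    qed
  qed
qed

lemma model_space_linear:
  assumes u: "u \<in> hardy_inf" and f: "f \<in> model_space u" and g: "g \<in> model_space u"
  shows "(\<lambda>z. f z + c * g z) \<in> model_space u"
proof -
  have fg: "f \<in> hardy2" "g \<in> hardy2" using f g model_space_subset_hardy2 by auto
  have cg: "(\<lambda>z. c * g z) \<in> hardy2" by (rule hardy2_cmult[OF fg(2)])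
  have s: "(\<lambda>z. f z + c * g z) \<in> hardy2" by (rule hardy2_add[OF fg(1) cg])
  have "(\<integral>\<^sub>T w. boundary (\<lambda>z. f z + c * g z) w * cnj (boundary u w * boundary h w)) = 0"
    if h: "h \<in> hardy2" for h
  proof -
    let ?W = "\<lambda>w. cnj (boundary u w * boundary h w)"
    have W: "L2 ?W" by (intro L2_cnj L2_mult_hardy_inf boundary_L2 h u)
    have i: "integrable circle_measure (\<lambda>w. boundary f w * ?W w)"
      "integrable circle_measure (\<lambda>w. c * (boundary g w * ?W w))"
      by (intro integrable_mult_right L2_mult boundary_L2 fg W)+
    have "(\<integral>\<^sub>T w. boundary (\<lambda>z. f z + c * g z) w * ?W w) =
      (\<integral>\<^sub>T w. boundary f w * ?W w + c * (boundary g w * ?W w))"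
    proof (rule circle_integral_eqI)
      show "AE w in circle_measure. boundary (\<lambda>z. f z + c * g z) w * ?W w =
        boundary f w * ?W w + c * (boundary g w * ?W w)"
        using fatou_radial_limits[OF fg(1)] fatou_radial_limits[OF fg(2)] fatou_radial_limits[OF cg]
        by eventually_elim (simp only: boundary_add boundary_cmult distrib_right mult.assoc)
    qed (intro L2_mult boundary_L2 s W Bochner_Integration.integrable_add i)+
    also have "\<dots> = 0"
      using f g h by (subst Bochner_Integration.integral_add[OF i]) (simp add: model_space_iff[OF u])
    finally show ?thesis .
  qed
  then show ?thesis using s by (simp add: model_space_iff[OF u])
qed

lemma model_space_subspace:
  assumes u: "u \<in> hardy_inf"
  shows "(\<lambda>_. 0) \<in> model_space u"
    "f \<in> model_space u \<Longrightarrow> g \<in> model_space u \<Longrightarrow> (\<lambda>z. f z + g z) \<in> model_space u"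
    "f \<in> model_space u \<Longrightarrow> (\<lambda>z. c * f z) \<in> model_space u"
proof -
  show 0: "(\<lambda>_. 0) \<in> model_space u" by (simp add: model_space_iff[OF u] const_hardy2 boundary_const)
  show "f \<in> model_space u \<Longrightarrow> g \<in> model_space u \<Longrightarrow> (\<lambda>z. f z + g z) \<in> model_space u"
    using model_space_linear[OF u, of f g 1] by simp
  show "f \<in> model_space u \<Longrightarrow> (\<lambda>z. c * f z) \<in> model_space u"
    using model_space_linear[OF u 0, of f c] by simp
qed

lemma model_space_closed:
  assumes u: "u \<in> hardy_inf" and x: "\<And>n. x n \<in> model_space u" and y: "y \<in> hardy2"
    and lim: "(\<lambda>n. hardy_norm (\<lambda>z. y z - x n z)) \<longlonglongrightarrow> 0"
  shows "y \<in> model_space u"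
proof -
  have x2: "x n \<in> hardy2" for n using x model_space_subset_hardy2 by auto
  have "(\<integral>\<^sub>T w. boundary y w * cnj (boundary u w * boundary h w)) = 0"
    if h: "h \<in> hardy2" for h
  proof -
    let ?W = "\<lambda>w. cnj (boundary u w * boundary h w)"
    have W: "L2 ?W"
      by (intro L2_cnj L2_mult_hardy_inf boundary_L2 h u)
    have le: "norm (\<integral>\<^sub>T w. boundary y w * ?W w) \<le> hardy_norm (\<lambda>z. y z - x n z) * l2_norm ?W" for n
    proof -
      have d: "(\<lambda>z. y z - x n z) \<in> hardy2" by (rule hardy2_diff[OF y x2])
      have i: "integrable circle_measure (\<lambda>w. boundary y w * ?W w)" "integrable circle_measure (\<lambda>w. boundary (x n) w * ?W w)"
        by (intro L2_mult boundary_L2 y x2 W)+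
      have "(\<integral>\<^sub>T w. boundary (\<lambda>z. y z - x n z) w * ?W w) =
          (\<integral>\<^sub>T w. boundary y w * ?W w - boundary (x n) w * ?W w)"
      proof (rule circle_integral_eqI)
        show "AE w in circle_measure. boundary (\<lambda>z. y z - x n z) w * ?W w = boundary y w * ?W w - boundary (x n) w * ?W w"
          using fatou_radial_limits[OF y] fatou_radial_limits[OF x2[of n]]
          by eventually_elim (simp only: boundary_diff left_diff_distrib)
      qed (intro L2_mult boundary_L2 d W Bochner_Integration.integrable_diff i)+
      also have "\<dots> = (\<integral>\<^sub>T w. boundary y w * ?W w)"
        using x[of n] h by (subst Bochner_Integration.integral_diff[OF i]) (simp add: model_space_iff[OF u])
      finally show ?thesis
        using l2_inner_bound[OF boundary_L2[OF d] W] by (simp only: hardy_norm_def)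
    qed
    have "(\<lambda>n. hardy_norm (\<lambda>z. y z - x n z) * l2_norm ?W) \<longlonglongrightarrow> 0 * l2_norm ?W"
      by (intro tendsto_intros lim)
    then have "norm (\<integral>\<^sub>T w. boundary y w * ?W w) \<le> 0 * l2_norm ?W"
      by (rule LIMSEQ_le_const) (intro exI allI impI le)
    then show ?thesis by simp
  qed
  then show ?thesis using y by (simp add: model_space_iff[OF u])
qed

text \<open>The seminorms \<open>f \<mapsto> \<parallel>(\<phi> f)(r \<cdot>)\<parallel>\<close> with \<open>r < 1\<close> are continuous, since \<open>\<phi>\<close> is bounded on the circle of
  radius \<open>r\<close>, and for each \<open>f\<close> they are bounded by the norm of \<open>\<phi> f\<close>. By the uniform boundedness principle
  multiplication by \<open>\<phi>\<close> is a bounded operator on the model space.\<close>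

lemma multiplier_imp_carleson:
  assumes u: "u \<in> hardy_inf" and \<phi>: "\<phi> \<in> hardy2"
    and mult: "\<And>f. f \<in> model_space u \<Longrightarrow> (\<lambda>z. \<phi> z * f z) \<in> hardy2"
  shows "carleson_measure_for (weight \<phi>) (model_space u)"
proof -
  note sub = model_space_subset_hardy2[of u]
  define p where "p k f = l2_norm (\<lambda>w. \<phi> (of_real (radius k) * w) * f (of_real (radius k) * w))" for k f
  have hol: "f holomorphic_on ball 0 1" if "f \<in> model_space u" for f using that sub hardy2_holomorphic by auto
  have si: "L2 (\<lambda>w. \<phi> (of_real (radius k) * w) * f (of_real (radius k) * w))"
    if "f \<in> model_space u" for k f
    using dilation_L2[OF hardy2_holomorphic[OF mult[OF that]] radius_bounds(1,2)] .
  have "\<exists>B\<ge>0. \<forall>f\<in>model_space u. p k f \<le> B * hardy_norm f" for k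
  proof -
    have "bounded ((\<lambda>w. \<phi> (of_real (radius k) * w)) ` sphere 0 1)"
      by (intro compact_imp_bounded compact_continuous_image dilation_continuous_sphere hardy2_holomorphic \<phi> radius_bounds) simp
    then obtain B where B: "\<And>w. w \<in> sphere 0 1 \<Longrightarrow> norm (\<phi> (of_real (radius k) * w)) \<le> B"
      unfolding bounded_iff by (metis imageI)
    have B0: "0 \<le> B" using order_trans[OF norm_ge_zero B[of 1]] by simp
    have "p k f \<le> B * hardy_norm f" if f: "f \<in> model_space u" for f
    proof -
      have "p k f \<le> B * l2_norm (\<lambda>w. f (of_real (radius k) * w))"
        unfolding p_def
        by (intro l2_norm_le dilation_L2 hol f radius_bounds L2_measurable si B0 AE_I2)
          (simp add: norm_mult mult_right_mono B)
      also have "\<dots> \<le> B * hardy_norm f"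
        using f sub by (intro mult_left_mono dilation_norm_le radius_bounds B0) auto
      finally show ?thesis .
    qed
    then show ?thesis using B0 by blast
  qed
  then obtain A where A: "\<And>k f. f \<in> model_space u \<Longrightarrow> p k f \<le> A k * hardy_norm f" by metis
  have "\<exists>C. \<forall>f\<in>model_space u. \<forall>k. p k f \<le> C * hardy_norm f"
  proof (rule hardy2_uniform_boundedness[where A = A, OF sub])
    show "p k (\<lambda>z. f z + g z) \<le> p k f + p k g" if "f \<in> model_space u" "g \<in> model_space u" for k f g
      using l2_norm_triangle[OF si[OF that(1)] si[OF that(2)]] by (simp only: p_def distrib_left)
    show "p k (\<lambda>z. c * f z) = norm c * p k f" for k f c
      unfolding p_def by (simp only: mult.left_commute l2_norm_cmult)
    show "\<exists>M. \<forall>k. p k f \<le> M" if "f \<in> model_space u" for f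
      unfolding p_def using dilation_norm_le[OF mult[OF that] radius_bounds(1,2)] by blast
    show "y \<in> model_space u" if "\<And>n. x n \<in> model_space u" "y \<in> hardy2"
      "(\<lambda>n. hardy_norm (\<lambda>z. y z - x n z)) \<longlonglongrightarrow> 0" for x y
      by (rule model_space_closed[OF u that])
  qed (intro model_space_subspace u A; assumption)+
  then obtain C where C: "\<And>f k. f \<in> model_space u \<Longrightarrow> p k f \<le> C * hardy_norm f" by blast
  have bd: "AE w in circle_measure. boundary (\<lambda>z. \<phi> z * f z) w = boundary \<phi> w * boundary f w"
    if "f \<in> model_space u" for f using that sub by (intro boundary_mult_AE \<phi>) auto
  have meas: "(\<lambda>w. boundary \<phi> w * boundary f w) \<in> borel_measurable circle_measure" if "f \<in> model_space u" for f
    using that by (intro borel_measurable_times boundary_measurable hardy2_holomorphic[OF \<phi>] hol)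
  show ?thesis
  proof (rule bounded_multiplication_imp_carleson[OF \<phi> sub])
    fix f assume f: "f \<in> model_space u"
    note P = boundary_L2[OF mult[OF f]]
    show "L2 (\<lambda>w. boundary \<phi> w * boundary f w)"
      by (rule L2_mono[OF meas[OF f] L2_integrable[OF P]])
        (use bd[OF f] in \<open>auto elim: eventually_mono\<close>)
    have "l2_norm (\<lambda>w. boundary \<phi> w * boundary f w) = l2_norm (boundary (\<lambda>z. \<phi> z * f z))"
      by (rule l2_norm_cong_AE[OF meas[OF f] L2_measurable[OF P]])
        (use bd[OF f] in \<open>auto elim: eventually_mono\<close>)
    also have "\<dots> \<le> C * hardy_norm f"
      by (rule LIMSEQ_le_const2[OF dilation_norm_tendsto[OF mult[OF f]]])
        (intro exI allI impI C[unfolded p_def] f)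
    finally show "l2_norm (\<lambda>w. boundary \<phi> w * boundary f w) \<le> C * hardy_norm f" .
  qed
qed

text \<open>On the circle \<open>|S* u| = |u - u(0)| \<ge> 1 - |u(0)| > 0\<close>.\<close>

lemma shift_product_bounded_imp_bounded:
  assumes u: "inner_function u" "\<not> u constant_on ball 0 1" and \<phi>: "\<phi> \<in> hardy2"
    and P: "(\<lambda>z. \<phi> z * backward_shift u z) \<in> hardy_inf"
  shows "\<phi> \<in> hardy_inf"
proof -
  let ?P = "\<lambda>z. \<phi> z * backward_shift u z"
  have ui: "u \<in> hardy_inf" using u by (auto intro: inner_function_hardy_inf)
  note u2 = hardy_inf_imp_hardy2[OF ui]
  note S2 = hardy_inf_imp_hardy2[OF backward_shift_hardy_inf[OF ui]]
  obtain B where B: "AE w in circle_measure. norm (boundary ?P w) \<le> B"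
    using boundary_hardy_inf_bounded[OF P] .
  define d where "d = 1 - norm (u 0)"
  have d: "0 < d" using inner_function_strict[OF u] by (simp add: d_def)
  have "AE w in circle_measure. norm (boundary \<phi> w) \<le> B / d"
    using B boundary_mult_AE[OF \<phi> S2] fatou_radial_limits[OF u2] inner_function_unimodular[OF u(1)] AE_circle
  proof eventually_elim
    case (elim w)
    have "norm (boundary \<phi> w) * d \<le> norm (boundary \<phi> w) * norm (boundary u w - u 0)"
      using norm_triangle_ineq2[of "boundary u w" "u 0"] elim by (intro mult_left_mono) (auto simp: d_def)
    also have "\<dots> = norm (boundary ?P w)"
      unfolding elim(2) boundary_backward_shift(2)[OF elim(3,5)] by (simp add: norm_mult elim(5))
    finally show ?case using elim(1) d by (simp add: field_simps)
  qed
  then have "norm (\<phi> z) \<le> B / d" if "z \<in> ball 0 1" for z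
    by (rule boundary_bounded_imp_bounded[OF \<phi> _ that])
  then show ?thesis using hardy2_holomorphic[OF \<phi>] unfolding hardy_inf_def bounded_iff by blast
qed

theorem theorem3p1:
  fixes u v \<phi> :: "complex \<Rightarrow> complex"
  assumes "inner_function u" and "inner_function v"
    and "\<not> u constant_on ball 0 1"
    and "\<phi> \<in> hardy2"
  defines "\<mu> \<equiv> density circle_measure (\<lambda>\<zeta>. ennreal ((norm (boundary \<phi> \<zeta>))\<^sup>2))"
    and "\<psi> \<equiv> (\<lambda>\<zeta>. cnj (\<zeta> * boundary v \<zeta>) * boundary u \<zeta>)"
  shows "((\<phi> \<in> multipliers u v \<longleftrightarrow>
            (\<lambda>z. \<phi> z * backward_shift u z) \<in> model_space v \<and>
            carleson_measure_for \<mu> (model_space u)) \<and>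
          (\<phi> \<in> multipliers u v \<longleftrightarrow>
            \<phi> \<in> toeplitz_kernel \<psi> \<and> carleson_measure_for \<mu> (model_space u))) \<and>
         ((\<phi> \<in> multipliers u v \<inter> hardy_inf \<longleftrightarrow>
            (\<lambda>z. \<phi> z * backward_shift u z) \<in> model_space v \<inter> hardy_inf) \<and>
          (\<phi> \<in> multipliers u v \<inter> hardy_inf \<longleftrightarrow>
            \<phi> \<in> toeplitz_kernel \<psi> \<inter> hardy_inf))"
proof -
  note u = assms(1) and v = assms(2) and nc = assms(3) and \<phi> = assms(4)
  have ui: "u \<in> hardy_inf" and vi: "v \<in> hardy_inf" using u v by (auto intro: inner_function_hardy_inf)
  let ?shift = "(\<lambda>z. \<phi> z * backward_shift u z) \<in> model_space v"
  let ?carleson = "carleson_measure_for \<mu> (model_space u)"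
  have kernel: "\<phi> \<in> toeplitz_kernel \<psi> \<longleftrightarrow> orthogonal_hardy2 (twist u v \<phi>)"
    unfolding \<psi>_def by (rule toeplitz_kernel_iff[OF ui vi \<phi>])
  have shift_iff: "?shift \<longleftrightarrow> orthogonal_hardy2 (twist u v \<phi>)"
    using orthogonal_imp_shift_in_model_space[OF u v \<phi>] shift_in_model_space_imp_orthogonal[OF u nc v \<phi>] by blast
  have mult_shift: ?shift if "\<phi> \<in> multipliers u v"
    using that backward_shift_in_model_space[OF u] by (simp add: multipliers_def)
  have mult_carleson: ?carleson if "\<phi> \<in> multipliers u v"
    unfolding \<mu>_def
  proof (rule multiplier_imp_carleson[OF ui \<phi>])
    fix f assume "f \<in> model_space u"
    then show "(\<lambda>z. \<phi> z * f z) \<in> hardy2" using that model_space_subset_hardy2 by (auto simp: multipliers_def)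
  qed
  have mult: "\<phi> \<in> multipliers u v" if "orthogonal_hardy2 (twist u v \<phi>)" ?carleson
    unfolding multipliers_def
  proof (intro CollectI conjI ballI)
    show "\<phi> holomorphic_on ball 0 1" by (rule hardy2_holomorphic[OF \<phi>])
    fix f assume f: "f \<in> model_space u"
    show "(\<lambda>z. \<phi> z * f z) \<in> model_space v"
      by (rule orthogonal_imp_product_in_model_space[OF u v \<phi> that(1) f
            carleson_imp_L2[OF \<phi> model_space_subset_hardy2 f that(2)[unfolded \<mu>_def]]])
  qed
  have bounded: ?carleson if "\<phi> \<in> hardy_inf"
    unfolding \<mu>_def by (rule bounded_imp_carleson[OF that model_space_subset_hardy2])
  have shift_bounded: "(\<lambda>z. \<phi> z * backward_shift u z) \<in> hardy_inf \<longleftrightarrow> \<phi> \<in> hardy_inf"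
    using shift_product_bounded_imp_bounded[OF u nc \<phi>] hardy_inf_mult[OF _ backward_shift_hardy_inf[OF ui]] by blast
  show ?thesis
    using kernel shift_iff mult_shift mult_carleson mult bounded shift_bounded by blast
qed

end
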